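(* Consider the bilevel problem $\min_{x}\Phi(x)=f(x,y^*(x))$, $y^*(x)=\arg\min_y g(x,y)$, and suppose Assumptions A1, A2, A3, A4 of the context hold. Let $S_2$ (a batch size independent of $\epsilon$), $T$, $J$ be any given positive integers. Run ALS-STORM, i.e. the algorithm of the context with $q_1=K$, with $0<\lambda_1\le 1/(2L_g+2\mu)$, $0<\lambda_2\le1/(2L_g+2\mu)$, $\beta=C_\beta\alpha$, $\eta=C_\eta\alpha$, $\tau^x=C_{\eta x}\alpha^2$, $\tau^y=C_{\eta y}\alpha^2$, $\tau^v=C_{\eta v}\alpha^2$, $S_1=O(\epsilon^{-0.5})$, where $$C_\eta=\frac{48(L_g^2+C_v^2)}{\mu\lambda_2},\qquad C_\beta=\max\Big\{\frac{96C_y^2+8\bar M_1}{\mu\lambda_1},\ \frac{128\bar M_1JC_\eta\lambda_2}{\mu^2\lambda_1}\Big\},$$ $$C_{\eta x}=\frac{C_7}{S_2},\qquad C_{\eta y}=\frac{C_7\lambda_1C_\beta T}{\mu S_2},\qquad C_{\eta v}=\frac{C_7\lambda_2C_\eta J}{\mu S_2},$$ $$\alpha=\min\Big\{\sqrt{\tfrac{S_2\epsilon}{16\tilde P_6}},\ \sqrt{\tfrac{(1/2)^{2(T+J+4)}\mu S_2}{\lambda_2L_g^2C_\eta^2J+TC_\beta C_3C_6}},\ \tfrac1{32}\sqrt{\tfrac{\mu}{C_6(S_2^{-1}C_3+1+C_y^2)}},\ \sqrt{\tfrac{S_2}{C_7}},\ \tfrac1{C_8}\Big\},$$ with $C_3=J^2+J^2M^2+2T^2$,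 $C_6=L_g^2\lambda_1C_\beta+\bar M_1\lambda_2C_\eta$, $C_7=2^{2(T+J)+11}\big[L_g^2C_\eta+(\bar M_1+L_g^2)(1+TC_\beta)\big]$, $C_8=1+6L_\Phi+C_\beta+C_\eta+\sqrt{C_{\eta x}}+\sqrt{C_{\eta y}}+\sqrt{C_{\eta v}}$, $$\tilde P_6=(C_{\eta x}^2+C_{\eta y}^2+C_{\eta v}^2)\Big(1+P_6+\frac8\mu\lambda_1C_\beta C_3+\frac8\mu\lambda_2C_\eta J\Big)C_3(\sigma_f^2+\sigma_g^2+\sigma_{gxy}^2+\sigma_{gyy}^2),$$ $$P_6=\min\Big\{\frac{S_2}{32(\bar M_1+L_g^2)},\ \frac{(1/2)^{2T+2}S_2}{TC_\beta(\bar M_1+L_g^2)},\ \frac{(1/2)^{2J-1}S_2}{24L_g^2C_\eta}\Big\}.$$ Then (for a suitable number $K$ of outer iterations and suitable $S_1=O(\epsilon^{-0.5})$) ALS-STORM achieves an $\epsilon$-stationary point of the bilevel problem with a sample complexity of $O(\epsilon^{-1.5})$.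
   Context: Problem. $f(x,y)=\mathbb{E}_\xi[F(x,y;\xi)]$ and $g(x,y)=\mathbb{E}_\zeta[G(x,y;\zeta)]$ for $x\in\mathbb{R}^p$, $y\in\mathbb{R}^q$; $y^*(x)=\arg\min_{y\in\mathbb{R}^q}g(x,y)$; $\Phi(x)=f(x,y^*(x))$. $\|\cdot\|$ is the Euclidean norm for vectors and the spectral norm for matrices. $\nabla_x\nabla_y g$ is the Jacobian of $\nabla_x g$ with respect to $y$, $\nabla_y^2 g$ the Hessian in $y$. $\epsilon$-stationary point and complexity. A (random) point $\bar x$ is an $\epsilon$-stationary point if $\mathbb{E}\|\nabla\Phi(\bar x)\|^2\le\epsilon$. The output of the algorithm is $\bar x$ chosen uniformly at random from $\{x_0,\dots,x_{K-1}\}$. Sample complexity is the total number of evaluations of the stochastic gradients $\nabla_xF(x,y;\xi)$, $\nabla_yF(x,y;\xi)$, $\nabla_yG(x,y;\zeta)$, stochastic Jacobian-vector products $\nabla_x\nabla_yG(x,y;\zeta)v$ and stochastic Hessian-vector products $\nabla_y^2G(x,y;\zeta)v$. The $O(\cdot)$ is as $\epsilon\to0$, with constants independent of $\epsilon$. Assumption A1. For every $\xi,\zeta$: $f$, $F(\cdot,\cdot;\xi)$ are continuously differentiable and $g$, $G(\cdot,\cdot;\zeta)$ twice continuously differentiable on $\mathbb{R}^p\times\mathbb{R}^q$; for every $x,\zeta$, $g(x,\cdot)$ and $G(x,\cdot;\zeta)$ are $\mu$-strongly convex ($\mu>0$); $\Phi$ is nonconvex and $\inf_x\Phi(x)>-\infty$.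 Assumption A2. (a) $f$ and $\nabla f$ are Lipschitz in $(x,y)$ with constants $C_f$ and $L_f$. (b) $\nabla g$, $\nabla_x\nabla_yg$, $\nabla_y^2g$ are Lipschitz in $(x,y)$ with constants $L_g$, $L_{gxy}$, $L_{gyy}$. Assumption A3. $\nabla F(x,y;\xi)$, $\nabla G(x,y;\zeta)$, $\nabla_x\nabla_yG(x,y;\zeta)$, $\nabla_y^2G(x,y;\zeta)$ are unbiased estimates of $\nabla f$, $\nabla g$, $\nabla_x\nabla_yg$, $\nabla_y^2g$ at $(x,y)$, and $\mathbb{E}\|\nabla F-\nabla f\|^2\le\sigma_f^2$, $\mathbb{E}\|\nabla G-\nabla g\|^2\le\sigma_g^2$, $\mathbb{E}\|\nabla_x\nabla_yG-\nabla_x\nabla_yg\|^2\le\sigma_{gxy}^2$, $\mathbb{E}\|\nabla_y^2G-\nabla_y^2g\|^2\le\sigma_{gyy}^2$ for all $(x,y)$. Assumption A4. For all $\xi,\zeta$, $F(\cdot,\cdot;\xi)$ and $G(\cdot,\cdot;\zeta)$ satisfy the same conditions as $f$ and $g$ in A2 (same constants). Constants. $M\ge C_f/\mu$ is fixed, $\Omega=\{v\in\mathbb{R}^q:\|v\|\le M\}$, $L_{gg}=\max\{L_{gxy},L_{gyy}\}$, $\bar M_1=4L_f^2+4M^2L_{gg}^2$, $C_y=L_g/\mu$, $C_v=\big(\frac{L_f}{\mu}+\frac{C_fL_{gg}}{\mu^2}\big)\big(1+\frac{L_g}{\mu}\big)$, and $L_\Phi=L_f+\frac{2L_fL_g+C_fL_{gg}}{\mu}+\frac{L_fL_g^2+2C_fL_gL_{gg}}{\mu^2}+\frac{C_fL_g^2L_{gg}}{\mu^3}$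 (a Lipschitz constant of $\nabla\Phi$). Directions. $D_y(x,y)=\nabla_yg(x,y)$, $D_v(x,y,v)=\nabla_y^2g(x,y)v-\nabla_yf(x,y)$, $D_x(x,y,v)=\nabla_xf(x,y)-\nabla_x\nabla_yg(x,y)v$. A single-sample version replaces $f,g$ by $F(\cdot;\xi_i),G(\cdot;\zeta_i)$ with $\xi_i,\zeta_i$ fresh samples of $\xi,\zeta$ (for $D_y$ only $\zeta_i$); for a sample set $\mathcal S$, $D_\bullet(\cdot;\mathcal S)$ is the average of the single-sample versions over $\mathcal S$. Algorithm (parameters: positive integers $K,T,J,q_1,S_1,S_2$; stepsizes $\lambda_1,\lambda_2,\alpha,\beta,\eta>0$; $\tau^x,\tau^y,\tau^v$, which for ALS-STORM lie in $(0,1)$; initial $x_0\in\mathbb{R}^p$, $y_0\in\mathbb{R}^q$, $v_0\in\Omega$). All sample sets drawn are fresh and consist of mutually independent samples, and sets drawn are mutually independent. For $k=0,\dots,K-1$: 1. If $k\equiv0\pmod{q_1}$ (for $q_1=K$: only $k=0$), draw sample sets $\mathcal S_{1,x},\mathcal S_{1,y},\mathcal S_{1,v}$ of size $S_1$ and set $D_k^x=D_x(x_k,y_k,v_k;\mathcal S_{1,x})$, $D_k^y=D_y(x_k,y_k;\mathcal S_{1,y})$, $D_k^v=D_v(x_k,y_k,v_k;\mathcal S_{1,v})$. Otherwise set $D_k^x=D_{k-1,J-1}^x$, $D_k^y=D_{k-1,T-1}^y$, $D_k^v=D_{k-1,J-1}^v$. 2. $x_{k+1}=x_k-\alpha D_k^x$.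 3. Put $\bar x_{k,-1}=x_k$, $\bar y_{k,-1}=y_k$, $D_{k,-1}^y=D_k^y$, and $\bar x_{k,t}=x_{k+1}$ for $t\ge0$. For $t=0,\dots,T-1$: $\bar y_{k,t}=\bar y_{k,t-1}-\lambda_1\beta D_{k,t-1}^y$; draw a sample set $\mathcal S_{2,y}$ of size $S_2$; $D_{k,t}^y=D_y(\bar x_{k,t},\bar y_{k,t};\mathcal S_{2,y})+(1-\tau^y)\big(D_{k,t-1}^y-D_y(\bar x_{k,t-1},\bar y_{k,t-1};\mathcal S_{2,y})\big)$. Set $y_{k+1}=\bar y_{k,T-1}$. 4. Put $(x_{k,-1},y_{k,-1},v_{k,-1})=(x_k,y_k,v_k)$, $D_{k,-1}^x=D_k^x$, $D_{k,-1}^v=D_k^v$, and $x_{k,j}=x_{k+1}$, $y_{k,j}=y_{k+1}$ for $j\ge0$. For $j=0,\dots,J-1$: $v_{k,j}=\mathrm{proj}_\Omega(v_{k,j-1}-\lambda_2\eta D_{k,j-1}^v)$ (Euclidean projection); draw sample sets $\mathcal S_{2,x},\mathcal S_{2,v}$ of size $S_2$; with $u_{k,j}=(x_{k,j},y_{k,j},v_{k,j})$, $D_{k,j}^x=D_x(u_{k,j};\mathcal S_{2,x})+(1-\tau^x)\big(D_{k,j-1}^x-D_x(u_{k,j-1};\mathcal S_{2,x})\big)$ and $D_{k,j}^v=D_v(u_{k,j};\mathcal S_{2,v})+(1-\tau^v)\big(D_{k,j-1}^v-D_v(u_{k,j-1};\mathcal S_{2,v})\big)$. Set $v_{k+1}=v_{k,J-1}$.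 *)

theory Defs
  imports "HOL-Probability.Probability" "HOL-Library.Landau_Symbols"
begin

definition gradient :: "('a::real_inner \<Rightarrow> real) \<Rightarrow> 'a \<Rightarrow> 'a"
  where "gradient f z = (THE D. GDERIV f z :> D)"

definition C1 :: "('a::real_normed_vector \<Rightarrow> 'b::real_normed_vector) \<Rightarrow> bool"
  where "C1 f \<longleftrightarrow> (\<exists>f'. (\<forall>z. (f has_derivative blinfun_apply (f' z)) (at z)) \<and> continuous_on UNIV f')"

definition C2 :: "('a::real_normed_vector \<Rightarrow> 'b::real_normed_vector) \<Rightarrow> bool"
  where "C2 f \<longleftrightarrow> (\<exists>f'. (\<forall>z. (f has_derivative blinfun_apply (f' z)) (at z)) \<and> C1 f')"

text \<open>
  A function of \<open>(x, y)\<close> is a function on the product type, whose norm is the Euclidean norm of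
  the concatenated vector; \<^const>\<open>gradient\<close> on the product type is the full gradient.
\<close>

definition grad_x :: "((real^'p) \<times> (real^'q) \<Rightarrow> real) \<Rightarrow> (real^'p) \<times> (real^'q) \<Rightarrow> real^'p"
  where "grad_x h z = gradient (\<lambda>x. h (x, snd z)) (fst z)"

definition grad_y :: "((real^'p) \<times> (real^'q) \<Rightarrow> real) \<Rightarrow> (real^'p) \<times> (real^'q) \<Rightarrow> real^'q"
  where "grad_y h z = gradient (\<lambda>y. h (fst z, y)) (snd z)"

definition jac_xy :: "((real^'p) \<times> (real^'q) \<Rightarrow> real) \<Rightarrow> (real^'p) \<times> (real^'q) \<Rightarrow> real^'q^'p"
  where "jac_xy h z = jacobian (\<lambda>y. grad_x h (fst z, y)) (at (snd z))"

definition hess_yy :: "((real^'p) \<times> (real^'q) \<Rightarrow> real) \<Rightarrow> (real^'p) \<times> (real^'q) \<Rightarrow> real^'q^'q"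
  where "hess_yy h z = jacobian (\<lambda>y. grad_y h (fst z, y)) (at (snd z))"

text \<open>The library norm on matrices is the Frobenius norm, so the spectral norm is introduced separately.\<close>

definition spectral_norm :: "real^'n^'m \<Rightarrow> real"
  where "spectral_norm A = onorm (\<lambda>v. A *v v)"

definition spectral_lipschitz :: "real \<Rightarrow> ('a::metric_space \<Rightarrow> real^'n^'m) \<Rightarrow> bool"
  where "spectral_lipschitz L A \<longleftrightarrow> 0 \<le> L \<and> (\<forall>z z'. spectral_norm (A z - A z') \<le> L * dist z z')"

definition strongly_convex :: "real \<Rightarrow> ('a::real_inner \<Rightarrow> real) \<Rightarrow> bool"
  where "strongly_convex \<mu> h \<longleftrightarrow>
    (\<forall>a b. \<forall>t\<in>{0..1}. h ((1 - t) *\<^sub>R a + t *\<^sub>R b)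
        \<le> (1 - t) * h a + t * h b - \<mu> / 2 * t * (1 - t) * (norm (a - b))\<^sup>2)"

definition lower_solution :: "((real^'p) \<times> (real^'q) \<Rightarrow> real) \<Rightarrow> real^'p \<Rightarrow> real^'q"
  where "lower_solution g x = arg_min (\<lambda>y. g (x, y)) (\<lambda>_. True)"

definition hyper_objective ::
    "((real^'p) \<times> (real^'q) \<Rightarrow> real) \<Rightarrow> ((real^'p) \<times> (real^'q) \<Rightarrow> real) \<Rightarrow> real^'p \<Rightarrow> real"
  where "hyper_objective f g x = f (x, lower_solution g x)"

definition is_expectation_of :: "('b \<Rightarrow> real) \<Rightarrow> 's measure \<Rightarrow> ('s \<Rightarrow> 'b \<Rightarrow> real) \<Rightarrow> bool"
  where "is_expectation_of h N H \<longleftrightarrow>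
    (\<forall>z. integrable N (\<lambda>s. H s z) \<and> h z = (\<integral>s. H s z \<partial>N))"

definition problem_regularity ::
    "'a measure \<Rightarrow> 'b measure \<Rightarrow> ('a \<Rightarrow> (real^'p) \<times> (real^'q) \<Rightarrow> real) \<Rightarrow>
     ('b \<Rightarrow> (real^'p) \<times> (real^'q) \<Rightarrow> real) \<Rightarrow>
     ((real^'p) \<times> (real^'q) \<Rightarrow> real) \<Rightarrow> ((real^'p) \<times> (real^'q) \<Rightarrow> real) \<Rightarrow> real \<Rightarrow> bool"
  where "problem_regularity Mxi Mzeta F G f g \<mu> \<longleftrightarrow>
    C1 f \<and> (\<forall>\<xi>\<in>space Mxi. C1 (F \<xi>)) \<and>
    C2 g \<and> (\<forall>\<zeta>\<in>space Mzeta. C2 (G \<zeta>)) \<and>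
    0 < \<mu> \<and>
    (\<forall>x. strongly_convex \<mu> (\<lambda>y. g (x, y))) \<and>
    (\<forall>\<zeta>\<in>space Mzeta. \<forall>x. strongly_convex \<mu> (\<lambda>y. G \<zeta> (x, y))) \<and>
    \<not> convex_on UNIV (hyper_objective f g) \<and>
    bdd_below (range (hyper_objective f g))"

definition upper_lipschitz :: "real \<Rightarrow> real \<Rightarrow> ((real^'p) \<times> (real^'q) \<Rightarrow> real) \<Rightarrow> bool"
  where "upper_lipschitz Cf Lf f \<longleftrightarrow> Cf-lipschitz_on UNIV f \<and> Lf-lipschitz_on UNIV (gradient f)"

definition lower_lipschitz :: "real \<Rightarrow> real \<Rightarrow> real \<Rightarrow> ((real^'p) \<times> (real^'q) \<Rightarrow> real) \<Rightarrow> bool"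
  where "lower_lipschitz Lg Lgxy Lgyy g \<longleftrightarrow>
    Lg-lipschitz_on UNIV (gradient g) \<and>
    spectral_lipschitz Lgxy (jac_xy g) \<and> spectral_lipschitz Lgyy (hess_yy g)"

text \<open>
  \<open>nrm\<close> is the norm in which the variance is measured. Integrability is demanded explicitly
  because the Bochner integral of a non-integrable function is \<open>0\<close>.
\<close>

definition unbiased_estimate ::
    "('e \<Rightarrow> real) \<Rightarrow> 's measure \<Rightarrow> ('s \<Rightarrow> 'e::{banach,second_countable_topology}) \<Rightarrow> 'e \<Rightarrow> real \<Rightarrow> bool"
  where "unbiased_estimate nrm N H h \<sigma> \<longleftrightarrow>
    integrable N H \<and> (\<integral>s. H s \<partial>N) = h \<and>
    integrable N (\<lambda>s. (nrm (H s - h))\<^sup>2) \<and> (\<integral>s. (nrm (H s - h))\<^sup>2 \<partial>N) \<le> \<sigma>\<^sup>2"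

definition stochastic_oracles ::
    "'a measure \<Rightarrow> 'b measure \<Rightarrow> ('a \<Rightarrow> (real^'p) \<times> (real^'q) \<Rightarrow> real) \<Rightarrow>
     ('b \<Rightarrow> (real^'p) \<times> (real^'q) \<Rightarrow> real) \<Rightarrow>
     ((real^'p) \<times> (real^'q) \<Rightarrow> real) \<Rightarrow> ((real^'p) \<times> (real^'q) \<Rightarrow> real) \<Rightarrow>
     real \<Rightarrow> real \<Rightarrow> real \<Rightarrow> real \<Rightarrow> bool"
  where "stochastic_oracles Mxi Mzeta F G f g \<sigma>f \<sigma>g \<sigma>gxy \<sigma>gyy \<longleftrightarrow>
    (\<forall>z. unbiased_estimate norm Mxi (\<lambda>\<xi>. gradient (F \<xi>) z) (gradient f z) \<sigma>f \<and>
         unbiased_estimate norm Mzeta (\<lambda>\<zeta>. gradient (G \<zeta>) z) (gradient g z) \<sigma>g \<and>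
         unbiased_estimate spectral_norm Mzeta (\<lambda>\<zeta>. jac_xy (G \<zeta>) z) (jac_xy g z) \<sigma>gxy \<and>
         unbiased_estimate spectral_norm Mzeta (\<lambda>\<zeta>. hess_yy (G \<zeta>) z) (hess_yy g z) \<sigma>gyy)"

definition dir_x ::
    "((real^'p) \<times> (real^'q) \<Rightarrow> real) \<Rightarrow> ((real^'p) \<times> (real^'q) \<Rightarrow> real) \<Rightarrow>
     (real^'p) \<times> (real^'q) \<Rightarrow> real^'q \<Rightarrow> real^'p"
  where "dir_x f g z v = grad_x f z - jac_xy g z *v v"

definition dir_y :: "((real^'p) \<times> (real^'q) \<Rightarrow> real) \<Rightarrow> (real^'p) \<times> (real^'q) \<Rightarrow> real^'q"
  where "dir_y g z = grad_y g z"

definition dir_v ::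
    "((real^'p) \<times> (real^'q) \<Rightarrow> real) \<Rightarrow> ((real^'p) \<times> (real^'q) \<Rightarrow> real) \<Rightarrow>
     (real^'p) \<times> (real^'q) \<Rightarrow> real^'q \<Rightarrow> real^'q"
  where "dir_v f g z v = hess_yy g z *v v - grad_y f z"

definition batch_mean :: "nat \<Rightarrow> (nat \<Rightarrow> 'e::real_vector) \<Rightarrow> 'e"
  where "batch_mean n d = (1 / real n) *\<^sub>R (\<Sum>i<n. d i)"

text \<open>
  The parameters in the usual notation:
  \<open>period\<close> \<open>= q\<^sub>1\<close>, \<open>y_iters\<close> \<open>= T\<close>, \<open>v_iters\<close> \<open>= J\<close>, \<open>batch_init\<close> \<open>= S\<^sub>1\<close>, \<open>batch_inner\<close> \<open>= S\<^sub>2\<close>,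
  \<open>rate_y\<close> \<open>= \<lambda>\<^sub>1\<close>, \<open>rate_v\<close> \<open>= \<lambda>\<^sub>2\<close>, \<open>step_x\<close> \<open>= \<alpha>\<close>, \<open>step_y\<close> \<open>= \<beta>\<close>, \<open>step_v\<close> \<open>= \<eta>\<close>,
  \<open>mom_x\<close>, \<open>mom_y\<close>, \<open>mom_v\<close> \<open>= \<tau>\<^sup>x, \<tau>\<^sup>y, \<tau>\<^sup>v\<close>, and \<open>radius\<close> \<open>= M\<close>.
\<close>

record als_params =
  period :: nat
  y_iters :: nat
  v_iters :: nat
  batch_init :: nat
  batch_inner :: nat
  rate_y :: real
  rate_v :: real
  step_x :: real
  step_y :: real
  step_v :: real
  mom_x :: real
  mom_y :: real
  mom_v :: real
  radius :: real

text \<open>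
  Names of the sample sets: \<open>Init_* k\<close> is drawn at the (re)initialisation in outer iteration \<open>k\<close>,
  and \<open>Inner_* k n\<close> in inner step \<open>n\<close> of outer iteration \<open>k\<close>. The \<open>i\<close>-th sample of a set is a
  pair \<open>(\<xi>\<^sub>i, \<zeta>\<^sub>i)\<close>; the sets used for \<^const>\<open>dir_y\<close> ignore the first component.
\<close>

datatype sample_set =
    Init_x nat | Init_y nat | Init_v nat
  | Inner_x nat nat | Inner_y nat nat | Inner_v nat nat

context
  fixes F :: "'a \<Rightarrow> (real^'p) \<times> (real^'q) \<Rightarrow> real"
    and G :: "'b \<Rightarrow> (real^'p) \<times> (real^'q) \<Rightarrow> real"
begin

definition batch_x :: "nat \<Rightarrow> (nat \<Rightarrow> 'a \<times> 'b) \<Rightarrow> (real^'p) \<times> (real^'q) \<Rightarrow> real^'q \<Rightarrow> real^'p"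
  where "batch_x n s z v = batch_mean n (\<lambda>i. dir_x (F (fst (s i))) (G (snd (s i))) z v)"

definition batch_y :: "nat \<Rightarrow> (nat \<Rightarrow> 'a \<times> 'b) \<Rightarrow> (real^'p) \<times> (real^'q) \<Rightarrow> real^'q"
  where "batch_y n s z = batch_mean n (\<lambda>i. dir_y (G (snd (s i))) z)"

definition batch_v :: "nat \<Rightarrow> (nat \<Rightarrow> 'a \<times> 'b) \<Rightarrow> (real^'p) \<times> (real^'q) \<Rightarrow> real^'q \<Rightarrow> real^'q"
  where "batch_v n s z v = batch_mean n (\<lambda>i. dir_v (F (fst (s i))) (G (snd (s i))) z v)"

text \<open>
  \<open>y_loop \<dots> n\<close> is the pair of the \<open>y\<close>-iterate and its estimator with inner index \<open>n - 1\<close>,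
  started from the outer iterates \<open>xk\<close>, \<open>xk1\<close> and the pair \<open>(yk, dy)\<close>; likewise for \<open>v_loop\<close>
  with the triple of the \<open>v\<close>-iterate and the \<open>x\<close>- and \<open>v\<close>-estimators.
\<close>

fun y_loop ::
    "als_params \<Rightarrow> (sample_set \<Rightarrow> nat \<Rightarrow> 'a \<times> 'b) \<Rightarrow> nat \<Rightarrow> real^'p \<Rightarrow> real^'p \<Rightarrow> real^'q \<Rightarrow> real^'q \<Rightarrow>
     nat \<Rightarrow> (real^'q) \<times> (real^'q)"
  where
    "y_loop par s k xk xk1 yk dy 0 = (yk, dy)"
  | "y_loop par s k xk xk1 yk dy (Suc t) =
      (let (y, d) = y_loop par s k xk xk1 yk dy t;
           D = batch_y (batch_inner par) (s (Inner_y k t));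
           x = (if t = 0 then xk else xk1);
           y' = y - (rate_y par * step_y par) *\<^sub>R d
       in (y', D (xk1, y') + (1 - mom_y par) *\<^sub>R (d - D (x, y))))"

fun v_loop ::
    "als_params \<Rightarrow> (sample_set \<Rightarrow> nat \<Rightarrow> 'a \<times> 'b) \<Rightarrow> nat \<Rightarrow>
     (real^'p) \<times> (real^'q) \<Rightarrow> (real^'p) \<times> (real^'q) \<Rightarrow> real^'q \<Rightarrow> real^'p \<Rightarrow> real^'q \<Rightarrow>
     nat \<Rightarrow> (real^'q) \<times> (real^'p) \<times> (real^'q)"
  where
    "v_loop par s k zk zk1 vk dx dv 0 = (vk, dx, dv)"
  | "v_loop par s k zk zk1 vk dx dv (Suc j) =
      (let (v, ex, ev) = v_loop par s k zk zk1 vk dx dv j;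
           Dx = batch_x (batch_inner par) (s (Inner_x k j));
           Dv = batch_v (batch_inner par) (s (Inner_v k j));
           z = (if j = 0 then zk else zk1);
           v' = closest_point (cball 0 (radius par)) (v - (rate_v par * step_v par) *\<^sub>R ev)
       in (v',
           Dx zk1 v' + (1 - mom_x par) *\<^sub>R (ex - Dx z v),
           Dv zk1 v' + (1 - mom_v par) *\<^sub>R (ev - Dv z v)))"

text \<open>
  The state \<open>(x\<^sub>k, y\<^sub>k, v\<^sub>k, dx, dy, dv)\<close> before outer iteration \<open>k\<close> carries the last inner estimators
  of iteration \<open>k - 1\<close>. They are overwritten whenever \<open>period\<close> divides \<open>k\<close>, in particular at
  \<open>k = 0\<close>, so that the initial value \<open>0\<close> is never used.
\<close>

fun als ::
    "als_params \<Rightarrow> real^'p \<Rightarrow> real^'q \<Rightarrow> real^'q \<Rightarrow> (sample_set \<Rightarrow> nat \<Rightarrow> 'a \<times> 'b) \<Rightarrow> nat \<Rightarrow>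
     (real^'p) \<times> (real^'q) \<times> (real^'q) \<times> (real^'p) \<times> (real^'q) \<times> (real^'q)"
  where
    "als par x0 y0 v0 s 0 = (x0, y0, v0, 0, 0, 0)"
  | "als par x0 y0 v0 s (Suc k) =
      (let (x, y, v, dx, dy, dv) = als par x0 y0 v0 s k;
           init = (k mod period par = 0);
           Dx = (if init then batch_x (batch_init par) (s (Init_x k)) (x, y) v else dx);
           Dy = (if init then batch_y (batch_init par) (s (Init_y k)) (x, y) else dy);
           Dv = (if init then batch_v (batch_init par) (s (Init_v k)) (x, y) v else dv);
           x' = x - step_x par *\<^sub>R Dx;
           (y', dy') = y_loop par s k x x' y Dy (y_iters par);
           (v', dx', dv') = v_loop par s k (x, y) (x', y') v Dx Dv (v_iters par)
       in (x', y', v', dx', dy', dv'))"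

definition als_x ::
    "als_params \<Rightarrow> real^'p \<Rightarrow> real^'q \<Rightarrow> real^'q \<Rightarrow> (sample_set \<Rightarrow> nat \<Rightarrow> 'a \<times> 'b) \<Rightarrow> nat \<Rightarrow> real^'p"
  where "als_x par x0 y0 v0 s k = fst (als par x0 y0 v0 s k)"

end

text \<open>
  Oracle calls in \<open>K\<close> outer iterations. One sample of \<^const>\<open>dir_x\<close> costs \<open>2\<close> (a gradient and a
  Jacobian-vector product), of \<^const>\<open>dir_y\<close> costs \<open>1\<close>, of \<^const>\<open>dir_v\<close> costs \<open>2\<close> (a gradient and
  a Hessian-vector product). In the inner loops every sample is evaluated at two points.
\<close>

definition sample_complexity :: "als_params \<Rightarrow> nat \<Rightarrow> nat"
  where "sample_complexity par K =
    (\<Sum>k<K. (if k mod period par = 0 then batch_init par * (2 + 1 + 2) else 0)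
          + (\<Sum>t<y_iters par. batch_inner par * (2 * 1))
          + (\<Sum>j<v_iters par. batch_inner par * (2 * 2) + batch_inner par * (2 * 2)))"

text \<open>
  \<open>Z (b, i)\<close> is the \<open>i\<close>-th sample of the set \<open>b\<close>, and \<open>\<kappa>\<close> is the index of the iterate that is
  returned. The joint law is a product: all \<open>\<xi>\<close>-samples have law \<open>Mxi\<close>, all \<open>\<zeta>\<close>-samples have law
  \<open>Mzeta\<close>, \<open>\<kappa>\<close> is uniform on \<open>{0..<K}\<close>, and all of these are mutually independent.
\<close>

definition als_randomness ::
    "'w measure \<Rightarrow> 'a measure \<Rightarrow> 'b measure \<Rightarrow> (sample_set \<times> nat \<Rightarrow> 'w \<Rightarrow> 'a \<times> 'b) \<Rightarrow>
     nat \<Rightarrow> ('w \<Rightarrow> nat) \<Rightarrow> bool"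
  where "als_randomness P Mxi Mzeta Z K \<kappa> \<longleftrightarrow>
    (let N = measure_pmf (pmf_of_set {0..<K}) \<Otimes>\<^sub>M Pi\<^sub>M UNIV (\<lambda>_. Mxi \<Otimes>\<^sub>M Mzeta);
         R = (\<lambda>\<omega>. (\<kappa> \<omega>, \<lambda>i. Z i \<omega>))
     in prob_space P \<and> R \<in> measurable P N \<and> distr P N R = N)"

definition als_output ::
    "('a \<Rightarrow> (real^'p) \<times> (real^'q) \<Rightarrow> real) \<Rightarrow> ('b \<Rightarrow> (real^'p) \<times> (real^'q) \<Rightarrow> real) \<Rightarrow>
     als_params \<Rightarrow> real^'p \<Rightarrow> real^'q \<Rightarrow> real^'q \<Rightarrow>
     (sample_set \<times> nat \<Rightarrow> 'w \<Rightarrow> 'a \<times> 'b) \<Rightarrow> ('w \<Rightarrow> nat) \<Rightarrow> 'w \<Rightarrow> real^'p"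
  where "als_output F G par x0 y0 v0 Z \<kappa> \<omega> = als_x F G par x0 y0 v0 (\<lambda>b i. Z (b, i) \<omega>) (\<kappa> \<omega>)"

text \<open>Note that the squared norm is compared with \<open>\<epsilon>\<close>, not with \<open>\<epsilon>\<^sup>2\<close>.\<close>

definition eps_stationary ::
    "'w measure \<Rightarrow> (real^'p \<Rightarrow> real) \<Rightarrow> real \<Rightarrow> ('w \<Rightarrow> real^'p) \<Rightarrow> bool"
  where "eps_stationary P \<Phi> \<epsilon> X \<longleftrightarrow>
    X \<in> borel_measurable P \<and>
    integrable P (\<lambda>\<omega>. (norm (gradient \<Phi> (X \<omega>)))\<^sup>2) \<and>
    (\<integral>\<omega>. (norm (gradient \<Phi> (X \<omega>)))\<^sup>2 \<partial>P) \<le> \<epsilon>"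

end

theory Submission imports Defs begin

text \<open>The squared distances \<open>a = |y - y\<^sup>*(x)|\<^sup>2\<close> and \<open>b = |v - v\<^sup>*(x)|\<^sup>2\<close>, where
  \<open>v\<^sup>*(x)\<close> solves the linear system of the hypergradient, contract along the inner loops up to the errors
  of the gradient estimators, and the expected squared errors \<open>e\<^sub>x, e\<^sub>y, e\<^sub>v\<close> of these
  estimators contract by the factor \<open>1 - \<tau>\<close> in every momentum step, up to the movement of the iterates
  and a noise term of order \<open>\<tau>\<^sup>2 \<sigma>\<^sup>2 / S2\<close>. With the chosen constants all these errors are absorbed
  by the Lyapunov function \<open>\<Phi>(x) + a + b + 8 S2 / (C7 \<alpha>) (e\<^sub>x + e\<^sub>y + e\<^sub>v)\<close>: in expectation one outer
  iteration decreases it by \<open>\<alpha>/2 |\<nabla>\<Phi>|\<^sup>2\<close> up to a noise term, which is at most \<open>\<alpha> \<epsilon> / 4\<close>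
  because \<open>\<alpha>\<^sup>2 \<le> S2 \<epsilon> / (16 Pt6)\<close>. A first batch of size \<open>S1 \<ge> 1/\<alpha>\<close> bounds the initial value of
  the Lyapunov function independently of \<open>\<epsilon>\<close>, so that \<open>K\<close> of order \<open>1 / (\<alpha> \<epsilon>)\<close> iterations
  suffice; \<open>1/\<alpha>\<close> is of order \<open>\<epsilon>\<^sup>-\<^sup>1\<^sup>/\<^sup>2\<close>.\<close>

section \<open>Gradients, strong convexity and smoothness\<close>

text \<open>The weight w of the estimator errors is dictated by scaling. As \<tau> is of order
  \<alpha>^2, a momentum step gains only w \<tau>, and this has to match error terms of order
  \<alpha> in the descent of \<Phi>, a and b; so w is of order 1 / \<alpha>. Movements of the
  iterates are squared and cost w \<alpha>^2, again of order \<alpha>, but with a factor 1 / C7 that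
  makes them negligible. The noise w \<tau>^2 is of order \<alpha>^3, and the error of the first
  batch costs w / S1.

  The delicate coupling is that each of the J steps for v feels the y-error. The y-loop is therefore
  run with the weight \<open>1 + pen\<close> on a, and the surplus \<open>pen * a T\<close> is spent
  in the v-loop; the second term of the maximum C_beta keeps pen small.

  Independence of the samples enters by resampling: replacing one coordinate of the product space by
  a fresh draw preserves the law, and whatever is computed before a batch is drawn does not change.
  Since a and the estimator errors have no a priori bound, integrability is carried through the
  induction along with the estimates.\<close>

lemma gradient_eq:
  fixes f :: "'a::real_inner \<Rightarrow> real"
  assumes "GDERIV f z :> D"
  shows "gradient f z = D"
  unfolding gradient_def
proof (rule the_equality, rule assms)
  fix E assume "GDERIV f z :> E"
  then have "(\<lambda>h. h \<bullet> E) = (\<lambda>h. h \<bullet> D)"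
    using assms unfolding gderiv_def by (rule has_derivative_unique)
  then have "(E - D) \<bullet> E = (E - D) \<bullet> D" by metis
  then have "(E - D) \<bullet> (E - D) = 0" by (simp add: inner_diff_right)
  then show "E = D" by simp
qed

lemma riesz_basis:
  fixes l :: "'a::euclidean_space \<Rightarrow> real"
  assumes "linear l"
  shows "l h = h \<bullet> (\<Sum>b\<in>Basis. l b *\<^sub>R b)"
proof -
  have "l h = l (\<Sum>b\<in>Basis. (h \<bullet> b) *\<^sub>R b)" by (simp add: euclidean_representation)
  also have "\<dots> = (\<Sum>b\<in>Basis. (h \<bullet> b) * l b)"
    by (simp add: linear_sum[OF assms] linear_cmul[OF assms])
  also have "\<dots> = h \<bullet> (\<Sum>b\<in>Basis. l b *\<^sub>R b)"
    by (simp add: inner_sum_right mult.commute)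
  finally show ?thesis .
qed

lemma gderiv_gradient:
  fixes f :: "'a::euclidean_space \<Rightarrow> real"
  assumes "C1 f"
  shows "GDERIV f z :> gradient f z"
proof -
  obtain f' where f': "(f has_derivative blinfun_apply (f' z)) (at z)"
    using assms unfolding C1_def by blast
  define D where "D = (\<Sum>b\<in>Basis. blinfun_apply (f' z) b *\<^sub>R b)"
  have "blinfun_apply (f' z) = (\<lambda>h. h \<bullet> D)"
    unfolding D_def by (intro ext riesz_basis) (simp add: blinfun.bounded_linear_right bounded_linear.linear)
  then have "GDERIV f z :> D" using f' unfolding gderiv_def by simp
  then show ?thesis using gradient_eq by metis
qed

lemma C2_imp_C1: "C2 f \<Longrightarrow> C1 f"
  unfolding C1_def C2_def
  by (metis continuous_at_imp_continuous_on has_derivative_continuous)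

lemma C2_gradient_differentiable:
  fixes f :: "'a::euclidean_space \<Rightarrow> real"
  assumes "C2 f"
  shows "(gradient f has_derivative frechet_derivative (gradient f) (at z)) (at z)"
proof -
  obtain f' f'' where f': "\<And>z. (f has_derivative blinfun_apply (f' z)) (at z)"
    and f'': "\<And>z. (f' has_derivative blinfun_apply (f'' z)) (at z)"
    using assms unfolding C2_def C1_def by blast
  have eq: "gradient f = (\<lambda>z. \<Sum>b\<in>Basis. blinfun_apply (f' z) b *\<^sub>R b)"
  proof
    fix z
    have "blinfun_apply (f' z) = (\<lambda>h. h \<bullet> (\<Sum>b\<in>Basis. blinfun_apply (f' z) b *\<^sub>R b))"
      by (intro ext riesz_basis) (simp add: blinfun.bounded_linear_right bounded_linear.linear)
    then have "GDERIV f z :> (\<Sum>b\<in>Basis. blinfun_apply (f' z) b *\<^sub>R b)"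
      using f'[of z] unfolding gderiv_def by simp
    then show "gradient f z = (\<Sum>b\<in>Basis. blinfun_apply (f' z) b *\<^sub>R b)" by (rule gradient_eq)
  qed
  have "((\<lambda>z. \<Sum>b\<in>Basis. blinfun_apply (f' z) b *\<^sub>R b) has_derivative
      (\<lambda>h. \<Sum>b\<in>Basis. blinfun_apply (f'' z h) b *\<^sub>R b)) (at z)"
    by (intro has_derivative_sum has_derivative_scaleR_left
          bounded_linear.has_derivative[OF blinfun.bounded_linear_left] f'')
  then have "gradient f differentiable (at z)" unfolding eq differentiable_def by blast
  then show ?thesis by (simp add: frechet_derivative_works)
qed

section \<open>Restriction to lines and symmetry of the second derivative\<close>

lemma GDERIV_line:
  fixes h :: "'a::real_inner \<Rightarrow> real"
  assumes der: "\<And>z. GDERIV h z :> D z"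
  shows "((\<lambda>s. h (a + s *\<^sub>R w)) has_field_derivative (D (a + s *\<^sub>R w) \<bullet> w)) (at s)"
proof -
  have "((\<lambda>s. h (a + s *\<^sub>R w)) has_derivative (\<lambda>r. (r *\<^sub>R w) \<bullet> D (a + s *\<^sub>R w))) (at s)"
    by (rule has_derivative_compose[OF _ der[unfolded gderiv_def], where f="\<lambda>s. a + s *\<^sub>R w"])
       (auto intro!: derivative_eq_intros)
  then show ?thesis
    by (rule has_derivative_imp_has_field_derivative) (simp add: inner_commute mult.commute)
qed

text \<open>The mean value theorem along w turns the second difference into t times a difference of
  gradients at two points within O(t) of z; expanding D at z there leaves an error o(t^2).\<close>

lemma second_difference_bound:
  fixes h :: "'a::real_inner \<Rightarrow> real"
  assumes der: "\<And>z. GDERIV h z :> D z"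
    and D': "(D has_derivative D') (at z)" and e: "0 < e"
  shows "\<exists>d>0. \<forall>t. 0 < t \<and> t < d \<longrightarrow>
    \<bar>(h (z + t *\<^sub>R u + t *\<^sub>R w) - h (z + t *\<^sub>R u) - h (z + t *\<^sub>R w) + h z) - t\<^sup>2 * (D' u \<bullet> w)\<bar>
      \<le> e * t\<^sup>2"
proof -
  interpret L: bounded_linear D' using D' by (rule has_derivative_bounded_linear)
  \<comment> \<open>The two gradient remainders contribute e t^2 times 2 (|u| + |w|) |w| / c; this c
    makes the factor at most 1, and the summand 1 keeps c positive.\<close>
  define c where "c = 2 * (norm u + norm w) * norm w + 1"
  have c: "c > 0" unfolding c_def by (smt (verit) mult_nonneg_nonneg norm_ge_zero)
  obtain d where d: "d > 0" and
    dd: "\<And>y. norm (y - z) < d \<Longrightarrow> norm (D y - D z - D' (y - z)) \<le> e / c * norm (y - z)"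
    using D' e c unfolding has_derivative_at_alt by (metis divide_pos_pos)
  \<comment> \<open>For t < d' both points z + t u + s w and z + s w with s < t stay within d of
    z.\<close>
  define d' where "d' = d / (norm u + norm w + 1)"
  have d': "d' > 0" unfolding d'_def using d by (simp add: add_nonneg_pos)
  show ?thesis
  proof (intro exI conjI allI impI)
    show "d' > 0" by fact
    fix t :: real assume t: "0 < t \<and> t < d'"
    define \<phi> where "\<phi> s = h (z + t *\<^sub>R u + s *\<^sub>R w) - h (z + s *\<^sub>R w)" for s
    have "(\<phi> has_real_derivative w \<bullet> D (z + t *\<^sub>R u + s *\<^sub>R w) - w \<bullet> D (z + s *\<^sub>R w)) (at s)" for s
      unfolding \<phi>_def inner_commute[of w] by (intro DERIV_diff GDERIV_line[OF der])
    with t have "\<exists>s>0. s < t \<and> \<phi> t - \<phi> 0 = (t - 0) * (w \<bullet> D (z + t *\<^sub>R u + s *\<^sub>R w) - w \<bullet> D (z + s *\<^sub>R w))"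
      by (intro MVT2) auto
    then obtain s where s: "0 < s" "s < t" and
      mvt: "\<phi> t - \<phi> 0 = t * (w \<bullet> D (z + t *\<^sub>R u + s *\<^sub>R w) - w \<bullet> D (z + s *\<^sub>R w))" by auto
    let ?a = "t *\<^sub>R u + s *\<^sub>R w" and ?b = "s *\<^sub>R w"
    have sw: "norm ?b \<le> t * norm w" using s by (simp add: mult_right_mono)
    have na: "norm ?a \<le> t * (norm u + norm w)"
      using norm_triangle_ineq[of "t *\<^sub>R u" "s *\<^sub>R w"] sw t by (simp add: algebra_simps)
    have nb: "norm ?b \<le> t * (norm u + norm w)" using sw t by (simp add: algebra_simps add_increasing)
    have "t * (norm u + norm w) < d"
    proof -
      have "t * (norm u + norm w) \<le> t * (norm u + norm w + 1)" using t by simp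
      also have "\<dots> < d" using t unfolding d'_def
        by (metis add_nonneg_pos less_numeral_extra(1) norm_ge_zero add_nonneg_nonneg pos_less_divide_eq)
      finally show ?thesis .
    qed
    then have "norm ?a < d" "norm ?b < d" using na nb by auto
    define ra where "ra = D (z + ?a) - D z - D' ?a"
    define rb where "rb = D (z + ?b) - D z - D' ?b"
    have ec: "0 \<le> e / c" using e c by simp
    have ra: "norm ra \<le> e / c * (t * (norm u + norm w))"
      using dd[of "z + ?a"] \<open>norm ?a < d\<close> mult_left_mono[OF na ec] by (simp add: ra_def)
    have rb: "norm rb \<le> e / c * (t * (norm u + norm w))"
      using dd[of "z + ?b"] \<open>norm ?b < d\<close> mult_left_mono[OF nb ec] by (simp add: rb_def)
    have "D (z + ?a) - D (z + ?b) = t *\<^sub>R D' u + (ra - rb)"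
      unfolding ra_def rb_def by (simp add: L.add L.scaleR)
    then have eq: "\<phi> t - \<phi> 0 - t\<^sup>2 * (D' u \<bullet> w) = t * (w \<bullet> (ra - rb))"
      unfolding mvt
      by (simp add: add.assoc inner_diff_right[symmetric] del: inner_diff_right)
         (simp add: inner_add_right inner_commute power2_eq_square algebra_simps)
    have "\<bar>t * (w \<bullet> (ra - rb))\<bar> \<le> t * (norm w * norm (ra - rb))"
      using t Cauchy_Schwarz_ineq2[of w "ra - rb"] by (simp add: abs_mult)
    also have "\<dots> \<le> t * (norm w * (2 * (e / c * (t * (norm u + norm w)))))"
      using norm_triangle_ineq4[of ra rb] add_mono[OF ra rb] t by (intro mult_left_mono) auto
    also have "\<dots> = (e * t\<^sup>2) * ((2 * (norm u + norm w) * norm w) / c)"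
      using c by (simp add: field_simps power2_eq_square)
    also have "\<dots> \<le> (e * t\<^sup>2) * 1"
      using e c unfolding c_def by (intro mult_left_mono) auto
    finally have "\<bar>\<phi> t - \<phi> 0 - t\<^sup>2 * (D' u \<bullet> w)\<bar> \<le> e * t\<^sup>2" unfolding eq by simp
    then show "\<bar>(h (z + t *\<^sub>R u + t *\<^sub>R w) - h (z + t *\<^sub>R u) - h (z + t *\<^sub>R w) + h z) - t\<^sup>2 * (D' u \<bullet> w)\<bar>
      \<le> e * t\<^sup>2" unfolding \<phi>_def by (simp add: algebra_simps)
  qed
qed

text \<open>The second difference over the parallelogram spanned by t u and t w is symmetric in u
  and w, so its two limits after division by t^2 agree.\<close>

lemma second_derivative_symmetric:
  fixes h :: "'a::real_inner \<Rightarrow> real"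
  assumes der: "\<And>z. GDERIV h z :> D z"
    and D': "(D has_derivative D') (at z)"
  shows "D' u \<bullet> w = D' w \<bullet> u"
proof (rule ccontr)
  assume ne: "D' u \<bullet> w \<noteq> D' w \<bullet> u"
  \<comment> \<open>With a third of the gap, two errors of size e cannot bridge it.\<close>
  define e where "e = \<bar>D' u \<bullet> w - D' w \<bullet> u\<bar> / 3"
  have e: "e > 0" using ne by (simp add: e_def)
  obtain d1 where d1: "d1 > 0" and 1: "\<And>t. 0 < t \<Longrightarrow> t < d1 \<Longrightarrow>
      \<bar>(h (z + t *\<^sub>R u + t *\<^sub>R w) - h (z + t *\<^sub>R u) - h (z + t *\<^sub>R w) + h z) - t\<^sup>2 * (D' u \<bullet> w)\<bar> \<le> e * t\<^sup>2"
    using second_difference_bound[OF der D' e, of u w] by blast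
  obtain d2 where d2: "d2 > 0" and 2: "\<And>t. 0 < t \<Longrightarrow> t < d2 \<Longrightarrow>
      \<bar>(h (z + t *\<^sub>R w + t *\<^sub>R u) - h (z + t *\<^sub>R w) - h (z + t *\<^sub>R u) + h z) - t\<^sup>2 * (D' w \<bullet> u)\<bar> \<le> e * t\<^sup>2"
    using second_difference_bound[OF der D' e, of w u] by blast
  define t where "t = min d1 d2 / 2"
  have t: "0 < t" "t < d1" "t < d2" using d1 d2 by (auto simp: t_def)
  have sw: "z + t *\<^sub>R w + t *\<^sub>R u = z + t *\<^sub>R u + t *\<^sub>R w" by simp
  have "\<bar>t\<^sup>2 * (D' u \<bullet> w) - t\<^sup>2 * (D' w \<bullet> u)\<bar> \<le> 2 * (e * t\<^sup>2)"
    using 1[OF t(1,2)] 2[OF t(1,3)] unfolding sw by linarith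
  moreover have "\<bar>t\<^sup>2 * (D' u \<bullet> w) - t\<^sup>2 * (D' w \<bullet> u)\<bar> = t\<^sup>2 * \<bar>D' u \<bullet> w - D' w \<bullet> u\<bar>"
    by (simp add: right_diff_distrib[symmetric] abs_mult)
  ultimately have "t\<^sup>2 * \<bar>D' u \<bullet> w - D' w \<bullet> u\<bar> \<le> t\<^sup>2 * (2 * e)"
    by (simp add: algebra_simps)
  then have "\<bar>D' u \<bullet> w - D' w \<bullet> u\<bar> \<le> 2 * e" using t by simp
  then show False using e unfolding e_def by simp
qed

section \<open>Quadratic bounds from Lipschitz gradients and from strong convexity\<close>

lemma smooth_upper_bound:
  fixes h :: "'a::real_inner \<Rightarrow> real"
  assumes der: "\<And>z. GDERIV h z :> D z"
    and lip: "\<And>x y. norm (D x - D y) \<le> L * norm (x - y)"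
  shows "h b \<le> h a + D a \<bullet> (b - a) + L / 2 * (norm (b - a))\<^sup>2"
proof -
  define w where "w = b - a"
  \<comment> \<open>On the segment, h minus the claimed majorant up to a constant. Its derivative is
    nonpositive, and comparing s = 0 with s = 1 is the claim.\<close>
  define \<psi> where "\<psi> s = h (a + s *\<^sub>R w) - s * (D a \<bullet> w) - L / 2 * s\<^sup>2 * (norm w)\<^sup>2" for s
  have "\<psi> 1 \<le> \<psi> 0"
  proof (rule DERIV_nonpos_imp_nonincreasing[of 0 1 \<psi>])
    fix s :: real assume s: "0 \<le> s" "s \<le> 1"
    have "(\<psi> has_field_derivative (D (a + s *\<^sub>R w) \<bullet> w - D a \<bullet> w - L * s * (norm w)\<^sup>2)) (at s)"
      unfolding \<psi>_def by (auto intro!: derivative_eq_intros GDERIV_line[OF der])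
    moreover have "D (a + s *\<^sub>R w) \<bullet> w - D a \<bullet> w \<le> L * s * (norm w)\<^sup>2"
    proof -
      have "D (a + s *\<^sub>R w) \<bullet> w - D a \<bullet> w = (D (a + s *\<^sub>R w) - D a) \<bullet> w" by (simp add: inner_diff_left)
      also have "\<dots> \<le> norm (D (a + s *\<^sub>R w) - D a) * norm w" by (rule norm_cauchy_schwarz)
      also have "\<dots> \<le> (L * norm (s *\<^sub>R w)) * norm w"
        using lip[of "a + s *\<^sub>R w" a] by (intro mult_right_mono) auto
      also have "\<dots> = L * s * (norm w)\<^sup>2" using s by (simp add: power2_eq_square)
      finally show ?thesis .
    qed
    ultimately show "\<exists>y. (\<psi> has_real_derivative y) (at s) \<and> y \<le> 0" by (metis diff_le_0_iff_le)
  qed simp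
  then show ?thesis unfolding \<psi>_def w_def by simp
qed

text \<open>Dividing the convexity inequality at a + t (b - a) by t and letting t tend to 0 from the
  right turns the difference quotient into the directional derivative.\<close>

lemma strongly_convex_lower_bound:
  fixes h :: "'a::real_inner \<Rightarrow> real"
  assumes der: "\<And>z. GDERIV h z :> D z" and sc: "strongly_convex \<mu> h"
  shows "h b \<ge> h a + D a \<bullet> (b - a) + \<mu> / 2 * (norm (b - a))\<^sup>2"
proof -
  define w where "w = b - a"
  define q where "q t = (h (a + t *\<^sub>R w) - h a) / t" for t
  have "((\<lambda>s. h (a + s *\<^sub>R w)) has_field_derivative (D (a + 0 *\<^sub>R w) \<bullet> w)) (at 0)"
    by (rule GDERIV_line[OF der])
  then have "(q \<longlongrightarrow> D a \<bullet> w) (at 0)" unfolding q_def by (simp add: DERIV_def)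
  then have 1: "(q \<longlongrightarrow> D a \<bullet> w) (at_right 0)" using tendsto_within_subset by blast
  have 2: "((\<lambda>t. h b - h a - \<mu> / 2 * (1 - t) * (norm w)\<^sup>2) \<longlongrightarrow> h b - h a - \<mu> / 2 * (1 - 0) * (norm w)\<^sup>2) (at_right 0)"
    by (intro tendsto_intros)
  have "\<forall>\<^sub>F t in at_right 0. q t \<le> h b - h a - \<mu> / 2 * (1 - t) * (norm w)\<^sup>2"
    unfolding eventually_at_right_field
  proof (intro exI[of _ 1] conjI allI impI)
    fix t :: real assume t: "t > 0" "t < 1"
    have "h ((1 - t) *\<^sub>R a + t *\<^sub>R b) \<le> (1 - t) * h a + t * h b - \<mu> / 2 * t * (1 - t) * (norm (a - b))\<^sup>2"
      using sc t unfolding strongly_convex_def by auto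
    moreover have "(1 - t) *\<^sub>R a + t *\<^sub>R b = a + t *\<^sub>R w" by (simp add: w_def algebra_simps)
    moreover have "norm (a - b) = norm w" by (simp add: w_def norm_minus_commute)
    ultimately have "h (a + t *\<^sub>R w) - h a \<le> t * (h b - h a - \<mu> / 2 * (1 - t) * (norm w)\<^sup>2)"
      by (simp add: algebra_simps)
    then show "q t \<le> h b - h a - \<mu> / 2 * (1 - t) * (norm w)\<^sup>2"
      unfolding q_def using t by (simp add: divide_le_eq mult.commute)
  qed simp
  from tendsto_le[OF _ 2 1 this] show ?thesis by (simp add: w_def)
qed

lemma strongly_monotone_gradient:
  fixes h :: "'a::real_inner \<Rightarrow> real"
  assumes der: "\<And>z. GDERIV h z :> D z" and sc: "strongly_convex \<mu> h"
  shows "\<mu> * (norm (a - b))\<^sup>2 \<le> (D a - D b) \<bullet> (a - b)"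
  using strongly_convex_lower_bound[OF der sc, of a b] strongly_convex_lower_bound[OF der sc, of b a]
  by (simp add: norm_minus_commute inner_diff_left inner_diff_right algebra_simps)

text \<open>After subtracting the quadratic \<open>\<mu>/2 |\<cdot>|\<^sup>2\<close>, the function is convex and \<open>(L - \<mu>)\<close>-smooth;
  the bound below is cocoercivity of its gradient.\<close>

lemma strongly_convex_cocoercive:
  fixes h :: "'a::real_inner \<Rightarrow> real"
  assumes der: "\<And>z. GDERIV h z :> D z" and sc: "strongly_convex \<mu> h"
    and lip: "\<And>x y. norm (D x - D y) \<le> L * norm (x - y)"
    and L: "\<mu> \<le> L"
  shows "L * \<mu> * (norm (a - b))\<^sup>2 + (norm (D a - D b))\<^sup>2 \<le> (L + \<mu>) * ((D a - D b) \<bullet> (a - b))"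
proof -
  define l where "l = L - \<mu>"
  define \<phi> where "\<phi> x = h x - \<mu> / 2 * (norm x)\<^sup>2" for x
  define E where "E x = D x - \<mu> *\<^sub>R x" for x
  have lo: "\<phi> y \<ge> \<phi> x + E x \<bullet> (y - x)" for x y
    using strongly_convex_lower_bound[OF der sc, of x y]
    unfolding \<phi>_def E_def power2_norm_eq_inner
    by (simp add: inner_diff_left inner_diff_right inner_commute algebra_simps)
  have up: "\<phi> y \<le> \<phi> x + E x \<bullet> (y - x) + l / 2 * (norm (y - x))\<^sup>2" for x y
    using smooth_upper_bound[OF der lip, of y x]
    unfolding \<phi>_def E_def power2_norm_eq_inner l_def
    by (simp add: inner_diff_left inner_diff_right inner_commute algebra_simps diff_divide_distrib add_divide_distrib)
  define \<Delta> where "\<Delta> = E a - E b"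
  define w where "w = a - b"
  \<comment> \<open>The value of \<phi> at u = y - t (E y - E x) is bounded below by the tangent at
    x and above by the quadratic at y; adding the results for both orders of a and b cancels the
    values of \<phi>. The step t stays free.\<close>
  have one: "(2 * t - l * t\<^sup>2) * (norm \<Delta>)\<^sup>2 \<le> \<Delta> \<bullet> w" for t
  proof -
    have *: "\<phi> x + E x \<bullet> (y - x) + (t - l / 2 * t\<^sup>2) * (norm (E y - E x))\<^sup>2 \<le> \<phi> y" for x y
    proof -
      define u where "u = y - t *\<^sub>R (E y - E x)"
      have "\<phi> x + E x \<bullet> (u - x) \<le> \<phi> y + E y \<bullet> (u - y) + l / 2 * (norm (u - y))\<^sup>2"
        using lo[of x u] up[of u y] by linarith
      moreover have "E x \<bullet> (u - x) = E x \<bullet> (y - x) - t * (E x \<bullet> (E y - E x))"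
        by (simp add: u_def inner_diff_right algebra_simps)
      moreover have "E y \<bullet> (u - y) = - t * (E y \<bullet> (E y - E x))" by (simp add: u_def)
      moreover have "(norm (u - y))\<^sup>2 = t\<^sup>2 * (norm (E y - E x))\<^sup>2"
        by (simp add: u_def power_mult_distrib)
      moreover have "t * (E y \<bullet> (E y - E x)) - t * (E x \<bullet> (E y - E x)) = t * (norm (E y - E x))\<^sup>2"
        by (simp add: power2_norm_eq_inner inner_diff_left right_diff_distrib[symmetric])
      ultimately show ?thesis by (simp add: algebra_simps)
    qed
    show ?thesis using *[of a b] *[of b a] unfolding \<Delta>_def w_def
      by (simp add: norm_minus_commute inner_diff_left inner_diff_right algebra_simps)
  qed
  have key: "(norm \<Delta>)\<^sup>2 \<le> l * (\<Delta> \<bullet> w)"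
  proof (cases "l = 0")
    case True
    have "2 * t * (norm \<Delta>)\<^sup>2 \<le> \<Delta> \<bullet> w" for t using one[of t] True by simp
    \<comment> \<open>For l = 0 every t is allowed: if \<Delta> were nonzero, the first instance
      would make the inner product at most 0, t = 0 makes it at least 0, and t = 1 then contradicts
      \<Delta> being nonzero.\<close>
    from this[of "(\<Delta> \<bullet> w) / (norm \<Delta>)\<^sup>2"] this[of 0] this[of 1]
    have "(norm \<Delta>)\<^sup>2 = 0"
      by (cases "\<Delta> = 0") auto
    then show ?thesis using True by simp
  next
    case False
    then have l: "l > 0" using L by (simp add: l_def)
    \<comment> \<open>The choice t = 1 / l maximises 2 t - l t^2.\<close>
    have "1 / l * (norm \<Delta>)\<^sup>2 \<le> \<Delta> \<bullet> w"
      using one[of "1 / l"] l by (simp add: power2_eq_square)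
    then show ?thesis using l by (simp add: field_simps)
  qed
  define H where "H = D a - D b"
  have "\<Delta> = H - \<mu> *\<^sub>R w" unfolding \<Delta>_def E_def w_def H_def by (simp add: algebra_simps)
  from key[unfolded this] show ?thesis unfolding w_def[symmetric] H_def[symmetric] l_def power2_norm_eq_inner
    by (simp add: inner_diff_left inner_diff_right inner_commute algebra_simps)
qed

section \<open>The minimizer of a strongly convex function\<close>

lemma strongly_convex_has_minimizer:
  fixes h :: "'a::euclidean_space \<Rightarrow> real"
  assumes der: "\<And>z. GDERIV h z :> D z" and sc: "strongly_convex \<mu> h" and mu: "\<mu> > 0"
  obtains y where "\<And>z. h y \<le> h z"
proof -
  \<comment> \<open>Beyond this radius the quadratic term of the lower bound at 0 dominates the
    linear one, so h is at least h 0 there and a minimizer over the ball is global.\<close>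
  define R where "R = 2 * norm (D 0) / \<mu> + 1"
  have "continuous_on UNIV h"
    using der unfolding gderiv_def
    by (meson continuous_at_imp_continuous_on has_derivative_continuous)
  then have "continuous_on (cball 0 R) h" by (rule continuous_on_subset) auto
  moreover have "R \<ge> 0" using mu by (simp add: R_def)
  ultimately obtain y where y: "y \<in> cball 0 R" "\<And>z. z \<in> cball 0 R \<Longrightarrow> h y \<le> h z"
    using continuous_attains_inf[of "cball 0 R" h] by auto
  show thesis
  proof (rule that)
    fix z show "h y \<le> h z"
    proof (cases "z \<in> cball 0 R")
      case False
      then have nz: "norm z > R" by simp
      have "D 0 \<bullet> z \<ge> - (norm (D 0) * norm z)"
        using Cauchy_Schwarz_ineq2[of "D 0" z] by linarith
      moreover have "norm (D 0) * norm z \<le> \<mu> / 2 * (norm z)\<^sup>2"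
      proof -
        have "norm (D 0) \<le> \<mu> / 2 * R" using mu by (simp add: R_def field_simps)
        also have "\<dots> \<le> \<mu> / 2 * norm z" using nz mu by simp
        finally show ?thesis using mult_right_mono[of "norm (D 0)" "\<mu> / 2 * norm z" "norm z"]
          by (simp add: power2_eq_square)
      qed
      ultimately have "h z \<ge> h 0"
        using strongly_convex_lower_bound[OF der sc, of 0 z] by simp
      moreover have "h y \<le> h 0" using y(2)[of 0] \<open>R \<ge> 0\<close> by simp
      ultimately show ?thesis by simp
    qed (rule y(2))
  qed
qed

lemma minimizer_gradient_zero:
  fixes h :: "'a::euclidean_space \<Rightarrow> real"
  assumes der: "GDERIV h y :> D" and min: "\<And>z. h y \<le> h z"
  shows "D = 0"
proof -
  have "(\<lambda>u. u \<bullet> D) = (\<lambda>u. 0)"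
    using differential_zero_maxmin[of y UNIV h "\<lambda>u. u \<bullet> D"] der min unfolding gderiv_def by auto
  then have "D \<bullet> D = 0" by metis
  then show ?thesis by simp
qed

text \<open>One inexact gradient step with error \<open>e\<close>, from \<open>w\<close> with gradient \<open>g\<close>, where the minimizer is
  at the origin; \<open>r\<close> is the cocoercivity constant.\<close>

lemma inexact_step_contraction:
  fixes w :: "'a::real_inner"
  assumes coc: "L * \<mu> * (norm w)\<^sup>2 + (norm g)\<^sup>2 \<le> (L + \<mu>) * (g \<bullet> w)"
    and mu: "0 < \<mu>" "\<mu> \<le> L" and s: "0 \<le> s" "s \<le> 1 / (2 * L + 2 * \<mu>)"
  shows "(norm (w - s *\<^sub>R (g + e)))\<^sup>2
    \<le> (1 - s * \<mu> / 2) * (norm w)\<^sup>2 + 5 * s / (2 * \<mu>) * (norm e)\<^sup>2 - s / (L + \<mu>) * (norm g)\<^sup>2"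
proof -
  define r where "r = 1 / (L + \<mu>)"
  have r: "r > 0" using mu by (simp add: r_def)
  have sr: "2 * s \<le> r" using s mu unfolding r_def by (simp add: field_simps)
  have rmu: "2 * \<mu> * r \<le> 1" using mu by (simp add: r_def field_simps)
  have Lr: "\<mu> / 2 \<le> L * \<mu> * r" using mu by (simp add: r_def field_simps)
  have "L * \<mu> * r * (norm w)\<^sup>2 + r * (norm g)\<^sup>2 = r * (L * \<mu> * (norm w)\<^sup>2 + (norm g)\<^sup>2)"
    by (simp add: algebra_simps)
  also have "\<dots> \<le> r * ((L + \<mu>) * (g \<bullet> w))" using coc r by simp
  also have "\<dots> = g \<bullet> w" using mu by (simp add: r_def)
  finally have gw: "\<mu> / 2 * (norm w)\<^sup>2 + r * (norm g)\<^sup>2 \<le> g \<bullet> w"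
    using mult_right_mono[OF Lr, of "(norm w)\<^sup>2"] by simp
  \<comment> \<open>Young's inequality with weight \<mu> / 2: after multiplication by s it spends
    half of the contraction s \<mu> |w|^2 that the inner product with g provides.\<close>
  have ew: "- (2 * (e \<bullet> w)) \<le> \<mu> / 2 * (norm w)\<^sup>2 + 2 / \<mu> * (norm e)\<^sup>2"
  proof -
    have "0 \<le> (norm ((\<mu> / 2) *\<^sub>R w + e))\<^sup>2 * (2 / \<mu>)" using mu by simp
    also have "\<dots> = \<mu> / 2 * (norm w)\<^sup>2 + 2 / \<mu> * (norm e)\<^sup>2 + 2 * (e \<bullet> w)"
      using mu unfolding power2_norm_eq_inner
      by (simp add: inner_add_left inner_add_right inner_commute field_simps power2_eq_square)
    finally show ?thesis by simp
  qed
  have ge: "(norm (g + e))\<^sup>2 \<le> 2 * (norm g)\<^sup>2 + 2 * (norm e)\<^sup>2"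
  proof -
    have "0 \<le> (norm (g - e))\<^sup>2" by simp
    then show ?thesis unfolding power2_norm_eq_inner
      by (simp add: inner_add_left inner_add_right inner_diff_left inner_diff_right inner_commute)
  qed
  \<comment> \<open>Since 2 s \<le> r, the term quadratic in s takes only half of the 2 s r |g|^2
    gained from cocoercivity. The other half stays in the conclusion and later pays for the movement
    of the iterates.\<close>
  have s2g: "2 * s\<^sup>2 * (norm g)\<^sup>2 \<le> s * r * (norm g)\<^sup>2"
    using mult_left_mono[OF sr s(1)] by (intro mult_right_mono) (auto simp: power2_eq_square ac_simps)
  have s2e: "2 * s\<^sup>2 \<le> s / (2 * \<mu>)"
  proof -
    have "2 * s \<le> 1 / (2 * \<mu>)" using sr rmu mu by (simp add: field_simps) (smt (verit) mult_left_mono)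
    then show ?thesis using mult_left_mono[of "2 * s" "1 / (2 * \<mu>)" s] s by (simp add: power2_eq_square)
  qed
  have "(norm (w - s *\<^sub>R (g + e)))\<^sup>2 = (norm w)\<^sup>2 - 2 * s * (g \<bullet> w) - 2 * s * (e \<bullet> w) + s\<^sup>2 * (norm (g + e))\<^sup>2"
    unfolding power2_norm_eq_inner
    by (simp add: inner_add_left inner_add_right inner_diff_left inner_diff_right inner_commute
        power2_eq_square algebra_simps)
  also have "\<dots> \<le> (norm w)\<^sup>2 - 2 * s * (\<mu> / 2 * (norm w)\<^sup>2 + r * (norm g)\<^sup>2)
      + s * (\<mu> / 2 * (norm w)\<^sup>2 + 2 / \<mu> * (norm e)\<^sup>2) + s\<^sup>2 * (2 * (norm g)\<^sup>2 + 2 * (norm e)\<^sup>2)"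
    using mult_left_mono[OF gw, of "2 * s"] mult_left_mono[OF ew, of s]
      mult_left_mono[OF ge, of "s\<^sup>2"] s by (simp add: algebra_simps)
  also have "\<dots> = (1 - s * \<mu> / 2) * (norm w)\<^sup>2 + (2 * s / \<mu> + 2 * s\<^sup>2) * (norm e)\<^sup>2
      - 2 * (s * r) * (norm g)\<^sup>2 + 2 * s\<^sup>2 * (norm g)\<^sup>2"
    by (simp add: algebra_simps)
  also have "\<dots> \<le> (1 - s * \<mu> / 2) * (norm w)\<^sup>2 + (2 * s / \<mu> + s / (2 * \<mu>)) * (norm e)\<^sup>2 - s * r * (norm g)\<^sup>2"
    using s2g mult_right_mono[OF s2e, of "(norm e)\<^sup>2"] by (simp add: algebra_simps)
  also have "2 * s / \<mu> + s / (2 * \<mu>) = 5 * s / (2 * \<mu>)" using mu by (simp add: field_simps)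
  finally show ?thesis by (simp add: r_def)
qed

section \<open>The hypergradient\<close>

lemma directional_derivative:
  assumes der: "(\<phi> has_derivative \<phi>') (at x)"
  shows "((\<lambda>t. (\<phi> (x + t *\<^sub>R w) - \<phi> x) /\<^sub>R t) \<longlongrightarrow> \<phi>' w) (at_right (0::real))"
proof (cases "w = 0")
  case True
  then show ?thesis using der by (simp add: has_derivative_bounded_linear linear_simps)
next
  case False
  interpret L: bounded_linear \<phi>' using der by (rule has_derivative_bounded_linear)
  have "((\<lambda>h. norm (\<phi> (x + h) - \<phi> x - \<phi>' h) / norm h) \<longlongrightarrow> 0) (at 0)"
    using der unfolding has_derivative_at by blast
  moreover have "filterlim (\<lambda>t::real. t *\<^sub>R w) (at 0) (at_right 0)"
  proof (rule filterlim_atI)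
    have "((\<lambda>t::real. t *\<^sub>R w) \<longlongrightarrow> 0 *\<^sub>R w) (at_right 0)" by (intro tendsto_intros)
    then show "((\<lambda>t::real. t *\<^sub>R w) \<longlongrightarrow> 0) (at_right 0)" by simp
    show "\<forall>\<^sub>F t in at_right (0::real). t *\<^sub>R w \<noteq> 0"
      using False by (auto simp: eventually_at_right_field intro!: exI[of _ 1])
  qed
  ultimately have "((\<lambda>t. norm (\<phi> (x + t *\<^sub>R w) - \<phi> x - \<phi>' (t *\<^sub>R w)) / norm (t *\<^sub>R w)) \<longlongrightarrow> 0) (at_right (0::real))"
    by (rule filterlim_compose)
  then have lim: "((\<lambda>t. norm (\<phi> (x + t *\<^sub>R w) - \<phi> x - \<phi>' (t *\<^sub>R w)) / norm (t *\<^sub>R w) * norm w) \<longlongrightarrow> 0 * norm w) (at_right (0::real))"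
    by (intro tendsto_mult tendsto_const)
  have eq: "\<forall>\<^sub>F t in at_right (0::real).
      norm (\<phi> (x + t *\<^sub>R w) - \<phi> x - \<phi>' (t *\<^sub>R w)) / norm (t *\<^sub>R w) * norm w
        = norm ((\<phi> (x + t *\<^sub>R w) - \<phi> x) /\<^sub>R t - \<phi>' w)"
    unfolding eventually_at_right_field
  proof (intro exI[of _ 1] conjI allI impI)
    fix t :: real assume t: "0 < t" "t < 1"
    have "(\<phi> (x + t *\<^sub>R w) - \<phi> x) /\<^sub>R t - \<phi>' w = (\<phi> (x + t *\<^sub>R w) - \<phi> x - \<phi>' (t *\<^sub>R w)) /\<^sub>R t"
      using t by (simp add: L.scaleR algebra_simps)
    then show "norm (\<phi> (x + t *\<^sub>R w) - \<phi> x - \<phi>' (t *\<^sub>R w)) / norm (t *\<^sub>R w) * norm w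
        = norm ((\<phi> (x + t *\<^sub>R w) - \<phi> x) /\<^sub>R t - \<phi>' w)"
      using t False by (simp add: norm_scaleR divide_inverse_commute)
  qed simp
  have "((\<lambda>t. norm ((\<phi> (x + t *\<^sub>R w) - \<phi> x) /\<^sub>R t - \<phi>' w)) \<longlongrightarrow> 0) (at_right (0::real))"
    using tendsto_cong[OF eq] lim by simp
  then show ?thesis by (simp add: tendsto_norm_zero_iff LIM_zero_iff)
qed

text \<open>Difference quotients are bounded by L |w|, and the bound survives the limit. In this way
  the Lipschitz constant of \<open>gradient g\<close> bounds its Jacobian blocks.\<close>

lemma has_derivative_norm_le:
  assumes der: "(\<phi> has_derivative \<phi>') (at x)"
    and lip: "\<And>y. norm (\<phi> y - \<phi> x) \<le> L * norm (y - x)"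
  shows "norm (\<phi>' w) \<le> L * norm w"
proof (rule tendsto_upperbound)
  show "((\<lambda>t. norm ((\<phi> (x + t *\<^sub>R w) - \<phi> x) /\<^sub>R t)) \<longlongrightarrow> norm (\<phi>' w)) (at_right (0::real))"
    by (intro tendsto_norm directional_derivative der)
  show "\<forall>\<^sub>F t in at_right (0::real). norm ((\<phi> (x + t *\<^sub>R w) - \<phi> x) /\<^sub>R t) \<le> L * norm w"
    unfolding eventually_at_right_field
  proof (intro exI[of _ 1] conjI allI impI)
    fix t :: real assume t: "0 < t" "t < 1"
    then show "norm ((\<phi> (x + t *\<^sub>R w) - \<phi> x) /\<^sub>R t) \<le> L * norm w"
      using lip[of "x + t *\<^sub>R w"] by (simp add: divide_inverse_commute[symmetric] pos_divide_le_eq mult_ac)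
  qed simp
qed simp

lemma norm_matrix_vector_le_spectral: "norm (A *v w) \<le> spectral_norm A * norm w"
  unfolding spectral_norm_def by (rule onorm) (rule matrix_vector_mul_bounded_linear)

lemma spectral_norm_nonneg: "0 \<le> spectral_norm A"
  unfolding spectral_norm_def by (rule onorm_pos_le) (rule matrix_vector_mul_bounded_linear)

section \<open>Partial gradients as components of the full gradient\<close>

lemma grad_x_eq:
  fixes f :: "(real^'p) \<times> (real^'q) \<Rightarrow> real"
  assumes "C1 f"
  shows "grad_x f z = fst (gradient f z)"
  unfolding grad_x_def
proof (rule gradient_eq)
  have "((\<lambda>x. f (x, snd z)) has_derivative (\<lambda>h. (h, 0) \<bullet> gradient f (fst z, snd z))) (at (fst z))"
    by (rule has_derivative_compose[OF _ gderiv_gradient[OF assms, unfolded gderiv_def],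
          where f="\<lambda>x. (x, snd z)"]) (auto intro!: derivative_eq_intros)
  then show "GDERIV (\<lambda>x. f (x, snd z)) (fst z) :> fst (gradient f z)"
    unfolding gderiv_def by (simp add: inner_prod_def)
qed

lemma GDERIV_snd:
  fixes f :: "(real^'p) \<times> (real^'q) \<Rightarrow> real"
  assumes "C1 f"
  shows "GDERIV (\<lambda>y. f (x, y)) y :> snd (gradient f (x, y))"
proof -
  have "((\<lambda>y. f (x, y)) has_derivative (\<lambda>h. (0, h) \<bullet> gradient f (x, y))) (at y)"
    by (rule has_derivative_compose[OF _ gderiv_gradient[OF assms, unfolded gderiv_def],
          where f="\<lambda>y. (x, y)"]) (auto intro!: derivative_eq_intros)
  then show ?thesis unfolding gderiv_def by (simp add: inner_prod_def)
qed

lemma grad_y_eq: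
  fixes f :: "(real^'p) \<times> (real^'q) \<Rightarrow> real"
  assumes "C1 f"
  shows "grad_y f z = snd (gradient f z)"
  using gradient_eq[OF GDERIV_snd[OF assms, of "fst z" "snd z"]] by (simp add: grad_y_def)

lemma norm_snd_le: "norm (snd z) \<le> norm z"
  using Product_Vector.norm_snd_le[of "snd z" "fst z"] by simp

lemma norm_fst_le: "norm (fst z) \<le> norm z"
  using Product_Vector.norm_fst_le[of "fst z" "snd z"] by simp

lemma norm_add_square_le:
  fixes a b :: "'a::real_normed_vector"
  shows "(norm (a + b))\<^sup>2 \<le> 2 * (norm a)\<^sup>2 + 2 * (norm b)\<^sup>2"
proof -
  have "(norm (a + b))\<^sup>2 \<le> (norm a + norm b)\<^sup>2" by (intro power_mono norm_triangle_ineq) auto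
  also have "\<dots> \<le> 2 * (norm a)\<^sup>2 + 2 * (norm b)\<^sup>2"
    using sum_squares_bound[of "norm a" "norm b"] by (simp add: power2_sum)
  finally show ?thesis .
qed

lemma square_sum_le: "(a + b)\<^sup>2 \<le> 2 * a\<^sup>2 + 2 * (b::real)\<^sup>2"
  using norm_add_square_le[of a b] by simp

text \<open>Shared on purpose by (f, g) and by every sample pair (F \<xi>, G \<zeta>): by A4 the
  constants agree, so each deterministic estimate below also holds for sampled directions, uniformly
  in the sample.\<close>

locale smooth_pair =
  fixes f g :: "(real^'p) \<times> (real^'q) \<Rightarrow> real"
    and Cf Lf Lg Lgxy Lgyy \<mu> :: real
  assumes C1f: "C1 f" and C2g: "C2 g" and mu: "0 < \<mu>"
    and sc: "\<And>x. strongly_convex \<mu> (\<lambda>y. g (x, y))"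
    and ul: "upper_lipschitz Cf Lf f" and ll: "lower_lipschitz Lg Lgxy Lgyy g"
begin

lemma C1g: "C1 g" using C2g by (rule C2_imp_C1)

lemma const_nonneg: "0 \<le> Cf" "0 \<le> Lf" "0 \<le> Lg" "0 \<le> Lgxy" "0 \<le> Lgyy"
  using ul ll unfolding upper_lipschitz_def lower_lipschitz_def spectral_lipschitz_def
  by (auto dest: lipschitz_on_nonneg)

lemma gradient_f_lip: "norm (gradient f z - gradient f z') \<le> Lf * norm (z - z')"
  using ul unfolding upper_lipschitz_def by (auto dest!: lipschitz_onD[of _ _ _ z z'] simp: dist_norm)

lemma gradient_g_lip: "norm (gradient g z - gradient g z') \<le> Lg * norm (z - z')"
  using ll unfolding lower_lipschitz_def by (auto dest!: lipschitz_onD[of _ _ _ z z'] simp: dist_norm)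

lemma gradient_f_bound: "norm (gradient f z) \<le> Cf"
proof -
  have "norm (gradient f z \<bullet> gradient f z) \<le> Cf * norm (gradient f z)"
    using ul unfolding upper_lipschitz_def
    by (intro has_derivative_norm_le[OF gderiv_gradient[OF C1f, of z, unfolded gderiv_def]])
       (auto dest!: lipschitz_onD[of _ _ _ _ z] simp: dist_norm)
  then have "norm (gradient f z) * norm (gradient f z) \<le> Cf * norm (gradient f z)"
    by (simp add: norm_eq_sqrt_inner[symmetric] power2_norm_eq_inner[symmetric] power2_eq_square)
  then show ?thesis using const_nonneg(1) by (cases "gradient f z = 0") auto
qed

lemma grad_x_f_lip: "norm (grad_x f z - grad_x f z') \<le> Lf * norm (z - z')"
  using order_trans[OF norm_fst_le gradient_f_lip, of z z'] by (simp add: grad_x_eq[OF C1f])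

lemma grad_y_f_lip: "norm (grad_y f z - grad_y f z') \<le> Lf * norm (z - z')"
  using order_trans[OF norm_snd_le gradient_f_lip, of z z'] by (simp add: grad_y_eq[OF C1f])

lemma grad_x_f_bound: "norm (grad_x f z) \<le> Cf"
  using order_trans[OF norm_fst_le gradient_f_bound, of z] by (simp add: grad_x_eq[OF C1f])

lemma grad_y_f_bound: "norm (grad_y f z) \<le> Cf"
  using order_trans[OF norm_snd_le gradient_f_bound, of z] by (simp add: grad_y_eq[OF C1f])

lemma grad_x_g_lip: "norm (grad_x g z - grad_x g z') \<le> Lg * norm (z - z')"
  using order_trans[OF norm_fst_le gradient_g_lip, of z z'] by (simp add: grad_x_eq[OF C1g])

lemma grad_y_g_lip: "norm (grad_y g z - grad_y g z') \<le> Lg * norm (z - z')"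
  using order_trans[OF norm_snd_le gradient_g_lip, of z z'] by (simp add: grad_y_eq[OF C1g])

lemma GDERIV_g_y: "GDERIV (\<lambda>y. g (x, y)) y :> grad_y g (x, y)"
  using GDERIV_snd[OF C1g] by (simp add: grad_y_eq[OF C1g])

section \<open>The second-order blocks of g\<close>

abbreviation "D2 z \<equiv> frechet_derivative (gradient g) (at z)"

lemma D2_works: "(gradient g has_derivative D2 z) (at z)"
  by (rule C2_gradient_differentiable[OF C2g])

lemma gradient_g_section: "((\<lambda>y. gradient g (x, y)) has_derivative (\<lambda>w. D2 (x, y) (0, w))) (at y)"
  by (rule has_derivative_compose[OF _ D2_works, where f="\<lambda>y. (x, y)"])
     (auto intro!: derivative_eq_intros)

lemma grad_x_g_derivative: "((\<lambda>y. grad_x g (x, y)) has_derivative (\<lambda>w. jac_xy g (x, y) *v w)) (at y)"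
proof -
  have "(\<lambda>y. grad_x g (x, y)) differentiable (at y)"
    using has_derivative_fst[OF gradient_g_section[of x y]] unfolding grad_x_eq[OF C1g] differentiable_def by blast
  then show ?thesis unfolding jac_xy_def by (simp add: jacobian_works)
qed

lemma grad_y_g_derivative: "((\<lambda>y. grad_y g (x, y)) has_derivative (\<lambda>w. hess_yy g (x, y) *v w)) (at y)"
proof -
  have "(\<lambda>y. grad_y g (x, y)) differentiable (at y)"
    using has_derivative_snd[OF gradient_g_section[of x y]] unfolding grad_y_eq[OF C1g] differentiable_def by blast
  then show ?thesis unfolding hess_yy_def by (simp add: jacobian_works)
qed

text \<open>\<open>jac_xy\<close> and \<open>hess_yy\<close> arise by differentiating partial
  gradients in y alone; identifying them with blocks of the full second derivative \<open>D2\<close>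
  makes its symmetry available.\<close>

lemma jac_xy_eq: "jac_xy g z *v w = fst (D2 z (0, w))"
  using has_derivative_unique[OF grad_x_g_derivative[of "fst z" "snd z"]
      has_derivative_fst[OF gradient_g_section[of "fst z" "snd z"], folded grad_x_eq[OF C1g]]]
  by (simp add: fun_eq_iff)

lemma hess_yy_eq: "hess_yy g z *v w = snd (D2 z (0, w))"
  using has_derivative_unique[OF grad_y_g_derivative[of "fst z" "snd z"]
      has_derivative_snd[OF gradient_g_section[of "fst z" "snd z"], folded grad_y_eq[OF C1g]]]
  by (simp add: fun_eq_iff)

lemma jac_bound: "norm (jac_xy g z *v w) \<le> Lg * norm w"
proof (rule has_derivative_norm_le[OF grad_x_g_derivative[of "fst z" "snd z", simplified]])
  fix y show "norm (grad_x g (fst z, y) - grad_x g (fst z, snd z)) \<le> Lg * norm (y - snd z)"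
    using grad_x_g_lip[of "(fst z, y)" "(fst z, snd z)"] by (simp add: norm_Pair del: prod.collapse)
qed

lemma hess_bound: "norm (hess_yy g z *v w) \<le> Lg * norm w"
proof (rule has_derivative_norm_le[OF grad_y_g_derivative[of "fst z" "snd z", simplified]])
  fix y show "norm (grad_y g (fst z, y) - grad_y g (fst z, snd z)) \<le> Lg * norm (y - snd z)"
    using grad_y_g_lip[of "(fst z, y)" "(fst z, snd z)"] by (simp add: norm_Pair del: prod.collapse)
qed

lemma jac_lip: "norm ((jac_xy g z - jac_xy g z') *v w) \<le> Lgxy * norm (z - z') * norm w"
proof -
  have "spectral_norm (jac_xy g z - jac_xy g z') \<le> Lgxy * norm (z - z')"
    using ll unfolding lower_lipschitz_def spectral_lipschitz_def dist_norm by blast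
  then show ?thesis
    by (meson norm_matrix_vector_le_spectral mult_right_mono norm_ge_zero order_trans)
qed

lemma hess_lip: "norm ((hess_yy g z - hess_yy g z') *v w) \<le> Lgyy * norm (z - z') * norm w"
proof -
  have "spectral_norm (hess_yy g z - hess_yy g z') \<le> Lgyy * norm (z - z')"
    using ll unfolding lower_lipschitz_def spectral_lipschitz_def dist_norm by blast
  then show ?thesis
    by (meson norm_matrix_vector_le_spectral mult_right_mono norm_ge_zero order_trans)
qed

lemma grad_y_g_lip_y: "norm (grad_y g (x, y) - grad_y g (x, y')) \<le> Lg * norm (y - y')"
  using grad_y_g_lip[of "(x, y)" "(x, y')"] by (simp add: norm_Pair)

lemma strongly_monotone:
  "\<mu> * (norm (y - y'))\<^sup>2 \<le> (grad_y g (x, y) - grad_y g (x, y')) \<bullet> (y - y')"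
  using strongly_monotone_gradient[OF GDERIV_g_y sc] .

text \<open>Strong monotonicity and the Lipschitz bound are compared on one unit vector.\<close>

lemma mu_le_Lg: "\<mu> \<le> Lg"
proof -
  obtain b :: "real^'q" where b: "b \<in> Basis" using nonempty_Basis by blast
  have "\<mu> * (norm (b - 0))\<^sup>2 \<le> (grad_y g (0, b) - grad_y g (0, 0)) \<bullet> (b - 0)"
    by (rule strongly_monotone)
  also have "\<dots> \<le> norm (grad_y g (0, b) - grad_y g (0, 0)) * norm (b - 0)" by (rule norm_cauchy_schwarz)
  also have "\<dots> \<le> Lg * norm (b - 0) * norm (b - 0)" by (intro mult_right_mono grad_y_g_lip_y) auto
  finally show ?thesis using b by simp
qed

lemma cocoercive:
  "Lg * \<mu> * (norm (y - y'))\<^sup>2 + (norm (grad_y g (x, y) - grad_y g (x, y')))\<^sup>2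
    \<le> (Lg + \<mu>) * ((grad_y g (x, y) - grad_y g (x, y')) \<bullet> (y - y'))"
  by (rule strongly_convex_cocoercive[OF GDERIV_g_y sc grad_y_g_lip_y mu_le_Lg])

text \<open>Cocoercivity of the gradient is homogeneous of degree 2, so it passes to difference
  quotients and then to their limit. It makes the contraction lemma of the y-iteration applicable to
  the linear system for v.\<close>

lemma hess_cocoercive:
  "Lg * \<mu> * (norm w)\<^sup>2 + (norm (hess_yy g z *v w))\<^sup>2 \<le> (Lg + \<mu>) * ((hess_yy g z *v w) \<bullet> w)"
proof -
  obtain x y where z: "z = (x, y)" by fastforce
  define q where "q t = (grad_y g (x, y + t *\<^sub>R w) - grad_y g (x, y)) /\<^sub>R t" for t
  have q: "(q \<longlongrightarrow> hess_yy g z *v w) (at_right 0)"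
    unfolding q_def z by (rule directional_derivative[OF grad_y_g_derivative])
  have "\<forall>\<^sub>F t in at_right 0. Lg * \<mu> * (norm w)\<^sup>2 + (norm (q t))\<^sup>2 \<le> (Lg + \<mu>) * (q t \<bullet> w)"
    unfolding eventually_at_right_field
  proof (intro exI[of _ 1] conjI allI impI)
    fix t :: real assume t: "0 < t" "t < 1"
    have dq: "grad_y g (x, y + t *\<^sub>R w) - grad_y g (x, y) = t *\<^sub>R q t" using t by (simp add: q_def)
    have "t\<^sup>2 * (Lg * \<mu> * (norm w)\<^sup>2 + (norm (q t))\<^sup>2) \<le> t\<^sup>2 * ((Lg + \<mu>) * (q t \<bullet> w))"
      using cocoercive[of "y + t *\<^sub>R w" y x] unfolding dq
      by (simp add: power2_eq_square algebra_simps)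
    then show "Lg * \<mu> * (norm w)\<^sup>2 + (norm (q t))\<^sup>2 \<le> (Lg + \<mu>) * (q t \<bullet> w)" using t by simp
  qed simp
  then show ?thesis by (rule tendsto_le[rotated -1]) (auto intro!: tendsto_intros q)
qed

lemma hess_strongly_monotone: "\<mu> * (norm w)\<^sup>2 \<le> (hess_yy g z *v w) \<bullet> w"
proof -
  have "(hess_yy g z *v w) \<bullet> w \<ge> 0"
  proof -
    have "0 \<le> Lg * \<mu> * (norm w)\<^sup>2 + (norm (hess_yy g z *v w))\<^sup>2"
      using mu const_nonneg by simp
    then have "0 \<le> (Lg + \<mu>) * ((hess_yy g z *v w) \<bullet> w)" using hess_cocoercive[of w z] by linarith
    then show ?thesis using mu const_nonneg(3) by (simp add: zero_le_mult_iff)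
  qed
  obtain x y where z: "z = (x, y)" by fastforce
  define q where "q t = (grad_y g (x, y + t *\<^sub>R w) - grad_y g (x, y)) /\<^sub>R t" for t
  have q: "(q \<longlongrightarrow> hess_yy g z *v w) (at_right 0)"
    unfolding q_def z by (rule directional_derivative[OF grad_y_g_derivative])
  have "\<forall>\<^sub>F t in at_right 0. \<mu> * (norm w)\<^sup>2 \<le> q t \<bullet> w"
    unfolding eventually_at_right_field
  proof (intro exI[of _ 1] conjI allI impI)
    fix t :: real assume t: "0 < t" "t < 1"
    have dq: "grad_y g (x, y + t *\<^sub>R w) - grad_y g (x, y) = t *\<^sub>R q t" using t by (simp add: q_def)
    have "t\<^sup>2 * (\<mu> * (norm w)\<^sup>2) \<le> t\<^sup>2 * (q t \<bullet> w)"
      using strongly_monotone[of "y + t *\<^sub>R w" y x] unfolding dq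
      by (simp add: power2_eq_square algebra_simps)
    then show "\<mu> * (norm w)\<^sup>2 \<le> q t \<bullet> w" using t by simp
  qed simp
  then show ?thesis by (rule tendsto_le[rotated -1]) (auto intro!: tendsto_intros q)
qed

text \<open>The difference of the matrices acts on v' and the full matrix on v - v', so the radius
  constrains v' alone.\<close>

lemma dir_x_lip:
  assumes "norm v' \<le> M"
  shows "norm (dir_x f g z v - dir_x f g z' v') \<le> (Lf + M * Lgxy) * norm (z - z') + Lg * norm (v - v')"
proof -
  have eq: "dir_x f g z v - dir_x f g z' v' = (grad_x f z - grad_x f z')
      - (jac_xy g z - jac_xy g z') *v v' - jac_xy g z *v (v - v')"
    unfolding dir_x_def by (simp add: matrix_vector_mult_diff_distrib matrix_vector_mult_diff_rdistrib)
  have "Lgxy * norm (z - z') * norm v' \<le> Lgxy * norm (z - z') * M"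
    using assms const_nonneg by (intro mult_left_mono) auto
  then show ?thesis unfolding eq
    using norm_triangle_ineq4[of "grad_x f z - grad_x f z' - (jac_xy g z - jac_xy g z') *v v'" "jac_xy g z *v (v - v')"]
      norm_triangle_ineq4[of "grad_x f z - grad_x f z'" "(jac_xy g z - jac_xy g z') *v v'"]
      grad_x_f_lip[of z z'] jac_lip[of z z' v'] jac_bound[of z "v - v'"]
    by (simp add: algebra_simps)
qed

lemma dir_v_lip:
  assumes "norm v' \<le> M"
  shows "norm (dir_v f g z v - dir_v f g z' v') \<le> (Lf + M * Lgyy) * norm (z - z') + Lg * norm (v - v')"
proof -
  have eq: "dir_v f g z v - dir_v f g z' v' = (hess_yy g z - hess_yy g z') *v v'
      + hess_yy g z *v (v - v') - (grad_y f z - grad_y f z')"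
    unfolding dir_v_def by (simp add: matrix_vector_mult_diff_distrib matrix_vector_mult_diff_rdistrib)
  have "Lgyy * norm (z - z') * norm v' \<le> Lgyy * norm (z - z') * M"
    using assms const_nonneg by (intro mult_left_mono) auto
  then show ?thesis unfolding eq
    using norm_triangle_ineq4[of "(hess_yy g z - hess_yy g z') *v v' + hess_yy g z *v (v - v')" "grad_y f z - grad_y f z'"]
      norm_triangle_ineq[of "(hess_yy g z - hess_yy g z') *v v'" "hess_yy g z *v (v - v')"]
      grad_y_f_lip[of z z'] hess_lip[of z z' v'] hess_bound[of z "v - v'"]
    by (simp add: algebra_simps)
qed

lemma dir_x_bound: "norm v \<le> M \<Longrightarrow> norm (dir_x f g z v) \<le> Cf + Lg * M"
  unfolding dir_x_def
  using norm_triangle_ineq4[of "grad_x f z" "jac_xy g z *v v"] grad_x_f_bound[of z] jac_bound[of z v]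
    mult_left_mono[of "norm v" M Lg] const_nonneg by simp

definition "Lgg = max Lgxy Lgyy"

text \<open>Origin of the constant M1: the inequality (a + b)^2 \<le> 2 a^2 + 2 b^2 is used once to
  separate z from v and once to split Lf + M Lgg.\<close>

lemma direction_sq_lip:
  assumes M: "norm v' \<le> M" and d: "norm d \<le> (Lf + M * Lc) * norm (z - z') + Lg * norm (v - v')"
    and Lc: "0 \<le> Lc" "Lc \<le> Lgg"
  shows "(norm d)\<^sup>2 \<le> (4 * Lf\<^sup>2 + 4 * M\<^sup>2 * Lgg\<^sup>2) * (norm (z - z'))\<^sup>2 + 2 * Lg\<^sup>2 * (norm (v - v'))\<^sup>2"
proof -
  have M0: "0 \<le> M" using M norm_ge_zero order_trans by blast
  have "(norm d)\<^sup>2 \<le> ((Lf + M * Lc) * norm (z - z') + Lg * norm (v - v'))\<^sup>2"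
    using d by (intro power_mono) auto
  also have "\<dots> \<le> 2 * ((Lf + M * Lc) * norm (z - z'))\<^sup>2 + 2 * (Lg * norm (v - v'))\<^sup>2"
    by (rule square_sum_le)
  also have "\<dots> = 2 * (Lf + M * Lc)\<^sup>2 * (norm (z - z'))\<^sup>2 + 2 * Lg\<^sup>2 * (norm (v - v'))\<^sup>2"
    by (simp add: power_mult_distrib)
  also have "2 * (Lf + M * Lc)\<^sup>2 \<le> 4 * Lf\<^sup>2 + 4 * M\<^sup>2 * Lgg\<^sup>2"
  proof -
    have "(Lf + M * Lc)\<^sup>2 \<le> (Lf + M * Lgg)\<^sup>2"
      using M0 Lc const_nonneg by (intro power_mono add_left_mono mult_left_mono) auto
    also have "\<dots> \<le> 2 * Lf\<^sup>2 + 2 * (M * Lgg)\<^sup>2" by (rule square_sum_le)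
    finally show ?thesis by (simp add: power_mult_distrib)
  qed
  finally show ?thesis by (simp add: mult_right_mono)
qed

lemma dir_x_sq_lip:
  assumes "norm v' \<le> M"
  shows "(norm (dir_x f g z v - dir_x f g z' v'))\<^sup>2
    \<le> (4 * Lf\<^sup>2 + 4 * M\<^sup>2 * Lgg\<^sup>2) * (norm (z - z'))\<^sup>2 + 2 * Lg\<^sup>2 * (norm (v - v'))\<^sup>2"
  by (rule direction_sq_lip[OF assms dir_x_lip[OF assms] const_nonneg(4)]) (simp add: Lgg_def)

lemma dir_v_sq_lip:
  assumes "norm v' \<le> M"
  shows "(norm (dir_v f g z v - dir_v f g z' v'))\<^sup>2
    \<le> (4 * Lf\<^sup>2 + 4 * M\<^sup>2 * Lgg\<^sup>2) * (norm (z - z'))\<^sup>2 + 2 * Lg\<^sup>2 * (norm (v - v'))\<^sup>2"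
  by (rule direction_sq_lip[OF assms dir_v_lip[OF assms] const_nonneg(5)]) (simp add: Lgg_def)

section \<open>The lower-level solution and the adjoint linear system\<close>

abbreviation "ystar \<equiv> lower_solution g"

lemma ystar_minimizes: "g (x, ystar x) \<le> g (x, y)"
proof -
  obtain y0 where y0: "\<And>y. g (x, y0) \<le> g (x, y)"
    by (rule strongly_convex_has_minimizer[OF GDERIV_g_y[of x] sc mu]) blast
  have "\<forall>y. g (x, ystar x) \<le> g (x, y)"
    unfolding lower_solution_def by (rule arg_minI[where x=y0]) (use y0 in \<open>auto simp: not_less\<close>)
  then show ?thesis by blast
qed

lemma grad_y_ystar: "grad_y g (x, ystar x) = 0"
  by (rule minimizer_gradient_zero[OF GDERIV_g_y]) (rule ystar_minimizes)

lemma le_of_square_le_mult: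
  assumes "m * a\<^sup>2 \<le> c * a" "0 \<le> a" "0 < m" "0 \<le> c"
  shows "a \<le> c / (m::real)"
  using assms by (cases "a = 0") (auto simp: power2_eq_square field_simps)

text \<open>Each gradient vanishes at its own minimizer, so the monotonicity gap at x equals a
  change of \<open>grad_y g\<close> in x alone, at the fixed point \<open>ystar x'\<close>.\<close>

lemma ystar_lip: "norm (ystar x - ystar x') \<le> Lg / \<mu> * norm (x - x')"
proof -
  let ?d = "ystar x - ystar x'"
  have "\<mu> * (norm ?d)\<^sup>2 \<le> (grad_y g (x, ystar x) - grad_y g (x, ystar x')) \<bullet> ?d"
    by (rule strongly_monotone)
  also have "\<dots> = (grad_y g (x', ystar x') - grad_y g (x, ystar x')) \<bullet> ?d" by (simp add: grad_y_ystar)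
  also have "\<dots> \<le> norm (grad_y g (x', ystar x') - grad_y g (x, ystar x')) * norm ?d"
    by (rule norm_cauchy_schwarz)
  also have "\<dots> \<le> (Lg * norm (x - x')) * norm ?d"
    using grad_y_g_lip[of "(x', ystar x')" "(x, ystar x')"]
    by (intro mult_right_mono) (auto simp: norm_Pair norm_minus_commute)
  finally show ?thesis
    using le_of_square_le_mult[of \<mu> "norm ?d" "Lg * norm (x - x')"] mu const_nonneg by simp
qed

text \<open>Solved at every z and not just on the graph of \<open>ystar\<close>, so that its
  Lipschitz constant in z composes with that of \<open>zstar\<close>. The Hessian is injective by
  strong convexity, hence the choice is unique.\<close>

definition vhat :: "(real^'p) \<times> (real^'q) \<Rightarrow> real^'q"
  where "vhat z = (SOME v. hess_yy g z *v v = grad_y f z)"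

lemma hess_vhat: "hess_yy g z *v vhat z = grad_y f z"
proof -
  have "inj ((*v) (hess_yy g z))"
  proof (rule injI)
    fix u w assume "hess_yy g z *v u = hess_yy g z *v w"
    then have "\<mu> * (norm (u - w))\<^sup>2 \<le> 0"
      using hess_strongly_monotone[of "u - w" z] by (simp add: matrix_vector_mult_diff_distrib)
    then show "u = w" using mu by (simp add: mult_le_0_iff)
  qed
  then have "surj ((*v) (hess_yy g z))"
    using linear_injective_imp_surjective[OF matrix_vector_mul_linear] by blast
  then have "\<exists>v. hess_yy g z *v v = grad_y f z" by (metis surj_def)
  then show ?thesis unfolding vhat_def by (rule someI_ex)
qed

lemma hess_inverse_bound: "norm w \<le> norm (hess_yy g z *v w) / \<mu>"
proof (rule le_of_square_le_mult[OF _ _ mu])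
  show "\<mu> * (norm w)\<^sup>2 \<le> norm (hess_yy g z *v w) * norm w"
    using hess_strongly_monotone[of w z] norm_cauchy_schwarz[of "hess_yy g z *v w" w] by linarith
qed auto

lemma vhat_bound: "norm (vhat z) \<le> Cf / \<mu>"
  using hess_inverse_bound[of "vhat z" z] grad_y_f_bound[of z] mu
  by (simp add: hess_vhat) (meson divide_right_mono less_imp_le order_trans)

text \<open>Subtracting the systems at z and z' leaves the Hessian at z applied to the difference,
  while the change of the Hessian acts on the bounded vector \<open>vhat z'\<close>.\<close>

lemma vhat_lip: "norm (vhat z - vhat z') \<le> (Lf / \<mu> + Cf * Lgg / \<mu>\<^sup>2) * norm (z - z')"
proof -
  let ?h = "hess_yy g z *v (vhat z - vhat z')"
  have "?h = (grad_y f z - grad_y f z') - (hess_yy g z - hess_yy g z') *v vhat z'"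
    by (simp add: matrix_vector_mult_diff_distrib matrix_vector_mult_diff_rdistrib hess_vhat)
  then have "norm ?h \<le> Lf * norm (z - z') + Lgyy * norm (z - z') * norm (vhat z')"
    using norm_triangle_ineq4[of "grad_y f z - grad_y f z'" "(hess_yy g z - hess_yy g z') *v vhat z'"]
      grad_y_f_lip[of z z'] hess_lip[of z z' "vhat z'"] by simp
  also have "\<dots> \<le> Lf * norm (z - z') + Lgg * norm (z - z') * (Cf / \<mu>)"
    using vhat_bound[of z'] const_nonneg by (intro add_left_mono mult_mono) (auto simp: Lgg_def)
  finally have "norm ?h / \<mu> \<le> (Lf * norm (z - z') + Lgg * norm (z - z') * (Cf / \<mu>)) / \<mu>"
    using mu by (intro divide_right_mono) auto
  also have "\<dots> = (Lf / \<mu> + Cf * Lgg / \<mu>\<^sup>2) * norm (z - z')"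
    using mu by (simp add: field_simps power2_eq_square)
  finally show ?thesis using hess_inverse_bound[of "vhat z - vhat z'" z] by linarith
qed

section \<open>The hypergradient formula and its Lipschitz constant\<close>

definition "zstar x = (x, ystar x)"
definition "vstar x = vhat (zstar x)"
definition "Cy = Lg / \<mu>"
definition "Cv = (Lf / \<mu> + Cf * Lgg / \<mu>\<^sup>2) * (1 + Lg / \<mu>)"
definition "LPhi = Lf + (2 * Lf * Lg + Cf * Lgg) / \<mu> + (Lf * Lg\<^sup>2 + 2 * Cf * Lg * Lgg) / \<mu>\<^sup>2
  + Cf * Lg\<^sup>2 * Lgg / \<mu>^3"

lemma Lgg_nonneg: "0 \<le> Lgg" using const_nonneg by (simp add: Lgg_def)

lemma zstar_lip: "norm (zstar x - zstar x') \<le> (1 + Lg / \<mu>) * norm (x - x')"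
  using norm_Pair_le[of "x - x'" "ystar x - ystar x'"] ystar_lip[of x x']
  by (simp add: zstar_def algebra_simps)

lemma vstar_lip: "norm (vstar x - vstar x') \<le> Cv * norm (x - x')"
proof -
  have "norm (vstar x - vstar x') \<le> (Lf / \<mu> + Cf * Lgg / \<mu>\<^sup>2) * norm (zstar x - zstar x')"
    unfolding vstar_def by (rule vhat_lip)
  also have "\<dots> \<le> (Lf / \<mu> + Cf * Lgg / \<mu>\<^sup>2) * ((1 + Lg / \<mu>) * norm (x - x'))"
    using const_nonneg Lgg_nonneg mu by (intro mult_left_mono zstar_lip) auto
  finally show ?thesis by (simp add: Cv_def mult.assoc)
qed

lemma vstar_bound: "norm (vstar x) \<le> Cf / \<mu>" unfolding vstar_def by (rule vhat_bound)

definition "hypergrad x = dir_x f g (zstar x) (vstar x)"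

text \<open>With \<open>v = v\<^sup>*(x)\<close> frozen, \<open>\<Phi>(x') = l(x', y\<^sup>*(x'))\<close> for the Lagrangian
  \<open>l(z) = f(z) - \<langle>\<nabla>\<^sub>y g(z), v\<rangle>\<close>, because \<open>\<nabla>\<^sub>y g\<close> vanishes along the lower-level solutions. The
  \<open>y\<close>-derivative of \<open>l\<close> vanishes at \<open>z\<^sup>*(x)\<close>, so Lipschitz continuity of \<open>y\<^sup>*\<close> suffices and
  differentiability of \<open>y\<^sup>*\<close> is not needed.\<close>

lemma hyper_objective_GDERIV: "GDERIV (hyper_objective f g) x :> hypergrad x"
proof -
  define v where "v = vstar x"
  define z where "z = zstar x"
  define l where "l u = f u - grad_y g u \<bullet> v" for u
  \<comment> \<open>Symmetry moves the second derivative from h to (0, v), which turns the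
    derivative of the inner product of \<open>grad_y g\<close> with v into
    \<open>jac_xy g z *v v\<close> and \<open>hess_yy g z *v v\<close>.\<close>
  have D2sym: "D2 z u \<bullet> w = D2 z w \<bullet> u" for u w
    by (rule second_derivative_symmetric[OF gderiv_gradient[OF C1g] D2_works])
  have "((\<lambda>u. f u - snd (gradient g u) \<bullet> v) has_derivative
      (\<lambda>h. h \<bullet> gradient f z - snd (D2 z h) \<bullet> v)) (at z)"
    by (intro has_derivative_diff gderiv_gradient[OF C1f, unfolded gderiv_def]
        has_derivative_inner_left has_derivative_snd D2_works)
  moreover have "h \<bullet> gradient f z - snd (D2 z h) \<bullet> v = fst h \<bullet> hypergrad x" for h
  proof -
    have "snd (D2 z h) \<bullet> v = D2 z h \<bullet> (0, v)" by (simp add: inner_prod_def)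
    also have "\<dots> = D2 z (0, v) \<bullet> h" by (rule D2sym)
    also have "\<dots> = (jac_xy g z *v v) \<bullet> fst h + (hess_yy g z *v v) \<bullet> snd h"
      by (simp add: inner_prod_def jac_xy_eq hess_yy_eq)
    \<comment> \<open>The defining equation of v: the y-part of the derivative cancels against
      \<open>grad_y f\<close>.\<close>
    also have "hess_yy g z *v v = grad_y f z" unfolding v_def z_def vstar_def by (rule hess_vhat)
    finally show ?thesis
      unfolding hypergrad_def dir_x_def z_def[symmetric] v_def[symmetric]
      by (simp add: inner_prod_def grad_x_eq[OF C1f] grad_y_eq[OF C1f] inner_diff_right inner_commute)
  qed
  ultimately have l': "(l has_derivative (\<lambda>h. fst h \<bullet> hypergrad x)) (at z)"
    unfolding l_def grad_y_eq[OF C1g] by simp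
  have Phi: "hyper_objective f g x' = l (zstar x')" for x'
    unfolding hyper_objective_def l_def zstar_def by (simp add: grad_y_ystar)
  \<comment> \<open>The Lipschitz constant of \<open>zstar\<close>, by which the tolerance e is
    divided.\<close>
  define c where "c = 1 + Lg / \<mu>"
  have c: "c > 0" using mu const_nonneg(3) by (simp add: c_def add_pos_nonneg)
  show ?thesis unfolding gderiv_def has_derivative_at_alt
  proof (intro conjI allI impI)
    show "bounded_linear (\<lambda>h. h \<bullet> hypergrad x)" by (rule bounded_linear_inner_left)
    fix e :: real assume e: "0 < e"
    obtain d where d: "d > 0" and
      dd: "\<And>u. norm (u - z) < d \<Longrightarrow> norm (l u - l z - fst (u - z) \<bullet> hypergrad x) \<le> e / c * norm (u - z)"
      using l' e c unfolding has_derivative_at_alt by (metis divide_pos_pos)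
    show "\<exists>d>0. \<forall>x'. norm (x' - x) < d \<longrightarrow>
        norm (hyper_objective f g x' - hyper_objective f g x - (x' - x) \<bullet> hypergrad x) \<le> e * norm (x' - x)"
    proof (intro exI[of _ "d / c"] conjI allI impI)
      show "d / c > 0" using d c by simp
      fix x' assume x': "norm (x' - x) < d / c"
      have zl: "norm (zstar x' - z) \<le> c * norm (x' - x)" unfolding z_def c_def by (rule zstar_lip)
      also have "\<dots> < d" using x' c by (simp add: field_simps)
      finally have "norm (l (zstar x') - l z - fst (zstar x' - z) \<bullet> hypergrad x) \<le> e / c * norm (zstar x' - z)"
        by (rule dd)
      also have "\<dots> \<le> e / c * (c * norm (x' - x))" using zl e c by (intro mult_left_mono) auto
      finally show "norm (hyper_objective f g x' - hyper_objective f g x - (x' - x) \<bullet> hypergrad x) \<le> e * norm (x' - x)"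
        using c unfolding Phi by (simp add: z_def zstar_def)
    qed
  qed
qed

lemma gradient_hyper_objective: "gradient (hyper_objective f g) x = hypergrad x"
  by (rule gradient_eq) (rule hyper_objective_GDERIV)

text \<open>Origin of L_Phi: it is (Lf + Cf Lgg / \<mu>) (1 + Lg / \<mu>) + Lg Cv expanded, with Cf
  / \<mu> as the bound on \<open>vstar\<close>.\<close>

lemma hypergrad_lip: "norm (hypergrad x - hypergrad x') \<le> LPhi * norm (x - x')"
proof -
  let ?n = "norm (x - x')"
  have "norm (hypergrad x - hypergrad x')
      \<le> (Lf + Cf / \<mu> * Lgxy) * norm (zstar x - zstar x') + Lg * norm (vstar x - vstar x')"
    unfolding hypergrad_def by (rule dir_x_lip[OF vstar_bound])
  also have "\<dots> \<le> (Lf + Cf / \<mu> * Lgg) * ((1 + Lg / \<mu>) * ?n) + Lg * (Cv * ?n)"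
    using const_nonneg Lgg_nonneg mu
    by (intro add_mono mult_mono zstar_lip vstar_lip order_refl) (auto simp: Lgg_def)
  also have "\<dots> = LPhi * ?n"
    using mu unfolding LPhi_def Cv_def by (simp add: field_simps power2_eq_square power3_eq_cube)
  finally show ?thesis .
qed

text \<open>A uniform bound, which makes |\<nabla>\<Phi>|^2 integrable along any measurable
  iterate.\<close>

lemma hypergrad_bound: "norm (hypergrad x) \<le> Cf + Lg * (Cf / \<mu>)"
  unfolding hypergrad_def by (rule dir_x_bound[OF vstar_bound])

end

section \<open>Variance of recursive momentum estimators\<close>

text \<open>With u replaced by approximating simple functions, which take finitely many values, the
  composition is measurable; continuity in u gives the limit. This makes a sampled direction at a
  random iterate a random variable.\<close>

lemma caratheodory_measurable:
  fixes D :: "'c \<Rightarrow> 'u::euclidean_space \<Rightarrow> 'e::euclidean_space"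
  assumes meas: "\<And>u. (\<lambda>c. D c u) \<in> borel_measurable M"
    and cont: "\<And>c. c \<in> space M \<Longrightarrow> continuous_on UNIV (D c)"
  shows "(\<lambda>p. D (fst p) (snd p)) \<in> borel_measurable (M \<Otimes>\<^sub>M borel)"
proof -
  obtain s :: "nat \<Rightarrow> 'u \<Rightarrow> 'u" where s: "\<And>i. simple_function borel (s i)"
    and lim: "\<And>u. (\<lambda>i. s i u) \<longlonglongrightarrow> u"
    using borel_measurable_implies_sequence_metric[of "\<lambda>u::'u. u" borel 0] by auto
  show ?thesis
  proof (rule borel_measurable_LIMSEQ_metric)
    fix i
    show "(\<lambda>p. D (fst p) (s i (snd p))) \<in> borel_measurable (M \<Otimes>\<^sub>M borel)"
    proof (rule measurable_compose_countable'[where I="range (s i)" and f="\<lambda>u p. D (fst p) u" and g="\<lambda>p. s i (snd p)"])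
      show "(\<lambda>p. s i (snd p)) \<in> measurable (M \<Otimes>\<^sub>M borel) (count_space (range (s i)))"
      proof (rule measurable_compose[OF measurable_snd])
        have "finite (range (s i))" using simple_functionD(1)[OF s[of i]] by simp
        moreover have "s i -` {a} \<inter> space borel \<in> sets borel" for a
          by (rule simple_functionD(2)[OF s])
        ultimately show "s i \<in> measurable borel (count_space (range (s i)))"
          by (subst measurable_count_space_eq2) auto
      qed
      show "countable (range (s i))" using simple_functionD(1)[OF s[of i]] by (simp add: countable_finite)
      show "(\<lambda>p. D (fst p) u) \<in> borel_measurable (M \<Otimes>\<^sub>M borel)" for u
        by (rule measurable_compose[OF measurable_fst meas])
    qed
  next
    fix p assume "p \<in> space (M \<Otimes>\<^sub>M (borel :: 'u measure))"
    then have "fst p \<in> space M" by (auto simp: space_pair_measure)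
    then have "isCont (D (fst p)) (snd p)"
      using cont continuous_on_eq_continuous_at[of UNIV "D (fst p)"] by auto
    then show "(\<lambda>i. D (fst p) (s i (snd p))) \<longlonglongrightarrow> D (fst p) (snd p)"
      using isCont_tendsto_compose lim by blast
  qed
qed

section \<open>Resampling one coordinate of a product of independent samples\<close>

locale sampling = prob_space M for M :: "'c measure"
begin

definition \<Omega> :: "('i \<Rightarrow> 'c) measure" where "\<Omega> = Pi\<^sub>M UNIV (\<lambda>_. M)"

lemma prob_\<Omega>: "prob_space \<Omega>"
  unfolding \<Omega>_def by (intro prob_space_PiM) (rule prob_space_axioms)

lemma component_measurable[measurable]: "(\<lambda>w. w i) \<in> measurable \<Omega> M"
  unfolding \<Omega>_def by (rule measurable_component_singleton) simp

lemma resample_measurable: "(\<lambda>(c, w). w(i := c)) \<in> measurable (M \<Otimes>\<^sub>M \<Omega>) \<Omega>"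
proof -
  have "(\<lambda>p. (snd p)(i := fst p)) \<in> measurable (M \<Otimes>\<^sub>M Pi\<^sub>M UNIV (\<lambda>_. M)) (Pi\<^sub>M (insert i UNIV) (\<lambda>_. M))"
    by (rule measurable_fun_upd[where J=UNIV]) auto
  then show ?thesis unfolding \<Omega>_def by (simp add: case_prod_beta')
qed

text \<open>The form in which independence of the samples is used: overwriting one coordinate by a
  fresh draw leaves the law unchanged.\<close>

lemma resample_distr: "distr (M \<Otimes>\<^sub>M \<Omega>) \<Omega> (\<lambda>(c, w). w(i := c)) = \<Omega>"
  using distr_pair_PiM_eq_PiM[of UNIV "\<lambda>_. M" i] prob_space_axioms unfolding \<Omega>_def by simp

lemma pair_sf: "pair_sigma_finite M \<Omega>"
  by (intro pair_sigma_finite.intro prob_space_imp_sigma_finite prob_\<Omega> prob_space_axioms)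

text \<open>The version for nonnegative functions serves where integrability is still to be
  shown.\<close>

lemma resample_nn_integral:
  assumes \<phi>: "\<phi> \<in> borel_measurable \<Omega>"
  shows "(\<integral>\<^sup>+w. \<phi> w \<partial>\<Omega>) = (\<integral>\<^sup>+w. \<integral>\<^sup>+c. \<phi> (w(i := c)) \<partial>M \<partial>\<Omega>)"
proof -
  interpret P: pair_sigma_finite M \<Omega> by (rule pair_sf)
  have m: "(\<lambda>p. \<phi> (case p of (c, w) \<Rightarrow> w(i := c))) \<in> borel_measurable (M \<Otimes>\<^sub>M \<Omega>)"
    by (rule measurable_compose[OF resample_measurable \<phi>])
  have "(\<integral>\<^sup>+w. \<phi> w \<partial>\<Omega>) = (\<integral>\<^sup>+p. \<phi> (case p of (c, w) \<Rightarrow> w(i := c)) \<partial>(M \<Otimes>\<^sub>M \<Omega>))"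
    using nn_integral_distr[OF resample_measurable[of i], of \<phi>] \<phi> by (simp add: resample_distr)
  also have "\<dots> = (\<integral>\<^sup>+w. \<integral>\<^sup>+c. \<phi> (w(i := c)) \<partial>M \<partial>\<Omega>)"
    using P.nn_integral_snd[OF m] by simp
  finally show ?thesis .
qed

lemma resample_integral:
  fixes \<phi> :: "_ \<Rightarrow> real"
  assumes \<phi>: "integrable \<Omega> \<phi>"
  shows "(\<integral>w. \<phi> w \<partial>\<Omega>) = (\<integral>w. \<integral>c. \<phi> (w(i := c)) \<partial>M \<partial>\<Omega>)"
proof -
  interpret P: pair_sigma_finite M \<Omega> by (rule pair_sf)
  have \<phi>m: "\<phi> \<in> borel_measurable \<Omega>" using \<phi> by simp
  have "integrable (distr (M \<Otimes>\<^sub>M \<Omega>) \<Omega> (\<lambda>(c, w). w(i := c))) \<phi>" using \<phi> by (simp add: resample_distr)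
  then have m: "integrable (M \<Otimes>\<^sub>M \<Omega>) (\<lambda>p. \<phi> (case p of (c, w) \<Rightarrow> w(i := c)))"
    by (rule integrable_distr[OF resample_measurable])
  have "(\<integral>w. \<phi> w \<partial>\<Omega>) = (\<integral>p. \<phi> (case p of (c, w) \<Rightarrow> w(i := c)) \<partial>(M \<Otimes>\<^sub>M \<Omega>))"
    using integral_distr[OF resample_measurable[of i] \<phi>m] by (simp add: resample_distr)
  also have "\<dots> = (\<integral>w. \<integral>c. \<phi> (w(i := c)) \<partial>M \<partial>\<Omega>)"
    using P.integral_snd[of "\<lambda>c w. \<phi> (w(i := c))"] m by (simp add: case_prod_beta')
  finally show ?thesis .
qed

text \<open>The martingale step behind all variance bounds: U does not see coordinate i, and N has
  conditional mean 0 given the other coordinates, so the squared norms add without a cross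
  term.\<close>

lemma add_centered_sample:
  fixes U :: "('i \<Rightarrow> 'c) \<Rightarrow> 'e::euclidean_space" and N :: "('i \<Rightarrow> 'c) \<Rightarrow> 'c \<Rightarrow> 'e"
  assumes U: "U \<in> borel_measurable \<Omega>" and U2: "integrable \<Omega> (\<lambda>w. (norm (U w))\<^sup>2)"
    and Ui: "\<And>w c. U (w(i := c)) = U w"
    and N: "(\<lambda>p. N (fst p) (snd p)) \<in> borel_measurable (\<Omega> \<Otimes>\<^sub>M M)"
    and Ni: "\<And>w c. N (w(i := c)) = N w"
    and N0: "\<And>w. w \<in> space \<Omega> \<Longrightarrow> integrable M (N w)" "\<And>w. w \<in> space \<Omega> \<Longrightarrow> (\<integral>c. N w c \<partial>M) = 0"
    and NB: "\<And>w. w \<in> space \<Omega> \<Longrightarrow> (\<integral>\<^sup>+c. ennreal ((norm (N w c))\<^sup>2) \<partial>M) \<le> ennreal (B w)"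
    and B: "integrable \<Omega> B" "\<And>w. w \<in> space \<Omega> \<Longrightarrow> 0 \<le> B w"
  shows "integrable \<Omega> (\<lambda>w. (norm (U w + a *\<^sub>R N w (w i)))\<^sup>2)" (is ?int)
    and "(\<integral>w. (norm (U w + a *\<^sub>R N w (w i)))\<^sup>2 \<partial>\<Omega>) \<le> (\<integral>w. (norm (U w))\<^sup>2 \<partial>\<Omega>) + a\<^sup>2 * (\<integral>w. B w \<partial>\<Omega>)" (is ?le)
    and "(\<lambda>w. U w + a *\<^sub>R N w (w i)) \<in> borel_measurable \<Omega>" (is ?meas)
proof -
  define W where "W w = N w (w i)" for w
  have W[measurable]: "W \<in> borel_measurable \<Omega>"
    unfolding W_def using measurable_compose[OF measurable_Pair[OF measurable_ident component_measurable[of i]] N]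
    by (simp add: comp_def id_def)
  note U[measurable]
  \<comment> \<open>Nonnegative integrals come first: resampling i exposes the conditional bound B,
    and finiteness then gives integrability of |W|^2.\<close>
  have nn: "(\<integral>\<^sup>+w. ennreal ((norm (W w))\<^sup>2) \<partial>\<Omega>) \<le> (\<integral>\<^sup>+w. ennreal (B w) \<partial>\<Omega>)"
  proof (subst resample_nn_integral[of _ i])
    show "(\<integral>\<^sup>+w. \<integral>\<^sup>+c. ennreal ((norm (W (w(i := c))))\<^sup>2) \<partial>M \<partial>\<Omega>) \<le> (\<integral>\<^sup>+w. ennreal (B w) \<partial>\<Omega>)"
      by (intro nn_integral_mono) (simp add: W_def Ni NB)
  qed measurable
  also have "\<dots> = ennreal (\<integral>w. B w \<partial>\<Omega>)"
    using B by (intro nn_integral_eq_integral) (auto intro!: AE_I2)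
  finally have nnW: "(\<integral>\<^sup>+w. ennreal ((norm (W w))\<^sup>2) \<partial>\<Omega>) \<le> ennreal (\<integral>w. B w \<partial>\<Omega>)" .
  have W2: "integrable \<Omega> (\<lambda>w. (norm (W w))\<^sup>2)"
    by (rule integrableI_bounded) (use nnW in \<open>auto simp: le_less_trans[OF _ ennreal_less_top]\<close>)
  have B0: "0 \<le> (\<integral>w. B w \<partial>\<Omega>)" using B by (intro integral_nonneg_AE) (auto intro!: AE_I2)
  have W2le: "(\<integral>w. (norm (W w))\<^sup>2 \<partial>\<Omega>) \<le> (\<integral>w. B w \<partial>\<Omega>)"
    using nnW nn_integral_eq_integral[OF W2] B0 by (simp add: ennreal_le_iff)
  have UW: "integrable \<Omega> (\<lambda>w. U w \<bullet> W w)"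
  proof (rule Bochner_Integration.integrable_bound[of _ "\<lambda>w. (norm (U w))\<^sup>2 + (norm (W w))\<^sup>2"])
    show "AE w in \<Omega>. norm (U w \<bullet> W w) \<le> norm ((norm (U w))\<^sup>2 + (norm (W w))\<^sup>2)"
    proof (intro AE_I2)
      fix w
      have "\<bar>U w \<bullet> W w\<bar> \<le> norm (U w) * norm (W w)" by (rule Cauchy_Schwarz_ineq2)
      also have "\<dots> \<le> (norm (U w))\<^sup>2 + (norm (W w))\<^sup>2"
        using sum_squares_bound[of "norm (U w)" "norm (W w)"] mult_nonneg_nonneg[of "norm (U w)" "norm (W w)"] by (simp del: mult_nonneg_nonneg)
      finally show "norm (U w \<bullet> W w) \<le> norm ((norm (U w))\<^sup>2 + (norm (W w))\<^sup>2)" by simp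
    qed
  qed (use U2 W2 in auto)
  \<comment> \<open>After resampling, U is constant in the fresh sample and N integrates to
    0.\<close>
  have "(\<integral>w. U w \<bullet> W w \<partial>\<Omega>) = (\<integral>w. \<integral>c. U w \<bullet> N w c \<partial>M \<partial>\<Omega>)"
    by (subst resample_integral[OF UW, of i]) (simp add: W_def Ui Ni)
  also have "\<dots> = (\<integral>w. 0 \<partial>(\<Omega> :: ('i \<Rightarrow> 'c) measure))"
    by (rule Bochner_Integration.integral_cong) (simp_all add: integral_inner_right N0)
  finally have UW0: "(\<integral>w. U w \<bullet> W w \<partial>\<Omega>) = 0" by simp
  have eq: "(norm (U w + a *\<^sub>R N w (w i)))\<^sup>2 = (norm (U w))\<^sup>2 + 2 * a * (U w \<bullet> W w) + a\<^sup>2 * (norm (W w))\<^sup>2" for w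
    unfolding W_def[symmetric] power2_norm_eq_inner
    by (simp add: inner_add_left inner_add_right inner_commute power2_eq_square)
  show ?int unfolding eq using U2 W2 UW by auto
  show ?le unfolding eq using U2 W2 UW UW0 W2le by (simp add: mult_left_mono)
  show ?meas unfolding W_def[symmetric] by measurable
qed

text \<open>The samples of a batch are added one at a time; each contributes at most the mean of B
  divided by n^2, and n of them give the reduction by 1 / n.\<close>

lemma add_batch_noise:
  fixes U :: "('b \<times> nat \<Rightarrow> 'c) \<Rightarrow> 'e::euclidean_space" and N :: "('b \<times> nat \<Rightarrow> 'c) \<Rightarrow> 'c \<Rightarrow> 'e"
  assumes n: "0 < n"
    and U: "U \<in> borel_measurable \<Omega>" and U2: "integrable \<Omega> (\<lambda>w. (norm (U w))\<^sup>2)"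
    and Ui: "\<And>w i c. U (w((b, i) := c)) = U w"
    and N: "(\<lambda>p. N (fst p) (snd p)) \<in> borel_measurable (\<Omega> \<Otimes>\<^sub>M M)"
    and Ni: "\<And>w i c. N (w((b, i) := c)) = N w"
    and N0: "\<And>w. w \<in> space \<Omega> \<Longrightarrow> integrable M (N w)" "\<And>w. w \<in> space \<Omega> \<Longrightarrow> (\<integral>c. N w c \<partial>M) = 0"
    and NB: "\<And>w. w \<in> space \<Omega> \<Longrightarrow> (\<integral>\<^sup>+c. ennreal ((norm (N w c))\<^sup>2) \<partial>M) \<le> ennreal (B w)"
    and B: "integrable \<Omega> B" "\<And>w. w \<in> space \<Omega> \<Longrightarrow> 0 \<le> B w"
  defines "V \<equiv> \<lambda>w. U w + batch_mean n (\<lambda>i. N w (w (b, i)))"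
  shows "integrable \<Omega> (\<lambda>w. (norm (V w))\<^sup>2)"
    and "(\<integral>w. (norm (V w))\<^sup>2 \<partial>\<Omega>) \<le> (\<integral>w. (norm (U w))\<^sup>2 \<partial>\<Omega>) + (\<integral>w. B w \<partial>\<Omega>) / real n"
proof -
  \<comment> \<open>The normalisation 1 / n is fixed from the start, so partial sums need no
    rescaling; sample m does not occur in \<open>S m\<close>.\<close>
  define S where "S m w = U w + (1 / real n) *\<^sub>R (\<Sum>i<m. N w (w (b, i)))" for m w
  have SS: "S (Suc m) w = S m w + (1 / real n) *\<^sub>R N w (w (b, m))" for m w
    unfolding S_def by (simp add: scaleR_right_distrib)
  have Si: "S m (w((b, m) := c)) = S m w" for m w c
    unfolding S_def by (auto simp: Ui Ni intro!: sum.cong)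
  have "S m \<in> borel_measurable \<Omega> \<and> integrable \<Omega> (\<lambda>w. (norm (S m w))\<^sup>2)
     \<and> (\<integral>w. (norm (S m w))\<^sup>2 \<partial>\<Omega>) \<le> (\<integral>w. (norm (U w))\<^sup>2 \<partial>\<Omega>) + real m * ((1 / real n)\<^sup>2 * (\<integral>w. B w \<partial>\<Omega>))" for m
  proof (induction m)
    case 0
    then show ?case using U U2 by (simp add: S_def[abs_def])
  next
    case (Suc m)
    note step = add_centered_sample[where i = "(b, m)" and a = "1 / real n",
        OF conjunct1[OF Suc] conjunct1[OF conjunct2[OF Suc]] Si N Ni N0 NB B, folded SS]
    have "(\<integral>w. (norm (S (Suc m) w))\<^sup>2 \<partial>\<Omega>) \<le> (\<integral>w. (norm (S m w))\<^sup>2 \<partial>\<Omega>) + (1 / real n)\<^sup>2 * (\<integral>w. B w \<partial>\<Omega>)"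
      by (rule step(2))
    also have "\<dots> \<le> (\<integral>w. (norm (U w))\<^sup>2 \<partial>\<Omega>) + real (Suc m) * ((1 / real n)\<^sup>2 * (\<integral>w. B w \<partial>\<Omega>))"
      using Suc by (simp add: algebra_simps)
    finally show ?case using step(1,3) by blast
  qed
  from this[of n] have *: "integrable \<Omega> (\<lambda>w. (norm (S n w))\<^sup>2)"
    "(\<integral>w. (norm (S n w))\<^sup>2 \<partial>\<Omega>) \<le> (\<integral>w. (norm (U w))\<^sup>2 \<partial>\<Omega>) + real n * ((1 / real n)\<^sup>2 * (\<integral>w. B w \<partial>\<Omega>))"
    by auto
  have VS: "V = S n" unfolding V_def S_def batch_mean_def by simp
  show "integrable \<Omega> (\<lambda>w. (norm (V w))\<^sup>2)" unfolding VS by (rule *)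
  show "(\<integral>w. (norm (V w))\<^sup>2 \<partial>\<Omega>) \<le> (\<integral>w. (norm (U w))\<^sup>2 \<partial>\<Omega>) + (\<integral>w. B w \<partial>\<Omega>) / real n"
    using *(2) n unfolding VS by (simp add: power2_eq_square)
qed

text \<open>The variance is at most the second moment. It is applied to the difference of one
  sample's directions at two points, for which r is a pointwise Lipschitz bound.\<close>

lemma centered_second_moment_le:
  fixes Z :: "'c \<Rightarrow> 'e::euclidean_space"
  assumes Z: "integrable M Z" and le: "\<And>c. c \<in> space M \<Longrightarrow> (norm (Z c))\<^sup>2 \<le> r"
  shows "integrable M (\<lambda>c. (norm (Z c - (\<integral>c. Z c \<partial>M)))\<^sup>2)"
    and "(\<integral>c. (norm (Z c - (\<integral>c. Z c \<partial>M)))\<^sup>2 \<partial>M) \<le> r"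
proof -
  define m where "m = (\<integral>c. Z c \<partial>M)"
  have Zm[measurable]: "Z \<in> borel_measurable M" using Z by simp
  have Z2: "integrable M (\<lambda>c. (norm (Z c))\<^sup>2)"
    by (rule integrable_const_bound[where B=r]) (auto intro!: AE_I2 le)
  have eq: "(norm (Z c - m))\<^sup>2 = (norm (Z c))\<^sup>2 - 2 * (m \<bullet> Z c) + (norm m)\<^sup>2" for c
    unfolding power2_norm_eq_inner by (simp add: inner_diff_left inner_diff_right inner_commute)
  have mZ: "(\<integral>c. m \<bullet> Z c \<partial>M) = (norm m)\<^sup>2"
    using Z by (simp add: integral_inner_right m_def power2_norm_eq_inner)
  have imZ: "integrable M (\<lambda>c. m \<bullet> Z c)" using Z by simp
  show "integrable M (\<lambda>c. (norm (Z c - (\<integral>c. Z c \<partial>M)))\<^sup>2)"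
    unfolding m_def[symmetric] eq using Z2 imZ by auto
  have "(\<integral>c. (norm (Z c - m))\<^sup>2 \<partial>M) = (\<integral>c. (norm (Z c))\<^sup>2 \<partial>M) - (norm m)\<^sup>2"
    unfolding eq using Z2 imZ by (simp add: mZ prob_space)
  also have "(\<integral>c. (norm (Z c))\<^sup>2 \<partial>M) \<le> (\<integral>c. r \<partial>M)"
    by (rule integral_mono[OF Z2]) (auto intro: le)
  finally show "(\<integral>c. (norm (Z c - (\<integral>c. Z c \<partial>M)))\<^sup>2 \<partial>M) \<le> r"
    unfolding m_def[symmetric] by (simp add: prob_space) (smt (verit) zero_le_power2)
qed

text \<open>The moment bounds are confined to S because the variance of a matrix-vector product
  grows with the vector; measurability is global, so that random iterates can be inserted.\<close>

definition oracle_on ::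
    "'u set \<Rightarrow> ('c \<Rightarrow> 'u::euclidean_space \<Rightarrow> 'e::euclidean_space) \<Rightarrow> ('u \<Rightarrow> 'e) \<Rightarrow> real \<Rightarrow> bool"
  where "oracle_on S D m v \<longleftrightarrow>
    (\<lambda>p. D (fst p) (snd p)) \<in> borel_measurable (M \<Otimes>\<^sub>M borel) \<and> m \<in> borel_measurable borel \<and>
    (\<forall>u\<in>S. integrable M (\<lambda>c. D c u) \<and> (\<integral>c. D c u \<partial>M) = m u \<and>
      integrable M (\<lambda>c. (norm (D c u - m u))\<^sup>2) \<and> (\<integral>c. (norm (D c u - m u))\<^sup>2 \<partial>M) \<le> v)"

lemma oracle_onD:
  assumes "oracle_on S D m v"
  shows "(\<lambda>p. D (fst p) (snd p)) \<in> borel_measurable (M \<Otimes>\<^sub>M borel)" "m \<in> borel_measurable borel"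
    "u \<in> S \<Longrightarrow> integrable M (\<lambda>c. D c u)" "u \<in> S \<Longrightarrow> (\<integral>c. D c u \<partial>M) = m u"
    "u \<in> S \<Longrightarrow> integrable M (\<lambda>c. (norm (D c u - m u))\<^sup>2)"
    "u \<in> S \<Longrightarrow> (\<integral>c. (norm (D c u - m u))\<^sup>2 \<partial>M) \<le> v"
  using assms unfolding oracle_on_def by auto

lemma batch_mean_linear:
  fixes d d' :: "nat \<Rightarrow> 'e::real_vector"
  assumes "0 < n"
  shows "batch_mean n (\<lambda>i. (d i - a) - t *\<^sub>R (d' i - a')) = (batch_mean n d - a) - t *\<^sub>R (batch_mean n d' - a')"
  using assms unfolding batch_mean_def
  by (simp add: sum_subtractf scaleR_right_diff_distrib scaleR_sum_right[symmetric] sum_constant_scaleR mult.commute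
      scaleR_left_commute)

text \<open>The new error is \<open>(1 - \<tau>)\<close> times the old one plus a batch average of centered terms
  \<open>\<tau> (D u' - m u') + (1 - \<tau>) ((D u' - D u) - (m u' - m u))\<close>.\<close>

lemma momentum_step:
  fixes D :: "'c \<Rightarrow> 'u::euclidean_space \<Rightarrow> 'e::euclidean_space"
    and U U' :: "('b \<times> nat \<Rightarrow> 'c) \<Rightarrow> 'u" and est :: "('b \<times> nat \<Rightarrow> 'c) \<Rightarrow> 'e"
  assumes n: "0 < n" and ora: "oracle_on S D m v"
    and U[measurable]: "U \<in> borel_measurable \<Omega>" "U' \<in> borel_measurable \<Omega>" "est \<in> borel_measurable \<Omega>"
    and US: "\<And>w. w \<in> space \<Omega> \<Longrightarrow> U w \<in> S" "\<And>w. w \<in> space \<Omega> \<Longrightarrow> U' w \<in> S"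
    and inv: "\<And>w i c. U (w((b, i) := c)) = U w" "\<And>w i c. U' (w((b, i) := c)) = U' w"
      "\<And>w i c. est (w((b, i) := c)) = est w"
    and e2: "integrable \<Omega> (\<lambda>w. (norm (est w - m (U w)))\<^sup>2)"
    and lip: "\<And>w c. w \<in> space \<Omega> \<Longrightarrow> c \<in> space M \<Longrightarrow> (norm (D c (U' w) - D c (U w)))\<^sup>2 \<le> \<rho> w"
    and \<rho>: "integrable \<Omega> \<rho>"
    and \<tau>: "0 \<le> \<tau>" "\<tau> \<le> 1"
  defines "e' \<equiv> \<lambda>w. batch_mean n (\<lambda>i. D (w (b, i)) (U' w))
      + (1 - \<tau>) *\<^sub>R (est w - batch_mean n (\<lambda>i. D (w (b, i)) (U w))) - m (U' w)"
  shows "integrable \<Omega> (\<lambda>w. (norm (e' w))\<^sup>2)"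
    and "(\<integral>w. (norm (e' w))\<^sup>2 \<partial>\<Omega>)
      \<le> (1 - \<tau>) * (\<integral>w. (norm (est w - m (U w)))\<^sup>2 \<partial>\<Omega>) + 2 / real n * (\<tau>\<^sup>2 * v + (\<integral>w. \<rho> w \<partial>\<Omega>))"
proof -
  interpret O: prob_space "\<Omega> :: ('b \<times> nat \<Rightarrow> 'c) measure" by (rule prob_\<Omega>)
  note [measurable] = oracle_onD(1,2)[OF ora]
  \<comment> \<open>For fixed w this is centered in the fresh sample c; its batch average added to W
    is exactly the new error.\<close>
  define N where "N w c = (D c (U' w) - m (U' w)) - (1 - \<tau>) *\<^sub>R (D c (U w) - m (U w))" for w c
  define W where "W w = (1 - \<tau>) *\<^sub>R (est w - m (U w))" for w
  define B where "B w = 2 * \<tau>\<^sup>2 * v + 2 * \<rho> w" for w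
  have Dm[measurable]: "(\<lambda>p. D (snd p) (X (fst p))) \<in> borel_measurable (\<Omega> \<Otimes>\<^sub>M M)"
    if X: "X \<in> borel_measurable (\<Omega> :: ('b \<times> nat \<Rightarrow> 'c) measure)" for X
    using measurable_compose[OF measurable_Pair[OF measurable_snd measurable_compose[OF measurable_fst X]] oracle_onD(1)[OF ora]]
    by simp
  have space_ne: "\<exists>c. c \<in> space M" using not_empty by blast
  \<comment> \<open>The Lipschitz premise forces \<rho> to be nonnegative, since a sample
    exists.\<close>
  have \<rho>0: "0 \<le> \<rho> w" if "w \<in> space \<Omega>" for w
    using lip[OF that] space_ne by (meson order_trans zero_le_power2)
  have v0: "0 \<le> v"
  proof -
    obtain w where "w \<in> space (\<Omega> :: ('b \<times> nat \<Rightarrow> 'c) measure)" using O.not_empty by blast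
    then have "0 \<le> (\<integral>c. (norm (D c (U w) - m (U w)))\<^sup>2 \<partial>M)" by simp
    also have "\<dots> \<le> v" using oracle_onD(6)[OF ora US(1)] \<open>w \<in> space \<Omega>\<close> by blast
    finally show ?thesis .
  qed
  have NB: "(\<integral>\<^sup>+c. ennreal ((norm (N w c))\<^sup>2) \<partial>M) \<le> ennreal (B w)" if w: "w \<in> space \<Omega>" for w
  proof -
    define Z where "Z c = D c (U' w) - D c (U w)" for c
    have iD: "integrable M (\<lambda>c. D c (U' w))" "integrable M (\<lambda>c. D c (U w))"
      using oracle_onD(3)[OF ora] US[OF w] by auto
    have Z: "integrable M Z" unfolding Z_def using iD by simp
    have mZ: "(\<integral>c. Z c \<partial>M) = m (U' w) - m (U w)"
      unfolding Z_def using iD oracle_onD(4)[OF ora] US[OF w] by simp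
    note Z2 = centered_second_moment_le[OF Z, of "\<rho> w", unfolded mZ, OF lip[OF w, folded Z_def]]
    have iU: "integrable M (\<lambda>c. (norm (D c (U' w) - m (U' w)))\<^sup>2)"
      "(\<integral>c. (norm (D c (U' w) - m (U' w)))\<^sup>2 \<partial>M) \<le> v"
      using oracle_onD(5,6)[OF ora US(2)[OF w]] by auto
    have ptw: "(norm (N w c))\<^sup>2 \<le> 2 * \<tau>\<^sup>2 * (norm (D c (U' w) - m (U' w)))\<^sup>2
        + 2 * (norm (Z c - (m (U' w) - m (U w))))\<^sup>2" for c
    proof -
      have "N w c = \<tau> *\<^sub>R (D c (U' w) - m (U' w)) + (1 - \<tau>) *\<^sub>R (Z c - (m (U' w) - m (U w)))"
        unfolding N_def Z_def by (simp add: algebra_simps)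
      then have "(norm (N w c))\<^sup>2 \<le> 2 * (norm (\<tau> *\<^sub>R (D c (U' w) - m (U' w))))\<^sup>2
          + 2 * (norm ((1 - \<tau>) *\<^sub>R (Z c - (m (U' w) - m (U w)))))\<^sup>2"
        by (metis norm_add_square_le)
      also have "\<dots> = 2 * \<tau>\<^sup>2 * (norm (D c (U' w) - m (U' w)))\<^sup>2
          + 2 * ((1 - \<tau>)\<^sup>2 * (norm (Z c - (m (U' w) - m (U w))))\<^sup>2)"
        by (simp add: power_mult_distrib)
      also have "(1 - \<tau>)\<^sup>2 * (norm (Z c - (m (U' w) - m (U w))))\<^sup>2 \<le> 1 * (norm (Z c - (m (U' w) - m (U w))))\<^sup>2"
        using \<tau> by (intro mult_right_mono power_le_one) auto
      finally show ?thesis by simp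
    qed
    have "(\<integral>\<^sup>+c. ennreal ((norm (N w c))\<^sup>2) \<partial>M)
        \<le> (\<integral>\<^sup>+c. ennreal (2 * \<tau>\<^sup>2 * (norm (D c (U' w) - m (U' w)))\<^sup>2
            + 2 * (norm (Z c - (m (U' w) - m (U w))))\<^sup>2) \<partial>M)"
      by (intro nn_integral_mono ennreal_leI ptw)
    also have "\<dots> = ennreal (\<integral>c. 2 * \<tau>\<^sup>2 * (norm (D c (U' w) - m (U' w)))\<^sup>2
            + 2 * (norm (Z c - (m (U' w) - m (U w))))\<^sup>2 \<partial>M)"
      by (intro nn_integral_eq_integral Bochner_Integration.integrable_add integrable_mult_right iU Z2) auto
    also have "(\<integral>c. 2 * \<tau>\<^sup>2 * (norm (D c (U' w) - m (U' w)))\<^sup>2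
            + 2 * (norm (Z c - (m (U' w) - m (U w))))\<^sup>2 \<partial>M)
        = 2 * \<tau>\<^sup>2 * (\<integral>c. (norm (D c (U' w) - m (U' w)))\<^sup>2 \<partial>M)
            + 2 * (\<integral>c. (norm (Z c - (m (U' w) - m (U w))))\<^sup>2 \<partial>M)"
      using iU(1) Z2(1) by simp
    also have "\<dots> \<le> B w"
      unfolding B_def using iU(2) Z2(2) by (intro add_mono mult_left_mono) auto
    finally show ?thesis by (simp add: ennreal_leI)
  qed
  have W2: "integrable \<Omega> (\<lambda>w. (norm (W w))\<^sup>2)"
    unfolding W_def using e2 by (simp add: power_mult_distrib)
  have Wm: "W \<in> borel_measurable \<Omega>" unfolding W_def by measurable
  have Nm: "(\<lambda>p. N (fst p) (snd p)) \<in> borel_measurable (\<Omega> \<Otimes>\<^sub>M M)"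
    unfolding N_def by measurable
  have Nint: "integrable M (N w)" "(\<integral>c. N w c \<partial>M) = 0" if w: "w \<in> space \<Omega>" for w
    using oracle_onD(3,4)[OF ora US(1)[OF w]] oracle_onD(3,4)[OF ora US(2)[OF w]]
    unfolding N_def by (auto simp: prob_space)
  have Bint: "integrable \<Omega> B" unfolding B_def using \<rho> by simp
  have B0: "0 \<le> B w" if "w \<in> space \<Omega>" for w unfolding B_def using \<rho>0[OF that] v0 by simp
  have e'_eq: "W w + batch_mean n (\<lambda>i. N w (w (b, i))) = e' w" for w
    unfolding W_def N_def batch_mean_linear[OF n] e'_def by (simp add: algebra_simps)
  have Ninv: "N (w((b, i) := c)) = N w" and Winv: "W (w((b, i) := c)) = W w" for w i c
    unfolding N_def W_def by (simp_all add: inv)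
  note res = add_batch_noise[OF n Wm W2 Winv Nm Ninv Nint NB Bint B0, unfolded e'_eq]
  show "integrable \<Omega> (\<lambda>w. (norm (e' w))\<^sup>2)" by (rule res(1))
  have "(\<integral>w. (norm (W w))\<^sup>2 \<partial>\<Omega>) = (1 - \<tau>)\<^sup>2 * (\<integral>w. (norm (est w - m (U w)))\<^sup>2 \<partial>\<Omega>)"
    unfolding W_def by (simp add: power_mult_distrib)
  also have "\<dots> \<le> (1 - \<tau>) * (\<integral>w. (norm (est w - m (U w)))\<^sup>2 \<partial>\<Omega>)"
    using \<tau> by (intro mult_right_mono) (auto simp: power2_eq_square mult_left_le)
  finally have "(\<integral>w. (norm (W w))\<^sup>2 \<partial>\<Omega>) \<le> (1 - \<tau>) * (\<integral>w. (norm (est w - m (U w)))\<^sup>2 \<partial>\<Omega>)" .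
  moreover have "(\<integral>w. B w \<partial>\<Omega>) / real n = 2 / real n * (\<tau>\<^sup>2 * v + (\<integral>w. \<rho> w \<partial>\<Omega>))"
    unfolding B_def using \<rho> by (simp add: O.prob_space algebra_simps add_divide_distrib)
  ultimately show "(\<integral>w. (norm (e' w))\<^sup>2 \<partial>\<Omega>)
      \<le> (1 - \<tau>) * (\<integral>w. (norm (est w - m (U w)))\<^sup>2 \<partial>\<Omega>) + 2 / real n * (\<tau>\<^sup>2 * v + (\<integral>w. \<rho> w \<partial>\<Omega>))"
    using res(2) by linarith
qed

text \<open>At a deterministic point u this is \<open>add_batch_noise\<close> with U = 0 and
  constant B.\<close>

lemma batch_mean_error:
  fixes D :: "'c \<Rightarrow> 'u::euclidean_space \<Rightarrow> 'e::euclidean_space"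
    and b :: 'b
  assumes n: "0 < n" and ora: "oracle_on S D m v" and u: "u \<in> S"
  defines "e \<equiv> \<lambda>w. batch_mean n (\<lambda>i. D (w (b, i)) u) - m u"
  shows "integrable \<Omega> (\<lambda>w :: 'b \<times> nat \<Rightarrow> 'c. (norm (e w))\<^sup>2)"
    and "(\<integral>w. (norm (e w))\<^sup>2 \<partial>(\<Omega> :: ('b \<times> nat \<Rightarrow> 'c) measure)) \<le> v / real n"
proof -
  interpret O: prob_space "\<Omega> :: ('b \<times> nat \<Rightarrow> 'c) measure" by (rule prob_\<Omega>)
  note o = oracle_onD(3-6)[OF ora u]
  have v0: "0 \<le> v" using order_trans[OF integral_nonneg_AE o(4)] by simp
  have Dm: "(\<lambda>p. D (snd p) u - m u) \<in> borel_measurable ((\<Omega> :: ('b \<times> nat \<Rightarrow> 'c) measure) \<Otimes>\<^sub>M M)"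
    by (intro borel_measurable_diff borel_measurable_const
        measurable_compose[OF measurable_snd borel_measurable_integrable[OF o(1)]])
  have NB: "(\<integral>\<^sup>+c. ennreal ((norm (D c u - m u))\<^sup>2) \<partial>M) \<le> ennreal v"
    using nn_integral_eq_integral[OF o(3)] o(4) by (simp add: ennreal_leI)
  have N0: "(\<integral>c. D c u - m u \<partial>M) = 0" using o(1,2) by (simp add: prob_space)
  have e_eq: "0 + batch_mean n (\<lambda>i. D (w (b, i)) u - m u) = e w" for w
    using batch_mean_linear[OF n, of "\<lambda>i. D (w (b, i)) u" "m u" 0 "\<lambda>_. 0" 0] by (simp add: e_def)
  have "(\<lambda>_. 0 :: 'e) \<in> borel_measurable (\<Omega> :: ('b \<times> nat \<Rightarrow> 'c) measure)" by simp
  note res = add_batch_noise[OF n this, where N = "\<lambda>_ c. D c u - m u" and B = "\<lambda>_. v" and b = b,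
      unfolded e_eq]
  show "integrable \<Omega> (\<lambda>w :: 'b \<times> nat \<Rightarrow> 'c. (norm (e w))\<^sup>2)"
    by (rule res(1)) (use Dm NB N0 o(1) v0 in auto)
  have "(\<integral>w. (norm (e w))\<^sup>2 \<partial>(\<Omega> :: ('b \<times> nat \<Rightarrow> 'c) measure)) \<le> (\<integral>w. (norm (0::'e))\<^sup>2 \<partial>(\<Omega> :: ('b \<times> nat \<Rightarrow> 'c) measure)) + (\<integral>w. v \<partial>(\<Omega> :: ('b \<times> nat \<Rightarrow> 'c) measure)) / real n"
    by (rule res(2)) (use Dm NB N0 o(1) v0 in auto)
  then show "(\<integral>w. (norm (e w))\<^sup>2 \<partial>(\<Omega> :: ('b \<times> nat \<Rightarrow> 'c) measure)) \<le> v / real n"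
    by (simp add: O.prob_space)
qed

end

section \<open>One outer iteration of the Lyapunov argument\<close>

lemma telescope_le:
  fixes p c :: "nat \<Rightarrow> real"
  assumes "\<And>t. t < n \<Longrightarrow> p (Suc t) \<le> p t + c t"
  shows "p n \<le> p 0 + (\<Sum>t<n. c t)"
  using assms
proof (induction n)
  case (Suc n)
  have "p n \<le> p 0 + (\<Sum>t<n. c t)" using Suc by simp
  then show ?case using Suc.prems[of n] by simp
qed simp

text \<open>For the terms caused by the jump of x, which enter the inner loops at the first step
  only.\<close>

lemma sum_if_zero:
  fixes a :: real and n :: nat
  assumes "0 < n"
  shows "(\<Sum>t<n. if t = 0 then a else 0) = a"
  using assms by (cases n) (simp_all add: sum.lessThan_Suc_shift)

text \<open>A purely real-valued setting. Here s and s' are the effective inner step sizes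
  \<lambda>1 \<beta> and \<lambda>2 \<eta>, w weights the estimator errors, and q = 2 w / S2 is the
  price of a unit of noise or movement in a momentum step; \<open>tau\<close> records what such a
  step gains.\<close>

locale lyapunov_weights =
  fixes \<mu> Lg M1 Cy Cv \<alpha> s s' lam1 lam2 Cb Ce w q \<tau>x \<tau>y \<tau>v C7 :: real and T J S2 :: nat
  assumes pos: "0 < \<mu>" "\<mu> \<le> Lg" "0 \<le> M1" "0 < \<alpha>" "0 < T" "0 < J" "0 < S2"
    and lam: "0 < lam1" "lam1 \<le> 1 / (2 * Lg + 2 * \<mu>)" "0 < lam2" "lam2 \<le> 1 / (2 * Lg + 2 * \<mu>)"
    and Cbe: "0 < Cb" "0 < Ce"
    and s: "s = lam1 * Cb * \<alpha>" and s': "s' = lam2 * Ce * \<alpha>"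
    and Ce_eq: "48 * (Lg\<^sup>2 + Cv\<^sup>2) = \<mu> * lam2 * Ce"
    and Cb1: "96 * Cy\<^sup>2 + 8 * M1 \<le> \<mu> * lam1 * Cb"
    and Cb2: "128 * M1 * real J * Ce * lam2 \<le> \<mu>\<^sup>2 * lam1 * Cb"
    and C7: "2^15 * (Lg\<^sup>2 * Ce + (M1 + Lg\<^sup>2) * (1 + real T * Cb)) \<le> C7"
    and w: "w = 8 * real S2 / (C7 * \<alpha>)"
    and q: "q = 16 / (C7 * \<alpha>)"
    and tau: "w * \<tau>x = 8 * \<alpha>" "w * \<tau>y = 8 * real T * s / \<mu>" "w * \<tau>v = 8 * real J * s' / \<mu>"
    and small: "s \<le> lam1"
begin

lemma Lg_pos: "0 < Lg" using pos by linarith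

lemma C7_pos: "0 < C7"
proof -
  have "0 < 2^15 * (Lg\<^sup>2 * Ce + (M1 + Lg\<^sup>2) * (1 + real T * Cb))"
    using Lg_pos pos Cbe by (intro mult_pos_pos add_pos_nonneg) auto
  then show ?thesis using C7 by linarith
qed

lemma C7_ge: "2^15 * (Lg\<^sup>2 * Ce) \<le> C7" "2^15 * ((M1 + Lg\<^sup>2) * (1 + real T * Cb)) \<le> C7"
  "2^15 * ((M1 + Lg\<^sup>2) * (real T * Cb)) \<le> C7" "2^15 * (M1 + Lg\<^sup>2) \<le> C7"
proof -
  have a: "0 \<le> Lg\<^sup>2 * Ce" "0 \<le> (M1 + Lg\<^sup>2) * (real T * Cb)" "0 \<le> M1 + Lg\<^sup>2"
    using pos Cbe by auto
  have e: "(M1 + Lg\<^sup>2) * (1 + real T * Cb) = (M1 + Lg\<^sup>2) + (M1 + Lg\<^sup>2) * (real T * Cb)"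
    by (simp add: algebra_simps)
  show "2^15 * (Lg\<^sup>2 * Ce) \<le> C7" using C7 a unfolding e by simp
  show "2^15 * ((M1 + Lg\<^sup>2) * (1 + real T * Cb)) \<le> C7" using C7 a unfolding e by simp
  show "2^15 * ((M1 + Lg\<^sup>2) * (real T * Cb)) \<le> C7" using C7 a unfolding e by simp
  show "2^15 * (M1 + Lg\<^sup>2) \<le> C7" using C7 a unfolding e by simp
qed

lemma s_pos: "0 < s" "0 < s'" using lam pos Cbe by (auto simp: s s')

lemma q_pos: "0 < q" "0 < w" using C7_pos pos by (auto simp: q w)

lemma w_q: "w * 2 / real S2 = q" using C7_pos pos by (simp add: w q field_simps)

definition "r = 1 / (Lg + \<mu>)"

lemma r: "0 < r" "lam1 \<le> r / 2" "lam2 \<le> r / 2" "r \<le> 1 / (2 * \<mu>)"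
proof -
  show "0 < r" using pos Lg_pos by (simp add: r_def)
  have "1 / (2 * Lg + 2 * \<mu>) = r / 2" unfolding r_def by (simp add: field_simps)
  then show "lam1 \<le> r / 2" "lam2 \<le> r / 2" using lam by auto
  show "r \<le> 1 / (2 * \<mu>)" unfolding r_def using pos by (intro divide_left_mono) auto
qed

text \<open>The cost of the movements of the iterates in the variances of the estimators is negligible:
  \<open>C7\<close> dominates all the constants that multiply it.\<close>

lemma qLs: "q * (Lg\<^sup>2 * (2 * s\<^sup>2)) + q * (2 * M1 * (real T * (2 * s\<^sup>2))) \<le> s * lam1 / 512"
proof -
  have "q * (Lg\<^sup>2 * (2 * s\<^sup>2)) + q * (2 * M1 * (real T * (2 * s\<^sup>2)))
      = (2 * Lg\<^sup>2 + 4 * M1 * real T) * (q * s * s)" by (simp add: algebra_simps power2_eq_square)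
  also have "\<dots> \<le> (4 * ((M1 + Lg\<^sup>2) * real T)) * (q * s * s)"
  proof (rule mult_right_mono)
    have "Lg\<^sup>2 * 1 \<le> Lg\<^sup>2 * real T" using pos by (intro mult_left_mono) auto
    moreover have "0 \<le> Lg\<^sup>2 * real T" by simp
    moreover have "4 * ((M1 + Lg\<^sup>2) * real T) = 4 * M1 * real T + 4 * (Lg\<^sup>2 * real T)"
      by (simp add: algebra_simps)
    ultimately show "2 * Lg\<^sup>2 + 4 * M1 * real T \<le> 4 * ((M1 + Lg\<^sup>2) * real T)" by linarith
  qed (use q_pos s_pos in auto)
  also have "\<dots> = 64 * ((M1 + Lg\<^sup>2) * (real T * Cb)) / C7 * (s * lam1)"
    using C7_pos pos by (simp add: q s field_simps)
  also have "\<dots> \<le> 1 / 512 * (s * lam1)"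
    using C7_ge(3) C7_pos s_pos lam by (intro mult_right_mono) (auto simp: field_simps)
  finally show ?thesis by simp
qed

lemma qLs': "q * (4 * Lg\<^sup>2 * (3 * s'\<^sup>2)) \<le> s' * lam2 / 128"
proof -
  have "q * (4 * Lg\<^sup>2 * (3 * s'\<^sup>2)) = 192 * (Lg\<^sup>2 * Ce) / C7 * (s' * lam2)"
    using C7_pos pos by (simp add: q s' field_simps power2_eq_square)
  also have "\<dots> \<le> 1 / 128 * (s' * lam2)"
    using C7_ge(1) C7_pos s_pos lam by (intro mult_right_mono) (auto simp: field_simps)
  finally show ?thesis by simp
qed

lemma qL\<alpha>: "q * ((Lg\<^sup>2 + 2 * M1) * \<alpha>\<^sup>2) \<le> \<alpha> / 512"
proof -
  have "q * ((Lg\<^sup>2 + 2 * M1) * \<alpha>\<^sup>2) = 16 * (Lg\<^sup>2 + 2 * M1) / C7 * \<alpha>"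
    using C7_pos pos by (simp add: q power2_eq_square)
  also have "\<dots> \<le> 1 / 512 * \<alpha>"
  proof (rule mult_right_mono)
    have "0 \<le> Lg\<^sup>2" "0 \<le> M1" using pos by auto
    moreover have "C7 \<ge> 32768 * M1 + 32768 * Lg\<^sup>2" using C7_ge(4) by simp
    ultimately have "8192 * Lg\<^sup>2 + 16384 * M1 \<le> C7" by linarith
    then show "16 * (Lg\<^sup>2 + 2 * M1) / C7 \<le> 1 / 512" using C7_pos by (simp add: pos_divide_le_eq)
  qed (use pos in simp)
  finally show ?thesis by simp
qed

text \<open>\<open>pc\<close> bounds the coefficient of the y-error in one step of the v-loop: 3 s'
  M1 / \<mu> from the perturbed gradient and at most s' M1 / \<mu> from the movement cost.
  \<open>pen\<close> accumulates it over J steps.\<close>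

definition "pc = 4 * s' * M1 / \<mu>"
definition "pen = real J * pc"

lemma pc_nonneg: "0 \<le> pc" using s_pos pos by (simp add: pc_def)

lemma pc_le_pen: "pc \<le> pen" unfolding pen_def using pc_nonneg pos by (simp add: mult_le_cancel_right1)

text \<open>This is the purpose of the second term in the maximum C_beta; its 128 is 4 from
  \<open>pc\<close> times 32.\<close>

lemma pen_le: "pen \<le> s * \<mu> / 32"
proof -
  have "32 * (real J * (4 * s' * M1)) \<le> s * \<mu> * \<mu>"
    using mult_left_mono[OF Cb2, of \<alpha>] pos by (simp add: s s' power2_eq_square algebra_simps)
  then show ?thesis using pos by (simp add: pen_def pc_def field_simps)
qed

lemma smu_le: "s * \<mu> \<le> 1 / 4"
proof -
  have "s * \<mu> \<le> (r / 2) * \<mu>" using small r pos by (intro mult_right_mono) auto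
  also have "\<dots> \<le> (1 / (2 * \<mu>) / 2) * \<mu>" using r pos by (intro mult_right_mono divide_right_mono) auto
  also have "\<dots> = 1 / 4" using pos by simp
  finally show ?thesis .
qed

lemma pen_small: "0 \<le> pen" "pen \<le> 1 / 128"
  using pen_le smu_le pc_nonneg by (auto simp: pen_def)

text \<open>Here \<open>\<phi>\<close> and \<open>\<phi>'\<close> stand for the expectations of \<open>\<Phi>\<close> before and after the iteration, \<open>\<Gamma>\<close>
  for that of \<open>|\<nabla>\<Phi>|\<^sup>2\<close>, \<open>\<Delta>\<close> for that of \<open>|D\<^sup>x|\<^sup>2\<close>, \<open>a t\<close> and \<open>b j\<close> for the squared distances of
  the inner iterates to \<open>y\<^sup>*\<close> and \<open>v\<^sup>*\<close>, \<open>h t\<close> and \<open>h' j\<close> for the squared exact inner gradients,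
  \<open>ex, ey, ev\<close> for the squared errors of the estimators, and \<open>Z\<close> for the squared movement of \<open>(x, y)\<close>.\<close>

lemma one_iteration:
  fixes a h ey b h' ev ex :: "nat \<Rightarrow> real" and \<phi> \<phi>' \<Gamma> \<Delta> Z vx vy vv :: real
  assumes nn: "\<And>t. 0 \<le> a t" "\<And>t. 0 \<le> h t" "\<And>t. 0 \<le> ey t" "\<And>t. 0 \<le> b t" "\<And>t. 0 \<le> h' t"
      "\<And>t. 0 \<le> ev t" "\<And>t. 0 \<le> ex t" "0 \<le> \<Delta>"
    and I1: "\<phi>' \<le> \<phi> - \<alpha> / 2 * \<Gamma> - 5 * \<alpha> / 12 * \<Delta> + \<alpha> / 2 * (2 * ex 0 + 2 * M1 * a 0 + 4 * Lg\<^sup>2 * b 0)"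
    and I2: "\<And>t. t < T \<Longrightarrow> a (Suc t) \<le> (if t = 0 then 1 - s * \<mu> / 4 else 1) * a t + 3 * s / \<mu> * ey t
        - s * r * h t + (if t = 0 then \<alpha> / 20 * \<Delta> else 0)"
    and I3: "\<And>t. t < T \<Longrightarrow> ey (Suc t) \<le> (1 - \<tau>y) * ey t + 2 / real S2 * (\<tau>y\<^sup>2 * vy
        + Lg\<^sup>2 * (2 * s\<^sup>2 * (h t + ey t) + (if t = 0 then \<alpha>\<^sup>2 * \<Delta> else 0)))"
    and I4: "Z \<le> \<alpha>\<^sup>2 * \<Delta> + real T * (\<Sum>t<T. 2 * s\<^sup>2 * (h t + ey t))"
    and I5: "\<And>j. j < J \<Longrightarrow> b (Suc j) \<le> (if j = 0 then 1 - s' * \<mu> / 4 else 1) * b j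
        + 3 * s' / \<mu> * (2 * ev j + M1 * (if j = 0 then a 0 else a T))
        - s' * r * h' j + (if j = 0 then \<alpha> / 11 * \<Delta> else 0)"
    and I6: "\<And>j. j < J \<Longrightarrow> ex (Suc j) \<le> (1 - \<tau>x) * ex j + 2 / real S2 * (\<tau>x\<^sup>2 * vx
        + (if j = 0 then M1 * Z else 0)
        + 2 * Lg\<^sup>2 * (3 * s'\<^sup>2 * (h' j + ev j + M1 / 2 * (if j = 0 then a 0 else a T))))"
    and I7: "\<And>j. j < J \<Longrightarrow> ev (Suc j) \<le> (1 - \<tau>v) * ev j + 2 / real S2 * (\<tau>v\<^sup>2 * vv
        + (if j = 0 then M1 * Z else 0)
        + 2 * Lg\<^sup>2 * (3 * s'\<^sup>2 * (h' j + ev j + M1 / 2 * (if j = 0 then a 0 else a T))))"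
  shows "\<phi>' + a T + b J + w * (ex J + ey T + ev J) + \<alpha> / 2 * \<Gamma>
    \<le> \<phi> + a 0 + b 0 + w * (ex 0 + ey 0 + ev 0)
      + q * (real J * (\<tau>x\<^sup>2 * vx) + real T * (\<tau>y\<^sup>2 * vy) + real J * (\<tau>v\<^sup>2 * vv))"
proof -
  have wS: "w * (2 / real S2 * x) = q * x" for x unfolding w_q[symmetric] by simp
  \<comment> \<open>The movement m t of y enters the first momentum step of both the x- and the
    v-estimator through Z, with the factor T. The y-loop sets this price aside as the term - Q m
    t.\<close>
  define Q where "Q = q * (2 * M1 * real T)"
  define m where "m t = 2 * s\<^sup>2 * (h t + ey t)" for t
  \<comment> \<open>The weight 1 + pen on a leaves the surplus \<open>pen * a T\<close> at the end
    of the loop, which will cover the y-error in the v-loop.\<close>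
  have Y: "(1 + pen) * a (Suc t) + w * ey (Suc t) \<le> ((1 + pen) * a t + w * ey t)
      + ((if t = 0 then - ((1 + pen) * (s * \<mu> / 4) * a 0) + (\<alpha> / 16 * \<Delta> + q * (Lg\<^sup>2 * \<alpha>\<^sup>2) * \<Delta>) else 0)
        + (q * (\<tau>y\<^sup>2 * vy) - Q * m t))" if t: "t < T" for t
  proof -
    have c1: "(1 + pen) * (3 * s / \<mu>) \<le> 4 * (s / \<mu>)"
    proof -
      have "(1 + pen) * (3 * s / \<mu>) \<le> (4 / 3) * (3 * s / \<mu>)"
        using pen_small s_pos pos by (intro mult_right_mono) auto
      then show ?thesis by simp
    qed
    have c2: "(1 + pen) * (\<alpha> / 20) \<le> \<alpha> / 16"
    proof -
      have "(1 + pen) * (\<alpha> / 20) \<le> (5 / 4) * (\<alpha> / 20)" using pen_small pos by (intro mult_right_mono) auto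
      then show ?thesis by simp
    qed
    have c3: "s * r \<le> (1 + pen) * (s * r)" using pen_small s_pos r by simp
    have c4: "s * lam1 / 512 \<le> s * r"
    proof -
      have "lam1 / 512 \<le> r" using r lam by simp
      from mult_left_mono[OF this, of s] show ?thesis using s_pos by simp
    qed
    have c5: "s * lam1 / 512 \<le> s / \<mu>"
    proof -
      have "lam1 / 512 \<le> 1 / (2 * \<mu>)" using r lam by linarith
      also have "\<dots> \<le> 1 / \<mu>" using pos by (simp add: field_simps)
      finally show ?thesis using mult_left_mono[of "lam1 / 512" "1 / \<mu>" s] s_pos by simp
    qed
    have c6: "8 * (s / \<mu>) \<le> w * \<tau>y"
      unfolding tau times_divide_eq_right using pos s_pos by (intro divide_right_mono mult_right_mono) auto
    have A: "(1 + pen) * a (Suc t) \<le> (1 + pen) * ((if t = 0 then 1 - s * \<mu> / 4 else 1) * a t + 3 * s / \<mu> * ey t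
        - s * r * h t + (if t = 0 then \<alpha> / 20 * \<Delta> else 0))"
      using I2[OF t] pen_small by (intro mult_left_mono) auto
    have B: "w * ey (Suc t) \<le> w * ((1 - \<tau>y) * ey t) + q * (\<tau>y\<^sup>2 * vy
        + Lg\<^sup>2 * (m t + (if t = 0 then \<alpha>\<^sup>2 * \<Delta> else 0)))"
      using mult_left_mono[OF I3[OF t], of w] q_pos unfolding m_def distrib_left[of w] wS by simp
    have mq: "(q * Lg\<^sup>2 + Q) * m t \<le> s * lam1 / 512 * (h t + ey t)"
    proof -
      have "(q * Lg\<^sup>2 + Q) * m t = (q * (Lg\<^sup>2 * (2 * s\<^sup>2)) + q * (2 * M1 * (real T * (2 * s\<^sup>2)))) * (h t + ey t)"
        unfolding Q_def m_def by (simp add: algebra_simps)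
      also have "\<dots> \<le> s * lam1 / 512 * (h t + ey t)"
        using nn by (intro mult_right_mono qLs) auto
      finally show ?thesis .
    qed
    have e1: "s * lam1 / 512 * h t \<le> (1 + pen) * (s * r) * h t"
      using c3 c4 nn(2)[of t] by (intro mult_right_mono) auto
    have e2: "(1 + pen) * (3 * s / \<mu>) * ey t + s * lam1 / 512 * ey t \<le> w * \<tau>y * ey t"
    proof -
      have "(1 + pen) * (3 * s / \<mu>) + s * lam1 / 512 \<le> w * \<tau>y"
        using c1 c5 c6 divide_pos_pos[OF s_pos(1) pos(1)] by linarith
      from mult_right_mono[OF this nn(3)[of t]] show ?thesis by (simp add: algebra_simps)
    qed
    have e3: "(1 + pen) * (\<alpha> / 20) * \<Delta> \<le> \<alpha> / 16 * \<Delta>" using c2 nn by (intro mult_right_mono) auto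
    have B': "w * ey (Suc t) \<le> w * ey t - w * \<tau>y * ey t + q * (\<tau>y\<^sup>2 * vy) + q * Lg\<^sup>2 * m t
        + (if t = 0 then q * (Lg\<^sup>2 * \<alpha>\<^sup>2) * \<Delta> else 0)"
      using B by (cases "t = 0") (simp_all add: algebra_simps)
    have mq': "q * Lg\<^sup>2 * m t + Q * m t \<le> s * lam1 / 512 * h t + s * lam1 / 512 * ey t"
      using mq by (simp only: distrib_right distrib_left)
    have A': "(1 + pen) * a (Suc t) \<le> (1 + pen) * a t - (if t = 0 then (1 + pen) * (s * \<mu> / 4) * a 0 else 0)
        + (1 + pen) * (3 * s / \<mu>) * ey t - (1 + pen) * (s * r) * h t
        + (if t = 0 then (1 + pen) * (\<alpha> / 20) * \<Delta> else 0)"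
    proof -
      have "(1 + pen) * ((if t = 0 then 1 - s * \<mu> / 4 else 1) * a t + 3 * s / \<mu> * ey t
        - s * r * h t + (if t = 0 then \<alpha> / 20 * \<Delta> else 0))
        = (1 + pen) * a t - (if t = 0 then (1 + pen) * (s * \<mu> / 4) * a 0 else 0)
        + (1 + pen) * (3 * s / \<mu>) * ey t - (1 + pen) * (s * r) * h t
        + (if t = 0 then (1 + pen) * (\<alpha> / 20) * \<Delta> else 0)"
        by (cases "t = 0") (simp_all add: algebra_simps)
      from A[unfolded this] show ?thesis .
    qed
    show ?thesis
    proof (cases "t = 0")
      case True
      \<comment> \<open>All products are abstracted into variables, which makes the combination
        linear.\<close>
      have comb: "L + L' \<le> (u + v) + ((- k + (d + x)) + (n - Qm))"
        if "L \<le> u - k + c - c2 + c3" "L' \<le> v - tv + n + qm + x" "qm + Qm \<le> hh + ee" "hh \<le> c2" "c + ee \<le> tv" "c3 \<le> d"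
        for L L' u v k d x n Qm c c2 c3 tv qm hh ee :: real using that by linarith
      show ?thesis unfolding if_P[OF True]
        by (rule comb[OF A'[unfolded if_P[OF True]] B'[unfolded if_P[OF True]] mq' e1 e2 e3])
    next
      case False
      have comb: "L + L' \<le> (u + v) + (0 + (n - Qm))"
        if "L \<le> u - 0 + c - c2 + 0" "L' \<le> v - tv + n + qm + 0" "qm + Qm \<le> hh + ee" "hh \<le> c2" "c + ee \<le> tv"
        for L L' u v n Qm c c2 tv qm hh ee :: real using that by linarith
      show ?thesis unfolding if_not_P[OF False]
        by (rule comb[OF A'[unfolded if_not_P[OF False]] B'[unfolded if_not_P[OF False]] mq' e1 e2])
    qed
  qed
  have "(1 + pen) * a T + w * ey T \<le> ((1 + pen) * a 0 + w * ey 0)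
      + (\<Sum>t<T. (if t = 0 then - ((1 + pen) * (s * \<mu> / 4) * a 0) + (\<alpha> / 16 * \<Delta> + q * (Lg\<^sup>2 * \<alpha>\<^sup>2) * \<Delta>) else 0)
        + (q * (\<tau>y\<^sup>2 * vy) - Q * m t))"
    by (rule telescope_le[of T "\<lambda>t. (1 + pen) * a t + w * ey t"]) (rule Y)
  then have RY: "(1 + pen) * a T + w * ey T + Q * (\<Sum>t<T. m t) \<le> (1 + pen) * (1 - s * \<mu> / 4) * a 0 + w * ey 0
      + (\<alpha> / 16 + q * (Lg\<^sup>2 * \<alpha>\<^sup>2)) * \<Delta> + real T * (q * (\<tau>y\<^sup>2 * vy))"
    unfolding sum.distrib sum_if_zero[OF pos(5)] by (simp add: sum_subtractf sum_distrib_left[symmetric] algebra_simps)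
  define p where "p j = (if j = 0 then a 0 else a T)" for j :: nat
  have p: "0 \<le> p j" for j using nn by (simp add: p_def)
  \<comment> \<open>Step 0 still sees the old point and pays \<open>pc * a 0\<close>; writing this
    as \<open>pc * a T\<close> plus a correction at j = 0 keeps the other summand independent of
    j.\<close>
  have V: "b (Suc j) + w * (ex (Suc j) + ev (Suc j)) \<le> (b j + w * (ex j + ev j))
      + ((if j = 0 then - (s' * \<mu> / 4 * b 0) - 8 * \<alpha> * ex 0 + \<alpha> / 11 * \<Delta> + q * (2 * M1 * Z) + pc * a 0 - pc * a T else 0)
        + (pc * a T + (q * (\<tau>x\<^sup>2 * vx) + q * (\<tau>v\<^sup>2 * vv))))" if j: "j < J" for j
  proof -
    have c1: "s' * lam2 / 128 \<le> s' * r"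
    proof -
      have "lam2 / 128 \<le> r" using r lam by simp
      from mult_left_mono[OF this, of s'] show ?thesis using s_pos by simp
    qed
    have c2: "s' * lam2 / 128 \<le> s' / \<mu>"
    proof -
      have "lam2 / 128 \<le> 1 / (2 * \<mu>)" using r lam by linarith
      also have "\<dots> \<le> 1 / \<mu>" using pos by (simp add: field_simps)
      finally show ?thesis using mult_left_mono[of "lam2 / 128" "1 / \<mu>" s'] s_pos by simp
    qed
    have c3: "8 * (s' / \<mu>) \<le> w * \<tau>v"
      unfolding tau times_divide_eq_right using pos s_pos by (intro divide_right_mono mult_right_mono) auto
    define n where "n = 3 * s'\<^sup>2 * (h' j + ev j + M1 / 2 * p j)"
    have qn: "q * (4 * Lg\<^sup>2) * n \<le> s' * lam2 / 128 * (h' j + ev j + M1 / 2 * p j)"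
    proof -
      have "q * (4 * Lg\<^sup>2) * n = q * (4 * Lg\<^sup>2 * (3 * s'\<^sup>2)) * (h' j + ev j + M1 / 2 * p j)"
        unfolding n_def by (simp add: algebra_simps)
      also have "\<dots> \<le> s' * lam2 / 128 * (h' j + ev j + M1 / 2 * p j)"
        using nn p pos by (intro mult_right_mono qLs') auto
      finally show ?thesis .
    qed
    have X: "w * ex (Suc j) \<le> w * ((1 - \<tau>x) * ex j) + q * (\<tau>x\<^sup>2 * vx + (if j = 0 then M1 * Z else 0) + 2 * Lg\<^sup>2 * n)"
      using mult_left_mono[OF I6[OF j], of w] q_pos unfolding n_def p_def distrib_left[of w] wS by simp
    have E: "w * ev (Suc j) \<le> w * ((1 - \<tau>v) * ev j) + q * (\<tau>v\<^sup>2 * vv + (if j = 0 then M1 * Z else 0) + 2 * Lg\<^sup>2 * n)"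
      using mult_left_mono[OF I7[OF j], of w] q_pos unfolding n_def p_def distrib_left[of w] wS by simp
    have B: "b (Suc j) \<le> (if j = 0 then 1 - s' * \<mu> / 4 else 1) * b j + 3 * s' / \<mu> * (2 * ev j + M1 * p j)
        - s' * r * h' j + (if j = 0 then \<alpha> / 11 * \<Delta> else 0)"
      using I5[OF j] unfolding p_def .
    have e1: "s' * lam2 / 128 * h' j \<le> s' * r * h' j" using c1 nn by (intro mult_right_mono) auto
    have e2: "3 * s' / \<mu> * (2 * ev j) + s' * lam2 / 128 * ev j \<le> w * \<tau>v * ev j"
    proof -
      have "6 * (s' / \<mu>) + s' * lam2 / 128 \<le> w * \<tau>v" using c2 c3 divide_pos_pos[OF s_pos(2) pos(1)] by linarith
      from mult_right_mono[OF this nn(6)[of j]] show ?thesis by (simp add: algebra_simps)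
    qed
    have e3: "3 * s' / \<mu> * (M1 * p j) + s' * lam2 / 128 * (M1 / 2 * p j) \<le> pc * p j"
    proof -
      have "s' * lam2 / 128 * (M1 / 2 * p j) \<le> s' / \<mu> * (M1 / 2 * p j)"
        using c2 p pos by (intro mult_right_mono) auto
      also have "\<dots> \<le> s' / \<mu> * (M1 * p j)"
        using p[of j] pos s_pos by (intro mult_left_mono mult_right_mono) auto
      finally have "s' * lam2 / 128 * (M1 / 2 * p j) \<le> s' / \<mu> * (M1 * p j)" .
      then have "3 * s' / \<mu> * (M1 * p j) + s' * lam2 / 128 * (M1 / 2 * p j)
          \<le> 3 * s' / \<mu> * (M1 * p j) + s' / \<mu> * (M1 * p j)" by (rule add_left_mono)
      also have "\<dots> = pc * p j" by (simp add: pc_def)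
      finally show ?thesis .
    qed
    have e4: "0 \<le> w * \<tau>x * ex j" unfolding tau using pos nn by simp
    have X': "w * ex (Suc j) \<le> w * ex j - w * \<tau>x * ex j + q * (\<tau>x\<^sup>2 * vx) + (if j = 0 then q * (M1 * Z) else 0) + q * (2 * Lg\<^sup>2) * n"
      and E': "w * ev (Suc j) \<le> w * ev j - w * \<tau>v * ev j + q * (\<tau>v\<^sup>2 * vv) + (if j = 0 then q * (M1 * Z) else 0) + q * (2 * Lg\<^sup>2) * n"
      using X E by (cases "j = 0"; simp add: algebra_simps)+
    have qn': "2 * (q * (2 * Lg\<^sup>2) * n) \<le> s' * lam2 / 128 * h' j + s' * lam2 / 128 * ev j + s' * lam2 / 128 * (M1 / 2 * p j)"
      using qn by (simp add: distrib_left distrib_right)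
    have B': "b (Suc j) \<le> b j - (if j = 0 then s' * \<mu> / 4 * b 0 else 0) + 3 * s' / \<mu> * (2 * ev j) + 3 * s' / \<mu> * (M1 * p j)
        - s' * r * h' j + (if j = 0 then \<alpha> / 11 * \<Delta> else 0)"
      using B by (cases "j = 0") (simp_all add: algebra_simps)
    have pj: "pc * p j = (if j = 0 then pc * a 0 else pc * a T)" by (simp add: p_def)
    \<comment> \<open>The gain of the x-estimator is collected at j = 0, where it offsets the error
      \<open>ex 0\<close> in the descent of \<phi>; later gains are bounded below by 0.\<close>
    have ej: "w * \<tau>x * ex j \<ge> (if j = 0 then 8 * \<alpha> * ex 0 else 0)" using e4 tau by simp
    have dM: "q * (2 * M1 * Z) = 2 * (q * (M1 * Z))" by simp
    have split: "w * (x + y) = w * x + w * y" for x y by (simp add: distrib_left)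
    show ?thesis
    proof (cases "j = 0")
      case True
      have comb: "B' + (X' + E') \<le> (B + (X + E)) + ((- sb - x8 + d + 2 * z + p0 - pT) + (pT + (nx + nv)))"
        if "X' \<le> X - tx + nx + z + qn" "E' \<le> E - tv + nv + z + qn" "B' \<le> B - sb + c + c' - hr + d"
          "2 * qn \<le> hh + ee + pp" "hh \<le> hr" "c + ee \<le> tv" "c' + pp \<le> pj" "pj = p0" "x8 \<le> tx"
        for B' X' E' B X E sb x8 d z p0 pT nx nv tx qn tv c c' hr hh ee pp pj :: real
        using that by linarith
      show ?thesis unfolding dM split if_P[OF True]
        by (rule comb[OF X'[unfolded if_P[OF True]] E'[unfolded if_P[OF True]] B'[unfolded if_P[OF True]] qn' e1 e2 e3 pj[unfolded if_P[OF True]] ej[unfolded if_P[OF True]]])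
    next
      case False
      have comb: "B' + (X' + E') \<le> (B + (X + E)) + (0 + (pT + (nx + nv)))"
        if "X' \<le> X - tx + nx + 0 + qn" "E' \<le> E - tv + nv + 0 + qn" "B' \<le> B - 0 + c + c' - hr + 0"
          "2 * qn \<le> hh + ee + pp" "hh \<le> hr" "c + ee \<le> tv" "c' + pp \<le> pj" "pj = pT" "0 \<le> tx"
        for B' X' E' B X E pT nx nv tx qn tv c c' hr hh ee pp pj :: real
        using that by linarith
      show ?thesis unfolding dM split if_not_P[OF False]
        by (rule comb[OF X'[unfolded if_not_P[OF False]] E'[unfolded if_not_P[OF False]] B'[unfolded if_not_P[OF False]] qn' e1 e2 e3 pj[unfolded if_not_P[OF False]] ej[unfolded if_not_P[OF False]]])
    qed
  qed
  have "b J + w * (ex J + ev J) \<le> (b 0 + w * (ex 0 + ev 0))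
      + (\<Sum>j<J. (if j = 0 then - (s' * \<mu> / 4 * b 0) - 8 * \<alpha> * ex 0 + \<alpha> / 11 * \<Delta> + q * (2 * M1 * Z) + pc * a 0 - pc * a T else 0)
        + (pc * a T + (q * (\<tau>x\<^sup>2 * vx) + q * (\<tau>v\<^sup>2 * vv))))"
    by (rule telescope_le[of J "\<lambda>j. b j + w * (ex j + ev j)"]) (rule V)
  then have RV: "b J + w * (ex J + ev J) \<le> b 0 + w * (ex 0 + ev 0)
      - s' * \<mu> / 4 * b 0 - 8 * \<alpha> * ex 0 + \<alpha> / 11 * \<Delta> + q * (2 * M1 * Z) + pc * a 0 - pc * a T
      + real J * (pc * a T) + real J * (q * (\<tau>x\<^sup>2 * vx)) + real J * (q * (\<tau>v\<^sup>2 * vv))"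
    unfolding sum.distrib sum_if_zero[OF pos(6)] by (simp add: algebra_simps)
  \<comment> \<open>The reserve Q of the y-loop is spent here; only the jump of x is left.\<close>
  have RZ: "q * (2 * M1 * Z) \<le> q * (2 * M1 * \<alpha>\<^sup>2) * \<Delta> + Q * (\<Sum>t<T. m t)"
  proof -
    have "q * (2 * M1 * Z) \<le> q * (2 * M1 * (\<alpha>\<^sup>2 * \<Delta> + real T * (\<Sum>t<T. m t)))"
      using I4 q_pos pos unfolding m_def by (intro mult_left_mono) auto
    then show ?thesis unfolding Q_def by (simp add: algebra_simps)
  qed
  \<comment> \<open>Budget of \<open>a 0\<close>: the contraction s \<mu> / 4 covers pen and pc,
    each at most s \<mu> / 32, and \<alpha> M1 \<le> s \<mu> / 8, which comes from the first term of
    C_beta.\<close>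
  have ra: "(1 + pen) * (1 - s * \<mu> / 4) * a 0 + pc * a 0 + \<alpha> * M1 * a 0 \<le> a 0"
  proof -
    have "\<alpha> * (8 * M1) \<le> \<alpha> * (\<mu> * lam1 * Cb)" using Cb1 pos zero_le_power2[of Cy] by (intro mult_left_mono) linarith+
    then have "\<alpha> * M1 \<le> s * \<mu> / 8" by (simp add: s algebra_simps)
    moreover have "pc \<le> s * \<mu> / 32" using pc_le_pen pen_le by simp
    moreover have "0 \<le> pen * (s * \<mu> / 4)" using pen_small s_pos pos by simp
    moreover have "(1 + pen) * (1 - s * \<mu> / 4) = 1 + pen - s * \<mu> / 4 - pen * (s * \<mu> / 4)"
      by (simp add: algebra_simps)
    moreover have "0 \<le> s * \<mu>" using s_pos pos by simp
    ultimately have "(1 + pen) * (1 - s * \<mu> / 4) + pc + \<alpha> * M1 \<le> 1"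
      using pen_le by linarith
    from mult_right_mono[OF this nn(1)[of 0]] show ?thesis by (simp add: algebra_simps)
  qed
  \<comment> \<open>The constant 48 in C_eta makes s' \<mu> equal to 48 \<alpha> (Lg^2 + Cv^2), so a
    quarter of it covers 2 \<alpha> Lg^2.\<close>
  have rb: "\<alpha> * (2 * Lg\<^sup>2) * b 0 \<le> s' * \<mu> / 4 * b 0"
  proof (rule mult_right_mono)
    have "\<alpha> * (48 * (Lg\<^sup>2 + Cv\<^sup>2)) = s' * \<mu>" using Ce_eq by (simp add: s' algebra_simps)
    moreover have "0 \<le> \<alpha> * Lg\<^sup>2" "0 \<le> \<alpha> * Cv\<^sup>2" using pos by auto
    ultimately show "\<alpha> * (2 * Lg\<^sup>2) \<le> s' * \<mu> / 4" by (simp add: algebra_simps)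
  qed (rule nn)
  \<comment> \<open>Budget of \<Delta>: 1/16 + 1/11 + 1/512 is below the 5/12 released by the
    descent of \<phi>.\<close>
  have rd: "(\<alpha> / 16 + q * (Lg\<^sup>2 * \<alpha>\<^sup>2)) * \<Delta> + \<alpha> / 11 * \<Delta> + q * (2 * M1 * \<alpha>\<^sup>2) * \<Delta> \<le> 5 * \<alpha> / 12 * \<Delta>"
  proof -
    have "(\<alpha> / 16 + q * (Lg\<^sup>2 * \<alpha>\<^sup>2)) + \<alpha> / 11 + q * (2 * M1 * \<alpha>\<^sup>2) \<le> 5 * \<alpha> / 12"
      using qL\<alpha> pos by (simp add: algebra_simps)
    from mult_right_mono[OF this nn(8)] show ?thesis by (simp add: algebra_simps)
  qed
  have rx: "\<alpha> * ex 0 \<le> 8 * \<alpha> * ex 0" using pos nn by simp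
  have rp: "real J * (pc * a T) = pen * a T" "0 \<le> pc * a T" using pc_nonneg nn by (auto simp: pen_def)
  have I1': "\<phi>' \<le> \<phi> - \<alpha> / 2 * \<Gamma> - 5 * \<alpha> / 12 * \<Delta> + (\<alpha> * ex 0 + \<alpha> * M1 * a 0 + \<alpha> * (2 * Lg\<^sup>2) * b 0)"
    using I1 by (simp add: algebra_simps)
  have RY': "a T + pen * a T + w * ey T + Q * (\<Sum>t<T. m t) \<le> (1 + pen) * (1 - s * \<mu> / 4) * a 0 + w * ey 0
      + (\<alpha> / 16 + q * (Lg\<^sup>2 * \<alpha>\<^sup>2)) * \<Delta> + real T * (q * (\<tau>y\<^sup>2 * vy))"
    using RY by (simp only: distrib_right mult_1_left)
  have noise: "q * (real J * (\<tau>x\<^sup>2 * vx) + real T * (\<tau>y\<^sup>2 * vy) + real J * (\<tau>v\<^sup>2 * vv))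
     = real J * (q * (\<tau>x\<^sup>2 * vx)) + real T * (q * (\<tau>y\<^sup>2 * vy)) + real J * (q * (\<tau>v\<^sup>2 * vv))"
    by (simp add: algebra_simps)
  have split: "w * (x + y + z) = w * (x + z) + w * y" for x y z by (simp add: algebra_simps)
  have comb: "p' + aT + bJ + (V1 + eT) + g \<le> p + a0 + b0 + (V0 + e0) + (nx + ny + nv)"
    if "p' \<le> p - g - d + (x + ma + lb)" "aT + paT + eT + S \<le> y0 + e0 + dy + ny"
      "bJ + V1 \<le> b0 + V0 - sb - x8 + dv + z + pa0 - pT + JpT + nx + nv" "z \<le> dz + S"
      "y0 + pa0 + ma \<le> a0" "lb \<le> sb" "dy + dv + dz \<le> d" "x \<le> x8" "JpT = paT" "0 \<le> pT"
    for p' aT bJ V1 eT g p a0 b0 V0 e0 nx ny nv d x ma lb paT S y0 dy sb x8 dv z pa0 pT JpT dz :: real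
  proof -
    have 1: "p' + g \<le> p - d + x8 + ma + sb" using that(1,6,8) by linarith
    have 2: "bJ + V1 \<le> b0 + V0 - sb - x8 + dv + dz + S + pa0 + paT + nx + nv" using that(3,4,9,10) by linarith
    have 3: "aT + paT + eT + S \<le> a0 - pa0 - ma + e0 + dy + ny" using that(2,5) by linarith
    have 4: "aT + eT + bJ + V1 \<le> a0 - ma + e0 + ny + b0 + V0 - sb - x8 + nx + nv + (dy + dv + dz)"
      using 2 3 by linarith
    show ?thesis using 1 4 that(7) by linarith
  qed
  show ?thesis unfolding noise split by (rule comb[OF I1' RY' RV RZ ra rb rd rx rp])
qed

end

section \<open>The algorithm as a random process\<close>

context smooth_pair
begin

text \<open>The matrix multiplies an unbounded v, so the Lipschitz estimate is used locally, with
  the norm of the limit point as radius.\<close>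

lemma dir_x_continuous: "continuous_on UNIV (\<lambda>u. dir_x f g (fst u) (snd u))"
proof (rule continuous_at_imp_continuous_on, rule ballI)
  fix u0 :: "((real^'p) \<times> (real^'q)) \<times> (real^'q)"
  let ?b = "\<lambda>u. (Lf + norm (snd u0) * Lgxy) * norm (fst u - fst u0) + Lg * norm (snd u - snd u0)"
  have "(?b \<longlongrightarrow> ?b u0) (at u0)" by (intro tendsto_intros)
  then have b: "(?b \<longlongrightarrow> 0) (at u0)" by simp
  have le: "norm (dir_x f g (fst u) (snd u) - dir_x f g (fst u0) (snd u0)) \<le> ?b u" for u
    by (rule dir_x_lip[OF order_refl])
  have "((\<lambda>u. dir_x f g (fst u) (snd u) - dir_x f g (fst u0) (snd u0)) \<longlongrightarrow> 0) (at u0)"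
    by (rule Lim_null_comparison[OF always_eventually b]) (rule allI, rule le)
  then show "isCont (\<lambda>u. dir_x f g (fst u) (snd u)) u0"
    unfolding isCont_def by (rule LIM_zero_cancel)
qed

lemma dir_v_continuous: "continuous_on UNIV (\<lambda>u. dir_v f g (fst u) (snd u))"
proof (rule continuous_at_imp_continuous_on, rule ballI)
  fix u0 :: "((real^'p) \<times> (real^'q)) \<times> (real^'q)"
  let ?b = "\<lambda>u. (Lf + norm (snd u0) * Lgyy) * norm (fst u - fst u0) + Lg * norm (snd u - snd u0)"
  have "(?b \<longlongrightarrow> ?b u0) (at u0)" by (intro tendsto_intros)
  then have b: "(?b \<longlongrightarrow> 0) (at u0)" by simp
  have le: "norm (dir_v f g (fst u) (snd u) - dir_v f g (fst u0) (snd u0)) \<le> ?b u" for u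
    by (rule dir_v_lip[OF order_refl])
  have "((\<lambda>u. dir_v f g (fst u) (snd u) - dir_v f g (fst u0) (snd u0)) \<longlongrightarrow> 0) (at u0)"
    by (rule Lim_null_comparison[OF always_eventually b]) (rule allI, rule le)
  then show "isCont (\<lambda>u. dir_v f g (fst u) (snd u)) u0"
    unfolding isCont_def by (rule LIM_zero_cancel)
qed

lemma dir_y_lip: "norm (dir_y g z - dir_y g z') \<le> Lg * norm (z - z')"
  unfolding dir_y_def by (rule grad_y_g_lip)

lemma dir_y_continuous: "continuous_on UNIV (dir_y g)"
proof (rule lipschitz_on_continuous_on, rule lipschitz_onI)
  show "dist (dir_y g z) (dir_y g z') \<le> Lg * dist z z'" for z z' unfolding dist_norm by (rule dir_y_lip)
qed (rule const_nonneg)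

lemma LPhi_nonneg: "0 \<le> LPhi"
  unfolding LPhi_def using const_nonneg Lgg_nonneg mu by (intro add_nonneg_nonneg divide_nonneg_pos) auto

lemma hypergrad_continuous: "continuous_on UNIV hypergrad"
proof (rule lipschitz_on_continuous_on, rule lipschitz_onI)
  show "dist (hypergrad x) (hypergrad x') \<le> LPhi * dist x x'" for x x'
    unfolding dist_norm by (rule hypergrad_lip)
qed (rule LPhi_nonneg)

end

section \<open>Expectations under the joint law of \<xi> and \<zeta>\<close>

lemma integral_pair_fst:
  fixes h :: "'a \<Rightarrow> 'e::{banach,second_countable_topology}"
  assumes "prob_space M" "prob_space N" "integrable M h"
  shows "integrable (M \<Otimes>\<^sub>M N) (\<lambda>c. h (fst c))" "(\<integral>c. h (fst c) \<partial>(M \<Otimes>\<^sub>M N)) = (\<integral>x. h x \<partial>M)"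
proof -
  have d: "distr (M \<Otimes>\<^sub>M N) M fst = M" using assms(2) by (rule prob_space.distr_pair_fst)
  have "integrable (distr (M \<Otimes>\<^sub>M N) M fst) h" using assms(3) by (simp add: d)
  then show "integrable (M \<Otimes>\<^sub>M N) (\<lambda>c. h (fst c))" by (rule integrable_distr[OF measurable_fst])
  show "(\<integral>c. h (fst c) \<partial>(M \<Otimes>\<^sub>M N)) = (\<integral>x. h x \<partial>M)"
    using integral_distr[OF measurable_fst, of h M N] assms(3) by (simp add: d)
qed

lemma distr_pair_snd:
  fixes M :: "'a measure" and N :: "'b measure"
  assumes M: "prob_space M" and N: "prob_space N"
  shows "distr (M \<Otimes>\<^sub>M N) N snd = N"
proof -
  interpret M: prob_space M by (rule M)
  interpret N: prob_space N by (rule N)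
  show ?thesis
  proof (rule measure_eqI)
    fix A assume "A \<in> sets (distr (M \<Otimes>\<^sub>M N) N snd)"
    then have A: "A \<in> sets N" by simp
    have "snd -` A \<inter> space (M \<Otimes>\<^sub>M N) = space M \<times> A"
      using sets.sets_into_space[OF A] by (auto simp: space_pair_measure)
    then have "emeasure (distr (M \<Otimes>\<^sub>M N) N snd) A = emeasure (M \<Otimes>\<^sub>M N) (space M \<times> A)"
      using A by (simp add: emeasure_distr)
    also have "\<dots> = emeasure N A"
      using A by (simp add: N.emeasure_pair_measure_Times M.emeasure_space_1)
    finally show "emeasure (distr (M \<Otimes>\<^sub>M N) N snd) A = emeasure N A" .
  qed simp
qed

lemma integral_pair_snd:
  fixes h :: "'b \<Rightarrow> 'e::{banach,second_countable_topology}"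
  assumes "prob_space M" "prob_space N" "integrable N h"
  shows "integrable (M \<Otimes>\<^sub>M N) (\<lambda>c. h (snd c))" "(\<integral>c. h (snd c) \<partial>(M \<Otimes>\<^sub>M N)) = (\<integral>x. h x \<partial>N)"
proof -
  have d: "distr (M \<Otimes>\<^sub>M N) N snd = N" using assms(1,2) by (rule distr_pair_snd)
  have "integrable (distr (M \<Otimes>\<^sub>M N) N snd) h" using assms(3) by (simp add: d)
  then show "integrable (M \<Otimes>\<^sub>M N) (\<lambda>c. h (snd c))" by (rule integrable_distr[OF measurable_snd])
  show "(\<integral>c. h (snd c) \<partial>(M \<Otimes>\<^sub>M N)) = (\<integral>x. h x \<partial>N)"
    using integral_distr[of snd "M \<Otimes>\<^sub>M N" N h] assms(3) by (simp add: d)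
qed

lemma integrable_matrix_vector:
  fixes A :: "'s \<Rightarrow> real^'n^'m"
  assumes "integrable N A"
  shows "integrable N (\<lambda>x. A x *v v)" "(\<integral>x. A x *v v \<partial>N) = (\<integral>x. A x \<partial>N) *v v"
proof -
  have "linear (\<lambda>A :: real^'n^'m. A *v v)"
    by (rule linearI) (simp_all add: matrix_vector_mult_add_rdistrib scaleR_matrix_vector_assoc)
  then have b: "bounded_linear (\<lambda>A :: real^'n^'m. A *v v)" by (simp add: linear_conv_bounded_linear)
  show "integrable N (\<lambda>x. A x *v v)" by (rule integrable_bounded_linear[OF b assms])
  show "(\<integral>x. A x *v v \<partial>N) = (\<integral>x. A x \<partial>N) *v v" by (rule integral_bounded_linear[OF b assms])
qed

lemma unbiased_pair_fst:
  assumes "prob_space M" "prob_space N" and u: "unbiased_estimate nrm M H h \<sigma>"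
  shows "integrable (M \<Otimes>\<^sub>M N) (\<lambda>c. H (fst c))" "(\<integral>c. H (fst c) \<partial>(M \<Otimes>\<^sub>M N)) = h"
    "integrable (M \<Otimes>\<^sub>M N) (\<lambda>c. (nrm (H (fst c) - h))\<^sup>2)"
    "(\<integral>c. (nrm (H (fst c) - h))\<^sup>2 \<partial>(M \<Otimes>\<^sub>M N)) \<le> \<sigma>\<^sup>2"
proof -
  have i: "integrable M H" "integrable M (\<lambda>s. (nrm (H s - h))\<^sup>2)" "(\<integral>s. H s \<partial>M) = h"
    "(\<integral>s. (nrm (H s - h))\<^sup>2 \<partial>M) \<le> \<sigma>\<^sup>2"
    using u unfolding unbiased_estimate_def by auto
  show "integrable (M \<Otimes>\<^sub>M N) (\<lambda>c. H (fst c))" "(\<integral>c. H (fst c) \<partial>(M \<Otimes>\<^sub>M N)) = h"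
    "integrable (M \<Otimes>\<^sub>M N) (\<lambda>c. (nrm (H (fst c) - h))\<^sup>2)"
    "(\<integral>c. (nrm (H (fst c) - h))\<^sup>2 \<partial>(M \<Otimes>\<^sub>M N)) \<le> \<sigma>\<^sup>2"
    using integral_pair_fst[OF assms(1,2) i(1)] integral_pair_fst[OF assms(1,2) i(2)] i(3,4) by simp_all
qed

lemma unbiased_pair_snd:
  assumes "prob_space M" "prob_space N" and u: "unbiased_estimate nrm N H h \<sigma>"
  shows "integrable (M \<Otimes>\<^sub>M N) (\<lambda>c. H (snd c))" "(\<integral>c. H (snd c) \<partial>(M \<Otimes>\<^sub>M N)) = h"
    "integrable (M \<Otimes>\<^sub>M N) (\<lambda>c. (nrm (H (snd c) - h))\<^sup>2)"
    "(\<integral>c. (nrm (H (snd c) - h))\<^sup>2 \<partial>(M \<Otimes>\<^sub>M N)) \<le> \<sigma>\<^sup>2"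
proof -
  have i: "integrable N H" "integrable N (\<lambda>s. (nrm (H s - h))\<^sup>2)" "(\<integral>s. H s \<partial>N) = h"
    "(\<integral>s. (nrm (H s - h))\<^sup>2 \<partial>N) \<le> \<sigma>\<^sup>2"
    using u unfolding unbiased_estimate_def by auto
  show "integrable (M \<Otimes>\<^sub>M N) (\<lambda>c. H (snd c))" "(\<integral>c. H (snd c) \<partial>(M \<Otimes>\<^sub>M N)) = h"
    "integrable (M \<Otimes>\<^sub>M N) (\<lambda>c. (nrm (H (snd c) - h))\<^sup>2)"
    "(\<integral>c. (nrm (H (snd c) - h))\<^sup>2 \<partial>(M \<Otimes>\<^sub>M N)) \<le> \<sigma>\<^sup>2"
    using integral_pair_snd[OF assms(1,2) i(1)] integral_pair_snd[OF assms(1,2) i(2)] i(3,4) by simp_all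
qed

section \<open>Recursions of the inner loops in terms of projections\<close>

lemma y_loop_Suc:
  "fst (y_loop G par s k xk xk1 y d (Suc t))
    = fst (y_loop G par s k xk xk1 y d t) - (rate_y par * step_y par) *\<^sub>R snd (y_loop G par s k xk xk1 y d t)"
  "snd (y_loop G par s k xk xk1 y d (Suc t))
    = batch_y G (batch_inner par) (s (Inner_y k t)) (xk1, fst (y_loop G par s k xk xk1 y d (Suc t)))
      + (1 - mom_y par) *\<^sub>R (snd (y_loop G par s k xk xk1 y d t)
          - batch_y G (batch_inner par) (s (Inner_y k t)) (if t = 0 then xk else xk1, fst (y_loop G par s k xk xk1 y d t)))"
  by (simp_all add: Let_def case_prod_beta')

lemma v_loop_Suc:
  "fst (v_loop F G par s k zk zk1 v dx dv (Suc j))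
    = closest_point (cball 0 (radius par)) (fst (v_loop F G par s k zk zk1 v dx dv j)
        - (rate_v par * step_v par) *\<^sub>R snd (snd (v_loop F G par s k zk zk1 v dx dv j)))"
  "fst (snd (v_loop F G par s k zk zk1 v dx dv (Suc j)))
    = batch_x F G (batch_inner par) (s (Inner_x k j)) zk1 (fst (v_loop F G par s k zk zk1 v dx dv (Suc j)))
      + (1 - mom_x par) *\<^sub>R (fst (snd (v_loop F G par s k zk zk1 v dx dv j))
          - batch_x F G (batch_inner par) (s (Inner_x k j)) (if j = 0 then zk else zk1) (fst (v_loop F G par s k zk zk1 v dx dv j)))"
  "snd (snd (v_loop F G par s k zk zk1 v dx dv (Suc j)))
    = batch_v F G (batch_inner par) (s (Inner_v k j)) zk1 (fst (v_loop F G par s k zk zk1 v dx dv (Suc j)))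
      + (1 - mom_v par) *\<^sub>R (snd (snd (v_loop F G par s k zk zk1 v dx dv j))
          - batch_v F G (batch_inner par) (s (Inner_v k j)) (if j = 0 then zk else zk1) (fst (v_loop F G par s k zk zk1 v dx dv j)))"
  by (simp_all add: Let_def case_prod_beta')

text \<open>The radius M of the ball is called R here; its lower bound Cf / \<mu> puts
  \<open>vstar\<close> inside the ball.\<close>

locale als_base = smooth_pair f g Cf Lf Lg Lgxy Lgyy \<mu>
  for f g :: "(real^'p) \<times> (real^'q) \<Rightarrow> real" and Cf Lf Lg Lgxy Lgyy \<mu> +
  fixes Mxi :: "'a measure" and Mzeta :: "'b measure"
    and F :: "'a \<Rightarrow> (real^'p) \<times> (real^'q) \<Rightarrow> real"
    and G :: "'b \<Rightarrow> (real^'p) \<times> (real^'q) \<Rightarrow> real"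
    and \<sigma>f \<sigma>g \<sigma>gxy \<sigma>gyy R :: real
  assumes prob: "prob_space Mxi" "prob_space Mzeta"
    and samples: "\<And>\<xi> \<zeta>. \<xi> \<in> space Mxi \<Longrightarrow> \<zeta> \<in> space Mzeta \<Longrightarrow> smooth_pair (F \<xi>) (G \<zeta>) Cf Lf Lg Lgxy Lgyy \<mu>"
    and oracles: "stochastic_oracles Mxi Mzeta F G f g \<sigma>f \<sigma>g \<sigma>gxy \<sigma>gyy"
    and radius: "Cf / \<mu> \<le> R"
begin

lemma R_nonneg: "0 \<le> R" using radius const_nonneg(1) mu by (meson divide_nonneg_pos order_trans)

abbreviation "MM \<equiv> Mxi \<Otimes>\<^sub>M Mzeta"

sublocale sampling MM
  by (simp add: sampling_def prob_space_pair prob)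

abbreviation Om :: "(sample_set \<times> nat \<Rightarrow> 'a \<times> 'b) measure" where "Om \<equiv> \<Omega>"

sublocale O: prob_space Om by (rule prob_\<Omega>)

lemma space_MM: "c \<in> space MM \<Longrightarrow> smooth_pair (F (fst c)) (G (snd c)) Cf Lf Lg Lgxy Lgyy \<mu>"
  by (rule samples) (auto simp: space_pair_measure)

definition "SX c u = dir_x (F (fst c)) (G (snd c)) (fst u) (snd u)"
definition "SV c u = dir_v (F (fst c)) (G (snd c)) (fst u) (snd u)"
definition "SY c z = dir_y (G (snd c)) z"
definition "mX u = dir_x f g (fst u) (snd u)"
definition "mV u = dir_v f g (fst u) (snd u)"
definition "mY z = dir_y g z"

text \<open>For |v| \<le> R the error splits into a gradient part and R times a matrix part, and
  squaring the sum costs the factor 2.\<close>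

definition "var_x = 2 * \<sigma>f\<^sup>2 + 2 * (R\<^sup>2 * \<sigma>gxy\<^sup>2)"
definition "var_v = 2 * \<sigma>f\<^sup>2 + 2 * (R\<^sup>2 * \<sigma>gyy\<^sup>2)"

section \<open>Mean and variance of the sampled directions\<close>

lemma oracle_gradient_F:
  "integrable MM (\<lambda>c. gradient (F (fst c)) z)" "(\<integral>c. gradient (F (fst c)) z \<partial>MM) = gradient f z"
  "integrable MM (\<lambda>c. (norm (gradient (F (fst c)) z - gradient f z))\<^sup>2)"
  "(\<integral>c. (norm (gradient (F (fst c)) z - gradient f z))\<^sup>2 \<partial>MM) \<le> \<sigma>f\<^sup>2"
proof -
  have u: "unbiased_estimate norm Mxi (\<lambda>s. gradient (F s) z) (gradient f z) \<sigma>f"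
    using oracles unfolding stochastic_oracles_def by blast
  show "integrable MM (\<lambda>c. gradient (F (fst c)) z)" "(\<integral>c. gradient (F (fst c)) z \<partial>MM) = gradient f z"
    "integrable MM (\<lambda>c. (norm (gradient (F (fst c)) z - gradient f z))\<^sup>2)"
    "(\<integral>c. (norm (gradient (F (fst c)) z - gradient f z))\<^sup>2 \<partial>MM) \<le> \<sigma>f\<^sup>2"
    using unbiased_pair_fst[OF prob u] by auto
qed

lemma oracle_gradient_G:
  "integrable MM (\<lambda>c. gradient (G (snd c)) z)" "(\<integral>c. gradient (G (snd c)) z \<partial>MM) = gradient g z"
  "integrable MM (\<lambda>c. (norm (gradient (G (snd c)) z - gradient g z))\<^sup>2)"
  "(\<integral>c. (norm (gradient (G (snd c)) z - gradient g z))\<^sup>2 \<partial>MM) \<le> \<sigma>g\<^sup>2"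
proof -
  have u: "unbiased_estimate norm Mzeta (\<lambda>s. gradient (G s) z) (gradient g z) \<sigma>g"
    using oracles unfolding stochastic_oracles_def by blast
  show "integrable MM (\<lambda>c. gradient (G (snd c)) z)" "(\<integral>c. gradient (G (snd c)) z \<partial>MM) = gradient g z"
    "integrable MM (\<lambda>c. (norm (gradient (G (snd c)) z - gradient g z))\<^sup>2)"
    "(\<integral>c. (norm (gradient (G (snd c)) z - gradient g z))\<^sup>2 \<partial>MM) \<le> \<sigma>g\<^sup>2"
    using unbiased_pair_snd[OF prob u] by auto
qed

lemma oracle_jac:
  "integrable MM (\<lambda>c. jac_xy (G (snd c)) z)" "(\<integral>c. jac_xy (G (snd c)) z \<partial>MM) = jac_xy g z"
  "integrable MM (\<lambda>c. (spectral_norm (jac_xy (G (snd c)) z - jac_xy g z))\<^sup>2)"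
  "(\<integral>c. (spectral_norm (jac_xy (G (snd c)) z - jac_xy g z))\<^sup>2 \<partial>MM) \<le> \<sigma>gxy\<^sup>2"
proof -
  have u: "unbiased_estimate spectral_norm Mzeta (\<lambda>s. jac_xy (G s) z) (jac_xy g z) \<sigma>gxy"
    using oracles unfolding stochastic_oracles_def by blast
  show "integrable MM (\<lambda>c. jac_xy (G (snd c)) z)" "(\<integral>c. jac_xy (G (snd c)) z \<partial>MM) = jac_xy g z"
    "integrable MM (\<lambda>c. (spectral_norm (jac_xy (G (snd c)) z - jac_xy g z))\<^sup>2)"
    "(\<integral>c. (spectral_norm (jac_xy (G (snd c)) z - jac_xy g z))\<^sup>2 \<partial>MM) \<le> \<sigma>gxy\<^sup>2"
    using unbiased_pair_snd[OF prob u] by auto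
qed

lemma oracle_hess:
  "integrable MM (\<lambda>c. hess_yy (G (snd c)) z)" "(\<integral>c. hess_yy (G (snd c)) z \<partial>MM) = hess_yy g z"
  "integrable MM (\<lambda>c. (spectral_norm (hess_yy (G (snd c)) z - hess_yy g z))\<^sup>2)"
  "(\<integral>c. (spectral_norm (hess_yy (G (snd c)) z - hess_yy g z))\<^sup>2 \<partial>MM) \<le> \<sigma>gyy\<^sup>2"
proof -
  have u: "unbiased_estimate spectral_norm Mzeta (\<lambda>s. hess_yy (G s) z) (hess_yy g z) \<sigma>gyy"
    using oracles unfolding stochastic_oracles_def by blast
  show "integrable MM (\<lambda>c. hess_yy (G (snd c)) z)" "(\<integral>c. hess_yy (G (snd c)) z \<partial>MM) = hess_yy g z"
    "integrable MM (\<lambda>c. (spectral_norm (hess_yy (G (snd c)) z - hess_yy g z))\<^sup>2)"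
    "(\<integral>c. (spectral_norm (hess_yy (G (snd c)) z - hess_yy g z))\<^sup>2 \<partial>MM) \<le> \<sigma>gyy\<^sup>2"
    using unbiased_pair_snd[OF prob u] by auto
qed

lemma grad_sample:
  assumes "c \<in> space MM"
  shows "grad_x (F (fst c)) z = fst (gradient (F (fst c)) z)" "grad_y (F (fst c)) z = snd (gradient (F (fst c)) z)"
    "grad_y (G (snd c)) z = snd (gradient (G (snd c)) z)"
proof -
  interpret S: smooth_pair "F (fst c)" "G (snd c)" Cf Lf Lg Lgxy Lgyy \<mu> by (rule space_MM[OF assms])
  show "grad_x (F (fst c)) z = fst (gradient (F (fst c)) z)" "grad_y (F (fst c)) z = snd (gradient (F (fst c)) z)"
    "grad_y (G (snd c)) z = snd (gradient (G (snd c)) z)"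
    by (simp_all add: grad_x_eq[OF S.C1f] grad_y_eq[OF S.C1f] grad_y_eq[OF S.C1g])
qed

text \<open>\<open>A\<close> is a gradient part and \<open>B\<close> a matrix part of a sampled direction.\<close>

lemma oracle_combine:
  fixes A :: "'a \<times> 'b \<Rightarrow> 'e::euclidean_space" and B :: "'a \<times> 'b \<Rightarrow> real^'q^'m" and l :: "'e \<Rightarrow> real^'m"
    and D :: "'a \<times> 'b \<Rightarrow> real^'m"
  assumes A: "integrable MM A" "(\<integral>c. A c \<partial>MM) = a"
      "integrable MM (\<lambda>c. (norm (A c - a))\<^sup>2)" "(\<integral>c. (norm (A c - a))\<^sup>2 \<partial>MM) \<le> va"
    and B: "integrable MM B" "(\<integral>c. B c \<partial>MM) = b"
      "integrable MM (\<lambda>c. (spectral_norm (B c - b))\<^sup>2)" "(\<integral>c. (spectral_norm (B c - b))\<^sup>2 \<partial>MM) \<le> vb"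
    and l: "bounded_linear l" "\<And>x. norm (l x) \<le> norm x"
    and D: "\<And>c. c \<in> space MM \<Longrightarrow> D c = l (A c) + B c *v v" and v: "norm v \<le> R"
  shows "integrable MM D" "(\<integral>c. D c \<partial>MM) = l a + b *v v"
    "integrable MM (\<lambda>c. (norm (D c - (l a + b *v v)))\<^sup>2)"
    "(\<integral>c. (norm (D c - (l a + b *v v)))\<^sup>2 \<partial>MM) \<le> 2 * va + 2 * (R\<^sup>2 * vb)"
proof -
  note Bv = integrable_matrix_vector[OF B(1), of v]
  note lA = integrable_bounded_linear[OF l(1) A(1)] integral_bounded_linear[OF l(1) A(1)]
  have int: "integrable MM (\<lambda>c. l (A c) + B c *v v)" using Bv lA by simp
  show D1: "integrable MM D" using int by (rule iffD1[OF Bochner_Integration.integrable_cong[OF refl], rotated]) (simp add: D)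
  have "(\<integral>c. D c \<partial>MM) = (\<integral>c. l (A c) + B c *v v \<partial>MM)"
    by (rule Bochner_Integration.integral_cong) (auto simp: D)
  then show "(\<integral>c. D c \<partial>MM) = l a + b *v v" using Bv lA A(2) B(2) by simp
  have le: "(norm (D c - (l a + b *v v)))\<^sup>2 \<le> 2 * (norm (A c - a))\<^sup>2 + 2 * (R\<^sup>2 * (spectral_norm (B c - b))\<^sup>2)"
    if c: "c \<in> space MM" for c
  proof -
    have "D c - (l a + b *v v) = l (A c - a) + (B c - b) *v v"
      unfolding D[OF c] by (simp add: bounded_linear.linear l linear_diff matrix_vector_mult_diff_rdistrib)
    then have "(norm (D c - (l a + b *v v)))\<^sup>2 \<le> 2 * (norm (l (A c - a)))\<^sup>2 + 2 * (norm ((B c - b) *v v))\<^sup>2"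
      by (metis norm_add_square_le)
    also have "(norm (l (A c - a)))\<^sup>2 \<le> (norm (A c - a))\<^sup>2" by (intro power_mono l) auto
    also have "(norm ((B c - b) *v v))\<^sup>2 \<le> (spectral_norm (B c - b) * R)\<^sup>2"
      using v spectral_norm_nonneg
      by (intro power_mono order_trans[OF norm_matrix_vector_le_spectral] mult_left_mono) auto
    finally show ?thesis by (simp add: power_mult_distrib mult.commute)
  qed
  have intb: "integrable MM (\<lambda>c. 2 * (norm (A c - a))\<^sup>2 + 2 * (R\<^sup>2 * (spectral_norm (B c - b))\<^sup>2))"
    using A(3) B(3) by simp
  show D2: "integrable MM (\<lambda>c. (norm (D c - (l a + b *v v)))\<^sup>2)"
    by (rule Bochner_Integration.integrable_bound[OF intb])
       (use D1 le in \<open>auto intro!: AE_I2 borel_measurable_power borel_measurable_norm borel_measurable_diff intro: order_trans[OF _ abs_ge_self]\<close>)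
  have "(\<integral>c. (norm (D c - (l a + b *v v)))\<^sup>2 \<partial>MM)
      \<le> (\<integral>c. 2 * (norm (A c - a))\<^sup>2 + 2 * (R\<^sup>2 * (spectral_norm (B c - b))\<^sup>2) \<partial>MM)"
    by (rule integral_mono[OF D2 intb le])
  also have "\<dots> = 2 * (\<integral>c. (norm (A c - a))\<^sup>2 \<partial>MM) + 2 * (R\<^sup>2 * (\<integral>c. (spectral_norm (B c - b))\<^sup>2 \<partial>MM))"
    using A(3) B(3) by simp
  also have "\<dots> \<le> 2 * va + 2 * (R\<^sup>2 * vb)"
    using A(4) B(4) by (intro add_mono mult_left_mono) auto
  finally show "(\<integral>c. (norm (D c - (l a + b *v v)))\<^sup>2 \<partial>MM) \<le> 2 * va + 2 * (R\<^sup>2 * vb)" .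
qed

lemma neg_matrix_vector: "(- A) *v v = - (A *v (v :: real^'n))" for A :: "real^'n^'m"
  using matrix_vector_mult_diff_rdistrib[of 0 A v] by simp

lemma spectral_norm_minus: "spectral_norm (- A) = spectral_norm A"
  unfolding spectral_norm_def neg_matrix_vector by (simp add: onorm_neg)

lemma SX_oracle_at:
  assumes v: "norm v \<le> R"
  shows "integrable MM (\<lambda>c. SX c (z, v))" "(\<integral>c. SX c (z, v) \<partial>MM) = mX (z, v)"
    "integrable MM (\<lambda>c. (norm (SX c (z, v) - mX (z, v)))\<^sup>2)"
    "(\<integral>c. (norm (SX c (z, v) - mX (z, v)))\<^sup>2 \<partial>MM) \<le> var_x"
proof -
  have m: "mX (z, v) = fst (gradient f z) + (- jac_xy g z) *v v"
    unfolding mX_def dir_x_def neg_matrix_vector by (simp add: grad_x_eq[OF C1f])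
  have neg: "integrable MM (\<lambda>c. - jac_xy (G (snd c)) z)" "(\<integral>c. - jac_xy (G (snd c)) z \<partial>MM) = - jac_xy g z"
    using oracle_jac(1,2) by auto
  have sp: "spectral_norm (- jac_xy (G (snd c)) z - - jac_xy g z) = spectral_norm (jac_xy (G (snd c)) z - jac_xy g z)" for c
    using spectral_norm_minus[of "jac_xy (G (snd c)) z - jac_xy g z"] by simp
  note res = oracle_combine[OF oracle_gradient_F neg oracle_jac(3,4)[of z, folded sp] bounded_linear_fst norm_fst_le _ v,
      of "\<lambda>c. SX c (z, v)" z, folded m]
  have D: "SX c (z, v) = fst (gradient (F (fst c)) z) + (- jac_xy (G (snd c)) z) *v v" if "c \<in> space MM" for c
    unfolding SX_def dir_x_def neg_matrix_vector by (simp add: grad_sample[OF that])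
  show "integrable MM (\<lambda>c. SX c (z, v))" "(\<integral>c. SX c (z, v) \<partial>MM) = mX (z, v)"
    "integrable MM (\<lambda>c. (norm (SX c (z, v) - mX (z, v)))\<^sup>2)"
    "(\<integral>c. (norm (SX c (z, v) - mX (z, v)))\<^sup>2 \<partial>MM) \<le> var_x"
    unfolding var_x_def by (rule res, erule D)+
qed

lemma SV_oracle_at:
  assumes v: "norm v \<le> R"
  shows "integrable MM (\<lambda>c. SV c (z, v))" "(\<integral>c. SV c (z, v) \<partial>MM) = mV (z, v)"
    "integrable MM (\<lambda>c. (norm (SV c (z, v) - mV (z, v)))\<^sup>2)"
    "(\<integral>c. (norm (SV c (z, v) - mV (z, v)))\<^sup>2 \<partial>MM) \<le> var_v"
proof -
  have m: "mV (z, v) = - snd (gradient f z) + hess_yy g z *v v"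
    unfolding mV_def dir_v_def by (simp add: grad_y_eq[OF C1f])
  have nsnd: "norm (- snd (x :: (real^'p) \<times> (real^'q))) \<le> norm x" for x using norm_snd_le[of x] by simp
  note res = oracle_combine[OF oracle_gradient_F oracle_hess bounded_linear_minus[OF bounded_linear_snd] nsnd _ v,
      of "\<lambda>c. SV c (z, v)" z z, folded m]
  have D: "SV c (z, v) = - snd (gradient (F (fst c)) z) + hess_yy (G (snd c)) z *v v" if "c \<in> space MM" for c
    unfolding SV_def dir_v_def by (simp add: grad_sample[OF that])
  show "integrable MM (\<lambda>c. SV c (z, v))" "(\<integral>c. SV c (z, v) \<partial>MM) = mV (z, v)"
    "integrable MM (\<lambda>c. (norm (SV c (z, v) - mV (z, v)))\<^sup>2)"
    "(\<integral>c. (norm (SV c (z, v) - mV (z, v)))\<^sup>2 \<partial>MM) \<le> var_v"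
    unfolding var_v_def by (rule res, erule D)+
qed

lemma SY_oracle_at:
  "integrable MM (\<lambda>c. SY c z)" "(\<integral>c. SY c z \<partial>MM) = mY z"
  "integrable MM (\<lambda>c. (norm (SY c z - mY z))\<^sup>2)" "(\<integral>c. (norm (SY c z - mY z))\<^sup>2 \<partial>MM) \<le> \<sigma>g\<^sup>2"
proof -
  have m: "mY z = snd (gradient g z)" unfolding mY_def dir_y_def by (simp add: grad_y_eq[OF C1g])
  have D: "SY c z = snd (gradient (G (snd c)) z)" if "c \<in> space MM" for c
    unfolding SY_def dir_y_def by (simp add: grad_sample[OF that])
  have int: "integrable MM (\<lambda>c. snd (gradient (G (snd c)) z))"
    by (rule integrable_bounded_linear[OF bounded_linear_snd oracle_gradient_G(1)])
  show D1: "integrable MM (\<lambda>c. SY c z)"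
    using int by (rule iffD1[OF Bochner_Integration.integrable_cong[OF refl], rotated]) (simp add: D)
  have "(\<integral>c. SY c z \<partial>MM) = (\<integral>c. snd (gradient (G (snd c)) z) \<partial>MM)"
    by (rule Bochner_Integration.integral_cong) (auto simp: D)
  also have "\<dots> = mY z"
    using integral_bounded_linear[OF bounded_linear_snd oracle_gradient_G(1)[of z]] by (simp add: m oracle_gradient_G(2))
  finally show "(\<integral>c. SY c z \<partial>MM) = mY z" .
  have le: "(norm (SY c z - mY z))\<^sup>2 \<le> (norm (gradient (G (snd c)) z - gradient g z))\<^sup>2" if "c \<in> space MM" for c
    using norm_snd_le[of "gradient (G (snd c)) z - gradient g z"] unfolding D[OF that] m
    by (intro power_mono) auto
  show D2: "integrable MM (\<lambda>c. (norm (SY c z - mY z))\<^sup>2)"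
    by (rule Bochner_Integration.integrable_bound[OF oracle_gradient_G(3)])
       (use D1 le in \<open>auto intro!: AE_I2 borel_measurable_power borel_measurable_norm borel_measurable_diff\<close>)
  show "(\<integral>c. (norm (SY c z - mY z))\<^sup>2 \<partial>MM) \<le> \<sigma>g\<^sup>2"
    using integral_mono[OF D2 oracle_gradient_G(3) le] oracle_gradient_G(4) by (rule order_trans)
qed

definition "VS = {u :: ((real^'p) \<times> (real^'q)) \<times> (real^'q). norm (snd u) \<le> R}"

text \<open>Outside \<open>VS\<close> the sampled directions are still measurable in the sample, because they are affine
  in the last argument.\<close>

lemma SX_measurable: "(\<lambda>p. SX (fst p) (snd p)) \<in> borel_measurable (MM \<Otimes>\<^sub>M borel)"
proof (rule caratheodory_measurable)
  fix u :: "((real^'p) \<times> (real^'q)) \<times> (real^'q)"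
  have "(\<lambda>c. fst (gradient (F (fst c)) (fst u)) - jac_xy (G (snd c)) (fst u) *v snd u) \<in> borel_measurable MM"
    using integrable_bounded_linear[OF bounded_linear_fst oracle_gradient_F(1)] integrable_matrix_vector(1)[OF oracle_jac(1)]
    by (intro borel_measurable_diff borel_measurable_integrable) auto
  then show "(\<lambda>c. SX c u) \<in> borel_measurable MM"
    by (rule iffD1[OF measurable_cong, rotated]) (simp add: SX_def dir_x_def grad_sample)
next
  fix c assume "c \<in> space MM"
  then interpret S: smooth_pair "F (fst c)" "G (snd c)" Cf Lf Lg Lgxy Lgyy \<mu> by (rule space_MM)
  show "continuous_on UNIV (SX c)" unfolding SX_def by (rule S.dir_x_continuous)
qed

lemma SV_measurable: "(\<lambda>p. SV (fst p) (snd p)) \<in> borel_measurable (MM \<Otimes>\<^sub>M borel)"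
proof (rule caratheodory_measurable)
  fix u :: "((real^'p) \<times> (real^'q)) \<times> (real^'q)"
  have "(\<lambda>c. hess_yy (G (snd c)) (fst u) *v snd u - snd (gradient (F (fst c)) (fst u))) \<in> borel_measurable MM"
    using integrable_bounded_linear[OF bounded_linear_snd oracle_gradient_F(1)] integrable_matrix_vector(1)[OF oracle_hess(1)]
    by (intro borel_measurable_diff borel_measurable_integrable) auto
  then show "(\<lambda>c. SV c u) \<in> borel_measurable MM"
    by (rule iffD1[OF measurable_cong, rotated]) (simp add: SV_def dir_v_def grad_sample)
next
  fix c assume "c \<in> space MM"
  then interpret S: smooth_pair "F (fst c)" "G (snd c)" Cf Lf Lg Lgxy Lgyy \<mu> by (rule space_MM)
  show "continuous_on UNIV (SV c)" unfolding SV_def by (rule S.dir_v_continuous)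
qed

lemma SY_measurable: "(\<lambda>p. SY (fst p) (snd p)) \<in> borel_measurable (MM \<Otimes>\<^sub>M borel)"
proof (rule caratheodory_measurable)
  show "(\<lambda>c. SY c z) \<in> borel_measurable MM" for z using SY_oracle_at(1) by (rule borel_measurable_integrable)
next
  fix c assume "c \<in> space MM"
  then interpret S: smooth_pair "F (fst c)" "G (snd c)" Cf Lf Lg Lgxy Lgyy \<mu> by (rule space_MM)
  show "continuous_on UNIV (SY c)" unfolding SY_def by (rule S.dir_y_continuous)
qed

lemma mX_measurable[measurable]: "mX \<in> borel_measurable borel"
  unfolding mX_def by (rule borel_measurable_continuous_onI[OF dir_x_continuous])
lemma mV_measurable[measurable]: "mV \<in> borel_measurable borel"
  unfolding mV_def by (rule borel_measurable_continuous_onI[OF dir_v_continuous])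
lemma mY_measurable[measurable]: "mY \<in> borel_measurable borel"
  unfolding mY_def[abs_def] by (rule borel_measurable_continuous_onI[OF dir_y_continuous])

lemma oracle_SX: "oracle_on VS SX mX var_x"
  unfolding oracle_on_def VS_def using SX_measurable mX_measurable SX_oracle_at by auto
lemma oracle_SV: "oracle_on VS SV mV var_v"
  unfolding oracle_on_def VS_def using SV_measurable mV_measurable SV_oracle_at by auto
lemma oracle_SY: "oracle_on UNIV SY mY (\<sigma>g\<^sup>2)"
  unfolding oracle_on_def using SY_measurable mY_measurable SY_oracle_at by auto

definition "MM1 = 4 * Lf\<^sup>2 + 4 * R\<^sup>2 * Lgg\<^sup>2"

lemma SX_sq_lip:
  assumes "c \<in> space MM" "norm (snd u') \<le> R"
  shows "(norm (SX c u - SX c u'))\<^sup>2 \<le> MM1 * (norm (fst u - fst u'))\<^sup>2 + 2 * Lg\<^sup>2 * (norm (snd u - snd u'))\<^sup>2"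
proof -
  interpret S: smooth_pair "F (fst c)" "G (snd c)" Cf Lf Lg Lgxy Lgyy \<mu> by (rule space_MM[OF assms(1)])
  show ?thesis unfolding SX_def MM1_def by (rule S.dir_x_sq_lip[OF assms(2)])
qed

lemma SV_sq_lip:
  assumes "c \<in> space MM" "norm (snd u') \<le> R"
  shows "(norm (SV c u - SV c u'))\<^sup>2 \<le> MM1 * (norm (fst u - fst u'))\<^sup>2 + 2 * Lg\<^sup>2 * (norm (snd u - snd u'))\<^sup>2"
proof -
  interpret S: smooth_pair "F (fst c)" "G (snd c)" Cf Lf Lg Lgxy Lgyy \<mu> by (rule space_MM[OF assms(1)])
  show ?thesis unfolding SV_def MM1_def by (rule S.dir_v_sq_lip[OF assms(2)])
qed

lemma SY_sq_lip:
  assumes "c \<in> space MM"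
  shows "(norm (SY c z - SY c z'))\<^sup>2 \<le> Lg\<^sup>2 * (norm (z - z'))\<^sup>2"
proof -
  interpret S: smooth_pair "F (fst c)" "G (snd c)" Cf Lf Lg Lgxy Lgyy \<mu> by (rule space_MM[OF assms(1)])
  have "(norm (SY c z - SY c z'))\<^sup>2 \<le> (Lg * norm (z - z'))\<^sup>2"
    unfolding SY_def by (intro power_mono S.dir_y_lip) auto
  then show ?thesis by (simp add: power_mult_distrib)
qed

subsection \<open>Measurability of the iterates\<close>

text \<open>The samples live on one product space indexed by pairs, whereas the algorithm takes them
  curried.\<close>

definition smp :: "(sample_set \<times> nat \<Rightarrow> 'a \<times> 'b) \<Rightarrow> sample_set \<Rightarrow> nat \<Rightarrow> 'a \<times> 'b"
  where "smp w b i = w (b, i)"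

lemma batch_x_eq: "batch_x F G n (smp w b) z v = batch_mean n (\<lambda>i. SX (w (b, i)) (z, v))"
  unfolding batch_x_def SX_def smp_def by simp
lemma batch_v_eq: "batch_v F G n (smp w b) z v = batch_mean n (\<lambda>i. SV (w (b, i)) (z, v))"
  unfolding batch_v_def SV_def smp_def by simp
lemma batch_y_eq: "batch_y G n (smp w b) z = batch_mean n (\<lambda>i. SY (w (b, i)) z)"
  unfolding batch_y_def SY_def smp_def by simp

lemma batch_mean_measurable:
  fixes D :: "'a \<times> 'b \<Rightarrow> 'u::euclidean_space \<Rightarrow> 'e::euclidean_space"
  assumes D: "(\<lambda>p. D (fst p) (snd p)) \<in> borel_measurable (MM \<Otimes>\<^sub>M borel)"
    and U[measurable]: "U \<in> borel_measurable Om"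
  shows "(\<lambda>w. batch_mean n (\<lambda>i. D (w (b, i)) (U w))) \<in> borel_measurable Om"
proof -
  have [measurable]: "(\<lambda>w. D (w (b, i)) (U w)) \<in> borel_measurable Om" for i
    using measurable_compose[OF measurable_Pair[OF component_measurable[of "(b, i)"] U] D] by simp
  show ?thesis unfolding batch_mean_def by measurable
qed

lemma batch_x_measurable[measurable (raw)]:
  "Z \<in> borel_measurable Om \<Longrightarrow> V \<in> borel_measurable Om \<Longrightarrow> (\<lambda>w. batch_x F G n (smp w b) (Z w) (V w)) \<in> borel_measurable Om"
  unfolding batch_x_eq by (rule batch_mean_measurable[OF SX_measurable]) simp
lemma batch_v_measurable[measurable (raw)]:
  "Z \<in> borel_measurable Om \<Longrightarrow> V \<in> borel_measurable Om \<Longrightarrow> (\<lambda>w. batch_v F G n (smp w b) (Z w) (V w)) \<in> borel_measurable Om"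
  unfolding batch_v_eq by (rule batch_mean_measurable[OF SV_measurable]) simp
lemma batch_y_measurable[measurable (raw)]:
  "Z \<in> borel_measurable Om \<Longrightarrow> (\<lambda>w. batch_y G n (smp w b) (Z w)) \<in> borel_measurable Om"
  unfolding batch_y_eq by (rule batch_mean_measurable[OF SY_measurable])

lemma y_loop_measurable:
  assumes [measurable]: "xk \<in> borel_measurable Om" "xk1 \<in> borel_measurable Om" "y \<in> borel_measurable Om" "d \<in> borel_measurable Om"
  shows "(\<lambda>w. fst (y_loop G par (smp w) k (xk w) (xk1 w) (y w) (d w) t)) \<in> borel_measurable Om
    \<and> (\<lambda>w. snd (y_loop G par (smp w) k (xk w) (xk1 w) (y w) (d w) t)) \<in> borel_measurable Om"
proof (induction t)
  case (Suc t)
  let ?l = "\<lambda>w t. y_loop G par (smp w) k (xk w) (xk1 w) (y w) (d w) t"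
  from Suc have [measurable]: "(\<lambda>w. fst (?l w t)) \<in> borel_measurable Om" "(\<lambda>w. snd (?l w t)) \<in> borel_measurable Om"
    by (rule conjunct1, rule conjunct2)
  have [measurable]: "(\<lambda>w. if t = 0 then xk w else xk1 w) \<in> borel_measurable Om" by (cases "t = 0") simp_all
  have f[measurable]: "(\<lambda>w. fst (?l w (Suc t))) \<in> borel_measurable Om" unfolding y_loop_Suc(1) by measurable
  have "(\<lambda>w. snd (?l w (Suc t))) \<in> borel_measurable Om"
    unfolding y_loop_Suc(2)
    by (intro borel_measurable_add borel_measurable_diff borel_measurable_scaleR batch_y_measurable borel_measurable_Pair) measurable
  with f show ?case ..
qed simp

lemma closest_point_measurable[measurable]: "closest_point (cball (0::real^'q) r) \<in> borel_measurable borel" if "0 \<le> r" for r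
  by (rule borel_measurable_continuous_onI, rule continuous_on_closest_point) (use that in auto)

lemma v_loop_measurable:
  assumes [measurable]: "zk \<in> borel_measurable Om" "zk1 \<in> borel_measurable Om" "v \<in> borel_measurable Om"
      "dx \<in> borel_measurable Om" "dv \<in> borel_measurable Om"
    and r: "0 \<le> radius par"
  shows "(\<lambda>w. fst (v_loop F G par (smp w) k (zk w) (zk1 w) (v w) (dx w) (dv w) j)) \<in> borel_measurable Om
    \<and> (\<lambda>w. fst (snd (v_loop F G par (smp w) k (zk w) (zk1 w) (v w) (dx w) (dv w) j))) \<in> borel_measurable Om
    \<and> (\<lambda>w. snd (snd (v_loop F G par (smp w) k (zk w) (zk1 w) (v w) (dx w) (dv w) j))) \<in> borel_measurable Om"
proof (induction j)
  case (Suc j)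
  let ?l = "\<lambda>w j. v_loop F G par (smp w) k (zk w) (zk1 w) (v w) (dx w) (dv w) j"
  have [measurable]: "(\<lambda>w. fst (?l w j)) \<in> borel_measurable Om" by (rule conjunct1[OF Suc])
  have [measurable]: "(\<lambda>w. fst (snd (?l w j))) \<in> borel_measurable Om" by (rule conjunct1[OF conjunct2[OF Suc]])
  have [measurable]: "(\<lambda>w. snd (snd (?l w j))) \<in> borel_measurable Om" by (rule conjunct2[OF conjunct2[OF Suc]])
  have [measurable]: "(\<lambda>w. if j = 0 then zk w else zk1 w) \<in> borel_measurable Om" by (cases "j = 0") simp_all
  have f[measurable]: "(\<lambda>w. fst (?l w (Suc j))) \<in> borel_measurable Om"
    unfolding v_loop_Suc(1) by (rule measurable_compose[OF _ closest_point_measurable[OF r]]) measurable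
  have "(\<lambda>w. fst (snd (?l w (Suc j)))) \<in> borel_measurable Om"
    unfolding v_loop_Suc(2)
    by (intro borel_measurable_add borel_measurable_diff borel_measurable_scaleR batch_x_measurable) measurable
  moreover have "(\<lambda>w. snd (snd (?l w (Suc j)))) \<in> borel_measurable Om"
    unfolding v_loop_Suc(3)
    by (intro borel_measurable_add borel_measurable_diff borel_measurable_scaleR batch_v_measurable) measurable
  ultimately show ?case using f by (intro conjI)
qed simp

lemma als_measurable:
  assumes r: "0 \<le> radius par"
  shows "(\<lambda>w. fst (als F G par x0 y0 v0 (smp w) k)) \<in> borel_measurable Om
    \<and> (\<lambda>w. fst (snd (als F G par x0 y0 v0 (smp w) k))) \<in> borel_measurable Om
    \<and> (\<lambda>w. fst (snd (snd (als F G par x0 y0 v0 (smp w) k)))) \<in> borel_measurable Om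
    \<and> (\<lambda>w. fst (snd (snd (snd (als F G par x0 y0 v0 (smp w) k))))) \<in> borel_measurable Om
    \<and> (\<lambda>w. fst (snd (snd (snd (snd (als F G par x0 y0 v0 (smp w) k)))))) \<in> borel_measurable Om
    \<and> (\<lambda>w. snd (snd (snd (snd (snd (als F G par x0 y0 v0 (smp w) k)))))) \<in> borel_measurable Om"
proof (induction k)
  case (Suc k)
  let ?a = "\<lambda>w. als F G par x0 y0 v0 (smp w) k"
  from Suc have [measurable]: "(\<lambda>w. fst (?a w)) \<in> borel_measurable Om"
    "(\<lambda>w. fst (snd (?a w))) \<in> borel_measurable Om"
    "(\<lambda>w. fst (snd (snd (?a w)))) \<in> borel_measurable Om"
    "(\<lambda>w. fst (snd (snd (snd (?a w))))) \<in> borel_measurable Om"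
    "(\<lambda>w. fst (snd (snd (snd (snd (?a w)))))) \<in> borel_measurable Om"
    "(\<lambda>w. snd (snd (snd (snd (snd (?a w)))))) \<in> borel_measurable Om" by auto
  define ini where "ini \<longleftrightarrow> k mod period par = 0"
  define dx where "dx w = (if ini then batch_x F G (batch_init par) (smp w (Init_x k)) (fst (?a w), fst (snd (?a w))) (fst (snd (snd (?a w))))
    else fst (snd (snd (snd (?a w)))))" for w
  define dy where "dy w = (if ini then batch_y G (batch_init par) (smp w (Init_y k)) (fst (?a w), fst (snd (?a w)))
    else fst (snd (snd (snd (snd (?a w))))))" for w
  define dv where "dv w = (if ini then batch_v F G (batch_init par) (smp w (Init_v k)) (fst (?a w), fst (snd (?a w))) (fst (snd (snd (?a w))))
    else snd (snd (snd (snd (snd (?a w))))))" for w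
  define x' where "x' w = fst (?a w) - step_x par *\<^sub>R dx w" for w
  have dxm[measurable]: "dx \<in> borel_measurable Om"
    unfolding dx_def by (cases ini) (simp_all only: if_True if_False, (intro batch_x_measurable borel_measurable_Pair)?, measurable)
  have dym[measurable]: "dy \<in> borel_measurable Om"
    unfolding dy_def by (cases ini) (simp_all only: if_True if_False, (intro batch_y_measurable borel_measurable_Pair)?, measurable)
  have dvm[measurable]: "dv \<in> borel_measurable Om"
    unfolding dv_def by (cases ini) (simp_all only: if_True if_False, (intro batch_v_measurable borel_measurable_Pair)?, measurable)
  have x'm[measurable]: "x' \<in> borel_measurable Om" unfolding x'_def by measurable
  define yl where "yl w = y_loop G par (smp w) k (fst (?a w)) (x' w) (fst (snd (?a w))) (dy w) (y_iters par)" for w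
  have "(\<lambda>w. fst (yl w)) \<in> borel_measurable Om \<and> (\<lambda>w. snd (yl w)) \<in> borel_measurable Om"
    unfolding yl_def by (rule y_loop_measurable) measurable
  then have yl1[measurable]: "(\<lambda>w. fst (yl w)) \<in> borel_measurable Om" and yl2[measurable]: "(\<lambda>w. snd (yl w)) \<in> borel_measurable Om"
    by (rule conjunct1, rule conjunct2)
  define vl where "vl w = v_loop F G par (smp w) k (fst (?a w), fst (snd (?a w))) (x' w, fst (yl w)) (fst (snd (snd (?a w)))) (dx w) (dv w) (v_iters par)" for w
  have vl: "(\<lambda>w. fst (vl w)) \<in> borel_measurable Om \<and> (\<lambda>w. fst (snd (vl w))) \<in> borel_measurable Om
    \<and> (\<lambda>w. snd (snd (vl w))) \<in> borel_measurable Om"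
    unfolding vl_def by (rule v_loop_measurable[OF _ _ _ _ _ r]) measurable
  have "als F G par x0 y0 v0 (smp w) (Suc k) = (x' w, fst (yl w), fst (vl w), fst (snd (vl w)), snd (yl w), snd (snd (vl w)))" for w
    unfolding vl_def yl_def x'_def dx_def dy_def dv_def ini_def by (simp add: Let_def case_prod_beta')
  then show ?case using x'm yl1 yl2 vl by (simp only: fst_conv snd_conv)
qed simp

end

section \<open>Pathwise descent inequalities\<close>

lemma young_square:
  fixes u v :: "'a::real_inner"
  assumes "0 < \<theta>"
  shows "(norm (u + v))\<^sup>2 \<le> (1 + \<theta>) * (norm u)\<^sup>2 + (1 + 1 / \<theta>) * (norm v)\<^sup>2"
proof -
  have "0 \<le> (norm (sqrt \<theta> *\<^sub>R u - (1 / sqrt \<theta>) *\<^sub>R v))\<^sup>2" by simp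
  also have "\<dots> = \<theta> * (norm u)\<^sup>2 + (1 / \<theta>) * (norm v)\<^sup>2 - 2 * (u \<bullet> v)"
    using assms unfolding power2_norm_eq_inner
    by (simp add: inner_diff_left inner_diff_right inner_commute real_sqrt_mult_self power2_eq_square field_simps)
  finally show ?thesis unfolding power2_norm_eq_inner
    by (simp add: inner_add_left inner_add_right inner_commute algebra_simps)
qed

lemma norm_add3_square_le:
  fixes a b c :: "'a::real_inner"
  shows "(norm (a + b + c))\<^sup>2 \<le> 3 * ((norm a)\<^sup>2 + (norm b)\<^sup>2 + (norm c)\<^sup>2)"
proof -
  have "0 \<le> (norm (a - b))\<^sup>2 + (norm (b - c))\<^sup>2 + (norm (a - c))\<^sup>2" by simp
  then show ?thesis unfolding power2_norm_eq_inner
    by (simp add: inner_add_left inner_add_right inner_diff_left inner_diff_right inner_commute)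
qed

lemma norm_sum_square_le:
  fixes d :: "nat \<Rightarrow> 'a::real_normed_vector"
  shows "(norm (\<Sum>t<n. d t))\<^sup>2 \<le> real n * (\<Sum>t<n. (norm (d t))\<^sup>2)"
proof -
  have "(norm (\<Sum>t<n. d t))\<^sup>2 \<le> (\<Sum>t<n. norm (d t))\<^sup>2"
    by (intro power_mono norm_sum) auto
  also have "\<dots> \<le> (\<Sum>t<n. (norm (d t))\<^sup>2) * real (card {..<n})"
    by (rule sum_squared_le_sum_of_squares)
  finally show ?thesis by (simp add: mult.commute)
qed

text \<open>Passing from the minimizer at \<open>x\<^sub>k\<close> to the one at \<open>x\<^sub>k\<^sub>+\<^sub>1\<close> costs half of the contraction.\<close>

lemma drift_bound:
  assumes N: "N \<le> (1 - s * \<mu> / 2) * A + 5 * s / (2 * \<mu>) * E - k * H"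
    and V: "V \<le> c * (\<alpha>\<^sup>2 * \<Delta>)" and K: "K * c * \<alpha> \<le> s * \<mu>" "17 \<le> 4 * C * K"
    and pos: "0 \<le> A" "0 \<le> E" "0 \<le> H" "0 \<le> k" "0 < s" "0 < \<mu>" "s * \<mu> \<le> 1 / 4" "0 \<le> \<alpha>" "0 \<le> \<Delta>" "0 < K" "0 \<le> c"
  shows "(1 + s * \<mu> / 4) * N + (1 + 1 / (s * \<mu> / 4)) * V
    \<le> (1 - s * \<mu> / 4) * A + 3 * s / \<mu> * E - k * H + C * \<alpha> * (\<Delta>::real)"
proof -
  define \<theta> where "\<theta> = s * \<mu> / 4"
  have \<theta>: "0 < \<theta>" "\<theta> \<le> 1 / 16" using pos(7) mult_pos_pos[OF pos(5,6)] unfolding \<theta>_def by linarith+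
  have "(1 + \<theta>) * N \<le> (1 + \<theta>) * ((1 - 2 * \<theta>) * A + 5 * s / (2 * \<mu>) * E - k * H)"
  proof (rule mult_left_mono)
    have "2 * \<theta> = s * \<mu> / 2" by (simp add: \<theta>_def)
    then show "N \<le> (1 - 2 * \<theta>) * A + 5 * s / (2 * \<mu>) * E - k * H" using N by (simp only:)
  qed (use \<theta> in simp)
  also have "\<dots> = ((1 + \<theta>) * (1 - 2 * \<theta>)) * A + (1 + \<theta>) * (5 * s / (2 * \<mu>)) * E - (1 + \<theta>) * (k * H)"
    by (simp add: algebra_simps)
  also have "\<dots> \<le> (1 - \<theta>) * A + 3 * s / \<mu> * E - k * H"
  proof -
    have "(1 + \<theta>) * (1 - 2 * \<theta>) \<le> 1 - \<theta>" using \<theta> by (simp add: algebra_simps)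
    then have "((1 + \<theta>) * (1 - 2 * \<theta>)) * A \<le> (1 - \<theta>) * A" using pos by (intro mult_right_mono)
    moreover have "(1 + \<theta>) * (5 * s / (2 * \<mu>)) \<le> 3 * s / \<mu>"
    proof -
      have "(1 + \<theta>) * (5 * s / (2 * \<mu>)) \<le> (6 / 5) * (5 * s / (2 * \<mu>))"
        using \<theta> pos by (intro mult_right_mono) auto
      also have "\<dots> = 3 * s / \<mu>" by simp
      finally show ?thesis .
    qed
    then have "(1 + \<theta>) * (5 * s / (2 * \<mu>)) * E \<le> 3 * s / \<mu> * E" using pos by (intro mult_right_mono)
    moreover have "1 * (k * H) \<le> (1 + \<theta>) * (k * H)" using \<theta> pos by (intro mult_right_mono) auto
    ultimately show ?thesis by linarith
  qed
  finally have 1: "(1 + \<theta>) * N \<le> (1 - \<theta>) * A + 3 * s / \<mu> * E - k * H" .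
  have "(1 + 1 / \<theta>) * V \<le> (1 + 1 / \<theta>) * (c * (\<alpha>\<^sup>2 * \<Delta>))" using V \<theta> by (intro mult_left_mono) auto
  \<comment> \<open>As \<theta> \<le> 1/16, one has 1 + 1 / \<theta> \<le> 17 / (16 \<theta>) =
    (17/4) / (s \<mu>), the source of the 17 in the hypothesis. The lemma is applied with K = 96, C
    = 1/20 for y and K = 48, C = 1/11 for v.\<close>
  also have "\<dots> \<le> (17 / 16 / \<theta>) * (c * (\<alpha>\<^sup>2 * \<Delta>))"
    using \<theta> pos by (intro mult_right_mono) (auto simp: field_simps)
  also have "\<dots> = (17 / 4) / (s * \<mu>) * (c * \<alpha>) * (\<alpha> * \<Delta>)"
    by (simp add: \<theta>_def power2_eq_square)
  also have "\<dots> \<le> C * (\<alpha> * \<Delta>)"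
  proof (rule mult_right_mono)
    have sm: "0 < s * \<mu>" using pos by simp
    have "c * \<alpha> \<le> s * \<mu> / K" using K pos by (simp add: field_simps)
    then have "(17 / 4) / (s * \<mu>) * (c * \<alpha>) \<le> (17 / 4) / (s * \<mu>) * (s * \<mu> / K)"
      using sm by (intro mult_left_mono) auto
    also have "\<dots> = 17 / 4 / K" using pos(5,6) by simp
    also have "\<dots> \<le> C" using K pos by (simp add: field_simps)
    finally show "(17 / 4) / (s * \<mu>) * (c * \<alpha>) \<le> C" .
  qed (use pos in auto)
  finally show ?thesis using 1 unfolding \<theta>_def by (simp add: mult.assoc)
qed

text \<open>The first outer iteration whose starting state may depend on the set. Initial batches
  get 0 because \<open>st\<close> below already contains the initial estimators.\<close>

fun stage :: "sample_set \<Rightarrow> nat" where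
  "stage (Init_x k) = 0" | "stage (Init_y k) = 0" | "stage (Init_v k) = 0"
| "stage (Inner_x k n) = Suc k" | "stage (Inner_y k n) = Suc k" | "stage (Inner_v k n) = Suc k"

lemma y_loop_cong:
  assumes "\<And>t'. t' < t \<Longrightarrow> s (Inner_y k t') = s' (Inner_y k t')"
  shows "y_loop G par s k xk xk1 y d t = y_loop G par s' k xk xk1 y d t"
  using assms by (induction t) (simp_all add: Let_def)

lemma v_loop_cong:
  assumes "\<And>j'. j' < j \<Longrightarrow> s (Inner_x k j') = s' (Inner_x k j')" "\<And>j'. j' < j \<Longrightarrow> s (Inner_v k j') = s' (Inner_v k j')"
  shows "v_loop F G par s k zk zk1 v dx dv j = v_loop F G par s' k zk zk1 v dx dv j"
  using assms by (induction j) (simp_all add: Let_def)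

lemma als_cong:
  assumes "period par = 0" "\<And>b. stage b \<le> k \<Longrightarrow> s b = s' b"
  shows "als F G par x0 y0 v0 s k = als F G par x0 y0 v0 s' k"
  using assms(2)
proof (induction k)
  case (Suc k)
  have IH: "als F G par x0 y0 v0 s k = als F G par x0 y0 v0 s' k"
    using Suc by (meson le_SucI)
  have y: "y_loop G par s k xk xk1 y d t = y_loop G par s' k xk xk1 y d t" for xk xk1 y d t
    by (rule y_loop_cong) (simp add: Suc.prems)
  have v: "v_loop F G par s k zk zk1 v dx dv t = v_loop F G par s' k zk zk1 v dx dv t" for zk zk1 v dx dv t
    by (rule v_loop_cong) (simp_all add: Suc.prems)
  have i: "s (Init_x k) = s' (Init_x k)" "s (Init_y k) = s' (Init_y k)" "s (Init_v k) = s' (Init_v k)"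
    by (simp_all add: Suc.prems)
  show ?case by (simp add: Let_def IH y v i cong: if_cong)
qed simp

text \<open>With period 0 a single process runs forever, independently of K, and initialises at k =
  0 only; \<open>als_period\<close> identifies its iterates up to K with those of period K. The
  hypotheses \<open>drift\<close> weigh the motion of \<open>ystar\<close> and \<open>vstar\<close>
  against the contraction of the inner loops.\<close>

locale als_setting = als_base f g Cf Lf Lg Lgxy Lgyy \<mu> Mxi Mzeta F G \<sigma>f \<sigma>g \<sigma>gxy \<sigma>gyy R
  for f g :: "(real^'p) \<times> (real^'q) \<Rightarrow> real" and Cf Lf Lg Lgxy Lgyy \<mu>
    and Mxi :: "'a measure" and Mzeta :: "'b measure"
    and F :: "'a \<Rightarrow> (real^'p) \<times> (real^'q) \<Rightarrow> real" and G :: "'b \<Rightarrow> (real^'p) \<times> (real^'q) \<Rightarrow> real"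
    and \<sigma>f \<sigma>g \<sigma>gxy \<sigma>gyy R +
  fixes par :: als_params and x0 :: "real^'p" and y0 v0 :: "real^'q"
  assumes par_period: "period par = 0" and par_radius: "radius par = R"
    and sizes: "0 < batch_init par" "0 < batch_inner par" "0 < y_iters par" "0 < v_iters par"
    and mom: "0 \<le> mom_x par" "mom_x par \<le> 1" "0 \<le> mom_y par" "mom_y par \<le> 1" "0 \<le> mom_v par" "mom_v par \<le> 1"
    and al: "0 < step_x par" "6 * LPhi * step_x par \<le> 1"
    and sy: "0 < rate_y par * step_y par" "rate_y par * step_y par \<le> 1 / (2 * Lg + 2 * \<mu>)"
    and sv: "0 < rate_v par * step_v par" "rate_v par * step_v par \<le> 1 / (2 * Lg + 2 * \<mu>)"
    and drift: "96 * Cy\<^sup>2 * step_x par \<le> rate_y par * step_y par * \<mu>"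
      "48 * Cv\<^sup>2 * step_x par \<le> rate_v par * step_v par * \<mu>"
    and v0_ball: "norm v0 \<le> R"
    and bdd: "bdd_below (range (hyper_objective f g))"
begin

abbreviation "al \<equiv> step_x par"
abbreviation "sy \<equiv> rate_y par * step_y par"
abbreviation "sv \<equiv> rate_v par * step_v par"
abbreviation "nb \<equiv> batch_inner par"
abbreviation "Ty \<equiv> y_iters par"
abbreviation "Jv \<equiv> v_iters par"

text \<open>The state of the algorithm at the start of outer iteration \<open>k\<close>, with the initial estimators
  already in place. With \<open>period = 0\<close> the test \<open>k mod period = 0\<close> holds only for \<open>k = 0\<close>.\<close>

definition st where
  "st k w = (case als F G par x0 y0 v0 (smp w) k of (x, y, v, dx, dy, dv) \<Rightarrow>
     if k = 0 then (x, y, v, batch_x F G (batch_init par) (smp w (Init_x 0)) (x, y) v,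
       batch_y G (batch_init par) (smp w (Init_y 0)) (x, y), batch_v F G (batch_init par) (smp w (Init_v 0)) (x, y) v)
     else (x, y, v, dx, dy, dv))"

definition "X k w = fst (st k w)"
definition "yl k t w = y_loop G par (smp w) k (X k w) (X k w - al *\<^sub>R fst (snd (snd (snd (st k w)))))
  (fst (snd (st k w))) (fst (snd (snd (snd (snd (st k w)))))) t"
definition "vl k j w = v_loop F G par (smp w) k (X k w, fst (snd (st k w)))
  (X k w - al *\<^sub>R fst (snd (snd (snd (st k w)))), fst (yl k Ty w))
  (fst (snd (snd (st k w)))) (fst (snd (snd (snd (st k w))))) (snd (snd (snd (snd (snd (st k w)))))) j"
definition "Yt k t w = fst (yl k t w)"
definition "DYt k t w = snd (yl k t w)"
definition "Vt k j w = fst (vl k j w)"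
definition "DXt k j w = fst (snd (vl k j w))"
definition "DVt k j w = snd (snd (vl k j w))"

lemma Yt_0: "Yt k 0 w = fst (snd (st k w))" by (simp add: Yt_def yl_def)
lemma DYt_0: "DYt k 0 w = fst (snd (snd (snd (snd (st k w)))))" by (simp add: DYt_def yl_def)
lemma Vt_0: "Vt k 0 w = fst (snd (snd (st k w)))" by (simp add: Vt_def vl_def)
lemma DXt_0: "DXt k 0 w = fst (snd (snd (snd (st k w))))" by (simp add: DXt_def vl_def)
lemma DVt_0: "DVt k 0 w = snd (snd (snd (snd (snd (st k w)))))" by (simp add: DVt_def vl_def)

lemma st_0: "st 0 w = (x0, y0, v0, batch_x F G (batch_init par) (smp w (Init_x 0)) (x0, y0) v0,
  batch_y G (batch_init par) (smp w (Init_y 0)) (x0, y0), batch_v F G (batch_init par) (smp w (Init_v 0)) (x0, y0) v0)"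
  by (simp add: st_def)

lemma st_Suc: "st (Suc k) w = (X k w - al *\<^sub>R DXt k 0 w, Yt k Ty w, Vt k Jv w, DXt k Jv w, DYt k Ty w, DVt k Jv w)"
proof -
  obtain x y v dx dy dv where a: "als F G par x0 y0 v0 (smp w) k = (x, y, v, dx, dy, dv)"
    by (metis prod_cases6)
  show ?thesis
    unfolding DXt_0 unfolding Yt_def DYt_def Vt_def DXt_def DVt_def vl_def yl_def X_def
    by (cases "k = 0") (simp_all add: st_def a par_period Let_def case_prod_beta')
qed

lemma X_Suc: "X (Suc k) w = X k w - al *\<^sub>R DXt k 0 w" by (simp add: X_def st_Suc)
lemma Yt_Suc_0: "Yt (Suc k) 0 w = Yt k Ty w" by (simp add: Yt_0 st_Suc)
lemma DYt_Suc_0: "DYt (Suc k) 0 w = DYt k Ty w" by (simp add: DYt_0 st_Suc)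
lemma Vt_Suc_0: "Vt (Suc k) 0 w = Vt k Jv w" by (simp add: Vt_0 st_Suc)
lemma DXt_Suc_0: "DXt (Suc k) 0 w = DXt k Jv w" by (simp add: DXt_0 st_Suc)
lemma DVt_Suc_0: "DVt (Suc k) 0 w = DVt k Jv w" by (simp add: DVt_0 st_Suc)

text \<open>Index t means after t inner steps, so t = 0 is the point with inner index -1: it still
  carries x_k, and every later one carries x_(k+1).\<close>

definition "xx k (t::nat) w = (if t = 0 then X k w else X (Suc k) w)"
definition "zz k (j::nat) w = (if j = 0 then (X k w, Yt k 0 w) else (X (Suc k) w, Yt k Ty w))"

lemma yl_alt: "yl k t w = y_loop G par (smp w) k (X k w) (X (Suc k) w) (Yt k 0 w) (DYt k 0 w) t"
  unfolding X_Suc DXt_0 Yt_0 DYt_0 yl_def ..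
lemma vl_alt: "vl k j w = v_loop F G par (smp w) k (zz k 0 w) (zz k 1 w) (Vt k 0 w) (DXt k 0 w) (DVt k 0 w) j"
  unfolding zz_def X_Suc DXt_0 Vt_0 DVt_0 vl_def Yt_0 by (simp add: Yt_def)

lemma Yt_Suc: "Yt k (Suc t) w = Yt k t w - sy *\<^sub>R DYt k t w"
  unfolding Yt_def DYt_def unfolding yl_alt by (rule y_loop_Suc)

lemma DYt_Suc: "DYt k (Suc t) w = batch_mean nb (\<lambda>i. SY (w (Inner_y k t, i)) (xx k (Suc t) w, Yt k (Suc t) w))
  + (1 - mom_y par) *\<^sub>R (DYt k t w - batch_mean nb (\<lambda>i. SY (w (Inner_y k t, i)) (xx k t w, Yt k t w)))"
  unfolding DYt_def Yt_def unfolding yl_alt y_loop_Suc(2) batch_y_eq xx_def by simp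

lemma Vt_Suc: "Vt k (Suc j) w = closest_point (cball 0 R) (Vt k j w - sv *\<^sub>R DVt k j w)"
  unfolding Vt_def DVt_def par_radius[symmetric] unfolding vl_alt by (rule v_loop_Suc)

lemma zz_Suc: "zz k (Suc j) w = zz k 1 w" by (simp add: zz_def)

lemma zz_if: "zz k j w = (if j = 0 then zz k 0 w else zz k 1 w)" by (simp add: zz_def)

lemma DXt_Suc: "DXt k (Suc j) w = batch_mean nb (\<lambda>i. SX (w (Inner_x k j, i)) (zz k (Suc j) w, Vt k (Suc j) w))
  + (1 - mom_x par) *\<^sub>R (DXt k j w - batch_mean nb (\<lambda>i. SX (w (Inner_x k j, i)) (zz k j w, Vt k j w)))"
  unfolding DXt_def Vt_def unfolding vl_alt v_loop_Suc(2) batch_x_eq zz_Suc zz_if[of k j] ..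

lemma DVt_Suc: "DVt k (Suc j) w = batch_mean nb (\<lambda>i. SV (w (Inner_v k j, i)) (zz k (Suc j) w, Vt k (Suc j) w))
  + (1 - mom_v par) *\<^sub>R (DVt k j w - batch_mean nb (\<lambda>i. SV (w (Inner_v k j, i)) (zz k j w, Vt k j w)))"
  unfolding DVt_def Vt_def unfolding vl_alt v_loop_Suc(3) batch_v_eq zz_Suc zz_if[of k j] ..

section \<open>Which samples the iterates depend on\<close>

lemma smp_upd: "b \<noteq> b' \<Longrightarrow> smp (w((b', i) := c)) b = smp w b"
  by (auto simp: smp_def)

lemma st_upd: "k < stage b \<Longrightarrow> st k (w((b, i) := c)) = st k w"
proof -
  assume b: "k < stage b"
  have "als F G par x0 y0 v0 (smp (w((b, i) := c))) k = als F G par x0 y0 v0 (smp w) k"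
    by (rule als_cong[OF par_period], rule smp_upd) (use b in auto)
  moreover have "smp (w((b, i) := c)) (Init_x 0) = smp w (Init_x 0)"
    "smp (w((b, i) := c)) (Init_y 0) = smp w (Init_y 0)" "smp (w((b, i) := c)) (Init_v 0) = smp w (Init_v 0)"
    using b by (auto intro!: smp_upd)
  ultimately show ?thesis unfolding st_def by (simp cong: if_cong)
qed

lemma X_upd: "k < stage b \<Longrightarrow> X k (w((b, i) := c)) = X k w" by (simp add: X_def st_upd)

lemma X_Suc_upd: "k < stage b \<Longrightarrow> X (Suc k) (w((b, i) := c)) = X (Suc k) w"
  unfolding X_Suc DXt_0 unfolding X_def by (simp add: st_upd)

lemma xx_upd: "k < stage b \<Longrightarrow> xx k t (w((b, i) := c)) = xx k t w"
  by (simp add: xx_def X_upd X_Suc_upd)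

lemma yl_upd:
  assumes "k < stage b" "\<And>t'. t' < t \<Longrightarrow> b \<noteq> Inner_y k t'"
  shows "yl k t (w((b, i) := c)) = yl k t w"
  unfolding yl_def st_upd[OF assms(1)] X_upd[OF assms(1)]
  by (rule y_loop_cong, rule smp_upd) (use assms(2) in auto)

lemma zz_upd:
  assumes "k < stage b" "\<And>t'. b \<noteq> Inner_y k t'"
  shows "zz k j (w((b, i) := c)) = zz k j w"
  unfolding zz_def Yt_def using assms by (simp add: yl_upd X_upd X_Suc_upd)

lemma vl_upd:
  assumes "k < stage b" "\<And>t'. b \<noteq> Inner_y k t'" "\<And>j'. j' < j \<Longrightarrow> b \<noteq> Inner_x k j' \<and> b \<noteq> Inner_v k j'"
  shows "vl k j (w((b, i) := c)) = vl k j w"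
  unfolding vl_def st_upd[OF assms(1)] X_upd[OF assms(1)] yl_upd[OF assms(1,2)]
  by (rule v_loop_cong; rule smp_upd) (use assms(3) in auto)

lemma Vt_bound: "norm (Vt k j w) \<le> R"
proof -
  have cb: "closest_point (cball 0 R) v \<in> cball (0::real^'q) R" for v
    using R_nonneg by (intro closest_point_in_set) auto
  have "\<forall>j. norm (Vt k j w) \<le> R"
  proof (induction k)
    case 0
    show ?case
    proof
      fix j show "norm (Vt 0 j w) \<le> R"
        by (cases j) (use cb v0_ball in \<open>auto simp: Vt_Suc Vt_0 st_0\<close>)
    qed
  next
    case (Suc k)
    show ?case
    proof
      fix j show "norm (Vt (Suc k) j w) \<le> R"
        by (cases j) (use cb Suc in \<open>auto simp: Vt_Suc Vt_Suc_0\<close>)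
    qed
  qed
  then show ?thesis by blast
qed

text \<open>The random variables whose expectations enter \<open>one_iteration\<close>, each named \<open>q\<close> followed by its name
  there.\<close>

definition "qa k t w = (norm (Yt k t w - ystar (xx k t w)))\<^sup>2"
definition "qh k t w = (norm (mY (xx k t w, Yt k t w)))\<^sup>2"
definition "qey k t w = (norm (DYt k t w - mY (xx k t w, Yt k t w)))\<^sup>2"
definition "qD k w = (norm (DXt k 0 w))\<^sup>2"
definition "qb k j w = (norm (Vt k j w - vstar (xx k j w)))\<^sup>2"
definition "qh' k j w = (norm (mV (zstar (xx k j w), Vt k j w)))\<^sup>2"
definition "qex k j w = (norm (DXt k j w - mX (zz k j w, Vt k j w)))\<^sup>2"
definition "qev k j w = (norm (DVt k j w - mV (zz k j w, Vt k j w)))\<^sup>2"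
definition "qZ k w = (norm (zz k 1 w - zz k 0 w))\<^sup>2"
text \<open>The y-error seen by step j of the v-loop, which works with y_k at j = 0 and with the
  result of the y-loop afterwards.\<close>

definition "qp k (j::nat) w = (if j = 0 then qa k 0 w else qa k Ty w)"

lemma q_nonneg: "0 \<le> qa k t w" "0 \<le> qh k t w" "0 \<le> qey k t w" "0 \<le> qD k w" "0 \<le> qb k j w"
  "0 \<le> qh' k j w" "0 \<le> qex k j w" "0 \<le> qev k j w" "0 \<le> qZ k w" "0 \<le> qp k j w"
  by (simp_all add: qa_def qh_def qey_def qD_def qb_def qh'_def qex_def qev_def qZ_def qp_def)

section \<open>Pathwise estimates for single steps\<close>

lemma MM1_nonneg: "0 \<le> MM1" by (simp add: MM1_def)

lemma smu: "sy * \<mu> \<le> 1 / 4" "sv * \<mu> \<le> 1 / 4"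
proof -
  have "1 / (2 * Lg + 2 * \<mu>) * \<mu> \<le> 1 / 4" using mu mu_le_Lg by (simp add: field_simps)
  then show "sy * \<mu> \<le> 1 / 4" "sv * \<mu> \<le> 1 / 4"
    using mult_right_mono[OF sy(2), of \<mu>] mult_right_mono[OF sv(2), of \<mu>] mu by linarith+
qed

text \<open>The distance is taken to the minimizer at the old \<open>xx k t\<close>; the jump of x
  is accounted for separately in \<open>path_a\<close>.\<close>

lemma step_y_contract:
  "(norm (Yt k (Suc t) w - ystar (xx k t w)))\<^sup>2
    \<le> (1 - sy * \<mu> / 2) * qa k t w + 5 * sy / (2 * \<mu>) * qey k t w - sy * (1 / (Lg + \<mu>)) * qh k t w"
proof -
  let ?w = "Yt k t w - ystar (xx k t w)" and ?g = "mY (xx k t w, Yt k t w)"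
  have coc: "Lg * \<mu> * (norm ?w)\<^sup>2 + (norm ?g)\<^sup>2 \<le> (Lg + \<mu>) * (?g \<bullet> ?w)"
    using cocoercive[of "Yt k t w" "ystar (xx k t w)" "xx k t w"] by (simp add: mY_def dir_y_def grad_y_ystar)
  have eq: "Yt k (Suc t) w - ystar (xx k t w) = ?w - sy *\<^sub>R (?g + (DYt k t w - ?g))"
    by (simp add: Yt_Suc)
  show ?thesis unfolding eq
    using inexact_step_contraction[OF coc mu mu_le_Lg less_imp_le[OF sy(1)] sy(2), of "DYt k t w - ?g"]
    unfolding qa_def qey_def qh_def by simp
qed

lemma path_a:
  "qa k (Suc t) w \<le> (if t = 0 then 1 - sy * \<mu> / 4 else 1) * qa k t w + 3 * sy / \<mu> * qey k t w
    - sy * (1 / (Lg + \<mu>)) * qh k t w + (if t = 0 then al / 20 * qD k w else 0)"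
proof (cases "t = 0")
  case True
  define N where "N = (norm (Yt k 1 w - ystar (X k w)))\<^sup>2"
  have N: "N \<le> (1 - sy * \<mu> / 2) * qa k 0 w + 5 * sy / (2 * \<mu>) * qey k 0 w - sy * (1 / (Lg + \<mu>)) * qh k 0 w"
    using step_y_contract[of k 0 w] by (simp add: N_def xx_def)
  define V where "V = (norm (ystar (X k w) - ystar (X (Suc k) w)))\<^sup>2"
  have "norm (ystar (X k w) - ystar (X (Suc k) w)) \<le> Cy * (al * norm (DXt k 0 w))"
    using ystar_lip[of "X k w" "X (Suc k) w"] al by (simp add: X_Suc Cy_def)
  then have "V \<le> (Cy * (al * norm (DXt k 0 w)))\<^sup>2" unfolding V_def by (intro power_mono) auto
  then have V: "V \<le> Cy\<^sup>2 * (al\<^sup>2 * qD k w)" by (simp add: qD_def power_mult_distrib)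
  have "qa k 1 w \<le> (1 + sy * \<mu> / 4) * N + (1 + 1 / (sy * \<mu> / 4)) * V"
    using young_square[of "sy * \<mu> / 4" "Yt k 1 w - ystar (X k w)" "ystar (X k w) - ystar (X (Suc k) w)"] sy mu
    by (simp add: N_def V_def qa_def xx_def)
  also have "\<dots> \<le> (1 - sy * \<mu> / 4) * qa k 0 w + 3 * sy / \<mu> * qey k 0 w - sy * (1 / (Lg + \<mu>)) * qh k 0 w + 1 / 20 * al * qD k w"
    by (rule drift_bound[OF N V drift(1)])
       (use q_nonneg sy mu smu al const_nonneg in auto)
  finally show ?thesis using True by simp
next
  \<comment> \<open>After the first step x stands still. The contraction is relaxed to the factor 1
    here: one contraction per outer iteration carries the argument.\<close>
  case False
  then have xx: "xx k (Suc t) w = xx k t w" by (simp add: xx_def)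
  have "qa k (Suc t) w \<le> (1 - sy * \<mu> / 2) * qa k t w + 5 * sy / (2 * \<mu>) * qey k t w - sy * (1 / (Lg + \<mu>)) * qh k t w"
    using step_y_contract[of k t w] by (simp add: qa_def xx)
  moreover have "(1 - sy * \<mu> / 2) * qa k t w \<le> 1 * qa k t w"
    using q_nonneg sy mu by (intro mult_right_mono) auto
  moreover have "5 * sy / (2 * \<mu>) * qey k t w \<le> 3 * sy / \<mu> * qey k t w"
  proof (rule mult_right_mono)
    have "5 * sy / (2 * \<mu>) = 5 / 2 * (sy / \<mu>)" "3 * sy / \<mu> = 3 * (sy / \<mu>)" by simp_all
    moreover have "0 \<le> sy / \<mu>" using sy mu by simp
    ultimately show "5 * sy / (2 * \<mu>) \<le> 3 * sy / \<mu>" by linarith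
  qed (rule q_nonneg)
  ultimately show ?thesis unfolding if_not_P[OF False] by linarith
qed

lemma path_dy: "(norm (DYt k t w))\<^sup>2 \<le> 2 * (qh k t w + qey k t w)"
  using norm_add_square_le[of "mY (xx k t w, Yt k t w)" "DYt k t w - mY (xx k t w, Yt k t w)"]
  by (simp add: qh_def qey_def)

lemma path_Ydiff: "(norm (Yt k (Suc t) w - Yt k t w))\<^sup>2 \<le> 2 * sy\<^sup>2 * (qh k t w + qey k t w)"
proof -
  have "(norm (Yt k (Suc t) w - Yt k t w))\<^sup>2 = sy\<^sup>2 * (norm (DYt k t w))\<^sup>2"
    using sy by (simp add: Yt_Suc power_mult_distrib)
  also have "\<dots> \<le> sy\<^sup>2 * (2 * (qh k t w + qey k t w))" by (intro mult_left_mono path_dy) auto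
  finally show ?thesis by (simp only: mult.assoc mult.left_commute)
qed

lemma norm_prod_square: "(norm z)\<^sup>2 = (norm (fst z))\<^sup>2 + (norm (snd z))\<^sup>2"
  by (simp add: norm_prod_def)

lemma path_zy:
  "(norm ((xx k (Suc t) w, Yt k (Suc t) w) - (xx k t w, Yt k t w)))\<^sup>2
    \<le> 2 * sy\<^sup>2 * (qh k t w + qey k t w) + (if t = 0 then al\<^sup>2 * qD k w else 0)"
proof -
  have "(norm (xx k (Suc t) w - xx k t w))\<^sup>2 = (if t = 0 then al\<^sup>2 * qD k w else 0)"
    using al by (simp add: xx_def X_Suc qD_def power_mult_distrib)
  then show ?thesis using path_Ydiff[of k t w] unfolding norm_prod_square by simp
qed

text \<open>The movement of y telescopes over the loop, and Cauchy-Schwarz costs the factor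
  T.\<close>

lemma path_Z: "qZ k w \<le> al\<^sup>2 * qD k w + real Ty * (\<Sum>t<Ty. 2 * sy\<^sup>2 * (qh k t w + qey k t w))"
proof -
  have "Yt k Ty w - Yt k 0 w = (\<Sum>t<Ty. Yt k (Suc t) w - Yt k t w)"
    by (rule sum_lessThan_telescope[symmetric])
  then have "(norm (Yt k Ty w - Yt k 0 w))\<^sup>2 \<le> real Ty * (\<Sum>t<Ty. (norm (Yt k (Suc t) w - Yt k t w))\<^sup>2)"
    by (simp only: norm_sum_square_le)
  also have "\<dots> \<le> real Ty * (\<Sum>t<Ty. 2 * sy\<^sup>2 * (qh k t w + qey k t w))"
    by (intro mult_left_mono sum_mono path_Ydiff) auto
  finally have "(norm (Yt k Ty w - Yt k 0 w))\<^sup>2 \<le> real Ty * (\<Sum>t<Ty. 2 * sy\<^sup>2 * (qh k t w + qey k t w))" .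
  moreover have "(norm (X (Suc k) w - X k w))\<^sup>2 = al\<^sup>2 * qD k w"
    using al by (simp add: X_Suc qD_def power_mult_distrib)
  ultimately show ?thesis unfolding qZ_def norm_prod_square by (simp add: zz_def)
qed

lemma zz_dist: "norm (zz k j w - zstar (xx k j w)) = sqrt (qp k j w)"
  using sizes(3) by (simp add: zz_def zstar_def xx_def qp_def qa_def norm_Pair)

lemma mV_zstar: "mV (zstar x, v) = hess_yy g (zstar x) *v (v - vstar x)"
  by (simp add: mV_def dir_v_def vstar_def hess_vhat matrix_vector_mult_diff_distrib)

text \<open>The price of running the v-iteration at y instead of \<open>ystar\<close>. As v is the
  same at both points there is no v-term and one factor 2 is saved, whence M1 / 2.\<close>

lemma path_pert: "(norm (mV (zz k j w, Vt k j w) - mV (zstar (xx k j w), Vt k j w)))\<^sup>2 \<le> MM1 / 2 * qp k j w"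
proof -
  have "norm (mV (zz k j w, Vt k j w) - mV (zstar (xx k j w), Vt k j w)) \<le> (Lf + R * Lgyy) * sqrt (qp k j w)"
    using dir_v_lip[OF Vt_bound[of k j w], of "zz k j w" "Vt k j w" "zstar (xx k j w)"]
    by (simp add: mV_def zz_dist)
  also have "\<dots> \<le> (Lf + R * Lgg) * sqrt (qp k j w)"
    using R_nonneg q_nonneg by (intro mult_right_mono add_left_mono mult_left_mono) (auto simp: Lgg_def)
  finally have "(norm (mV (zz k j w, Vt k j w) - mV (zstar (xx k j w), Vt k j w)))\<^sup>2 \<le> ((Lf + R * Lgg) * sqrt (qp k j w))\<^sup>2"
    by (intro power_mono) auto
  also have "\<dots> = (Lf + R * Lgg)\<^sup>2 * qp k j w" using q_nonneg by (simp add: power_mult_distrib)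
  also have "\<dots> \<le> MM1 / 2 * qp k j w"
    using square_sum_le[of Lf "R * Lgg"] q_nonneg by (intro mult_right_mono) (auto simp: MM1_def power_mult_distrib)
  finally show ?thesis .
qed

lemma vstar_in_ball: "norm (vstar x) \<le> R" using vstar_bound radius by (rule order_trans)

lemma closest_point_ball_lipschitz: "norm (closest_point (cball 0 R) u - closest_point (cball 0 R) v) \<le> norm (u - v :: real^'q)"
  using closest_point_lipschitz[of "cball (0::real^'q) R" u v] R_nonneg by (simp add: dist_norm)

text \<open>\<open>vstar\<close> lies in the ball and is fixed by the nonexpansive projection, so
  projecting does not increase the distance to it. The rest is an inexact step for the exact system
  at \<open>zstar\<close>, with the y-error counted as gradient error.\<close>

lemma step_v_contract:
  "(norm (Vt k (Suc j) w - vstar (xx k j w)))\<^sup>2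
    \<le> (1 - sv * \<mu> / 2) * qb k j w + 5 * sv / (2 * \<mu>) * (2 * qev k j w + MM1 * qp k j w) - sv * (1 / (Lg + \<mu>)) * qh' k j w"
proof -
  let ?w = "Vt k j w - vstar (xx k j w)" and ?g = "mV (zstar (xx k j w), Vt k j w)"
  let ?e = "DVt k j w - ?g"
  have coc: "Lg * \<mu> * (norm ?w)\<^sup>2 + (norm ?g)\<^sup>2 \<le> (Lg + \<mu>) * (?g \<bullet> ?w)"
    unfolding mV_zstar by (rule hess_cocoercive)
  have cp: "closest_point (cball 0 R) (vstar (xx k j w)) = vstar (xx k j w)"
    using vstar_in_ball by (intro closest_point_self) auto
  have "norm (Vt k (Suc j) w - vstar (xx k j w)) \<le> norm (Vt k j w - sv *\<^sub>R DVt k j w - vstar (xx k j w))"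
    unfolding Vt_Suc by (subst cp[symmetric]) (rule closest_point_ball_lipschitz)
  also have "Vt k j w - sv *\<^sub>R DVt k j w - vstar (xx k j w) = ?w - sv *\<^sub>R (?g + ?e)" by simp
  finally have "(norm (Vt k (Suc j) w - vstar (xx k j w)))\<^sup>2 \<le> (norm (?w - sv *\<^sub>R (?g + ?e)))\<^sup>2"
    by (intro power_mono) auto
  also have "\<dots> \<le> (1 - sv * \<mu> / 2) * (norm ?w)\<^sup>2 + 5 * sv / (2 * \<mu>) * (norm ?e)\<^sup>2 - sv / (Lg + \<mu>) * (norm ?g)\<^sup>2"
    by (rule inexact_step_contraction[OF coc mu mu_le_Lg less_imp_le[OF sv(1)] sv(2)])
  also have "\<dots> \<le> (1 - sv * \<mu> / 2) * qb k j w + 5 * sv / (2 * \<mu>) * (2 * qev k j w + MM1 * qp k j w) - sv * (1 / (Lg + \<mu>)) * qh' k j w"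
  proof -
    have "(norm ?e)\<^sup>2 \<le> 2 * qev k j w + 2 * (norm (mV (zz k j w, Vt k j w) - ?g))\<^sup>2"
      using norm_add_square_le[of "DVt k j w - mV (zz k j w, Vt k j w)" "mV (zz k j w, Vt k j w) - ?g"] by (simp add: qev_def)
    also have "\<dots> \<le> 2 * qev k j w + MM1 * qp k j w" using path_pert[of k j w] by simp
    finally have "5 * sv / (2 * \<mu>) * (norm ?e)\<^sup>2 \<le> 5 * sv / (2 * \<mu>) * (2 * qev k j w + MM1 * qp k j w)"
      using sv mu by (intro mult_left_mono) auto
    then show ?thesis unfolding qb_def qh'_def by simp
  qed
  finally show ?thesis .
qed

lemma path_b:
  "qb k (Suc j) w \<le> (if j = 0 then 1 - sv * \<mu> / 4 else 1) * qb k j w + 3 * sv / \<mu> * (2 * qev k j w + MM1 * qp k j w)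
    - sv * (1 / (Lg + \<mu>)) * qh' k j w + (if j = 0 then al / 11 * qD k w else 0)"
proof (cases "j = 0")
  case True
  define N where "N = (norm (Vt k 1 w - vstar (X k w)))\<^sup>2"
  have N: "N \<le> (1 - sv * \<mu> / 2) * qb k 0 w + 5 * sv / (2 * \<mu>) * (2 * qev k 0 w + MM1 * qp k 0 w) - sv * (1 / (Lg + \<mu>)) * qh' k 0 w"
    using step_v_contract[of k 0 w] by (simp add: N_def xx_def)
  define V where "V = (norm (vstar (X k w) - vstar (X (Suc k) w)))\<^sup>2"
  have "norm (vstar (X k w) - vstar (X (Suc k) w)) \<le> Cv * (al * norm (DXt k 0 w))"
    using vstar_lip[of "X k w" "X (Suc k) w"] al by (simp add: X_Suc)
  then have "V \<le> (Cv * (al * norm (DXt k 0 w)))\<^sup>2" unfolding V_def by (intro power_mono) auto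
  then have V: "V \<le> Cv\<^sup>2 * (al\<^sup>2 * qD k w)" by (simp add: qD_def power_mult_distrib)
  have "qb k 1 w \<le> (1 + sv * \<mu> / 4) * N + (1 + 1 / (sv * \<mu> / 4)) * V"
    using young_square[of "sv * \<mu> / 4" "Vt k 1 w - vstar (X k w)" "vstar (X k w) - vstar (X (Suc k) w)"] sv mu
    by (simp add: N_def V_def qb_def xx_def)
  also have "\<dots> \<le> (1 - sv * \<mu> / 4) * qb k 0 w + 3 * sv / \<mu> * (2 * qev k 0 w + MM1 * qp k 0 w) - sv * (1 / (Lg + \<mu>)) * qh' k 0 w + 1 / 11 * al * qD k w"
    by (rule drift_bound[OF N V drift(2)])
       (use q_nonneg sv mu smu al const_nonneg MM1_nonneg in auto)
  finally show ?thesis using True by simp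
next
  case False
  then have xx: "xx k (Suc j) w = xx k j w" by (simp add: xx_def)
  let ?E = "2 * qev k j w + MM1 * qp k j w"
  have E: "0 \<le> ?E" using q_nonneg MM1_nonneg by simp
  have "qb k (Suc j) w \<le> (1 - sv * \<mu> / 2) * qb k j w + 5 * sv / (2 * \<mu>) * ?E - sv * (1 / (Lg + \<mu>)) * qh' k j w"
    using step_v_contract[of k j w] by (simp add: qb_def xx)
  moreover have "(1 - sv * \<mu> / 2) * qb k j w \<le> 1 * qb k j w"
    using q_nonneg sv mu by (intro mult_right_mono) auto
  moreover have "5 * sv / (2 * \<mu>) * ?E \<le> 3 * sv / \<mu> * ?E"
  proof (rule mult_right_mono)
    have "5 * sv / (2 * \<mu>) = 5 / 2 * (sv / \<mu>)" "3 * sv / \<mu> = 3 * (sv / \<mu>)" by simp_all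
    moreover have "0 \<le> sv / \<mu>" using sv mu by simp
    ultimately show "5 * sv / (2 * \<mu>) \<le> 3 * sv / \<mu>" by linarith
  qed (rule E)
  ultimately show ?thesis unfolding if_not_P[OF False] by linarith
qed

text \<open>The current iterate is fixed by the projection, so the projected step is no longer than
  the free one.\<close>

lemma path_dv: "(norm (Vt k (Suc j) w - Vt k j w))\<^sup>2 \<le> 3 * sv\<^sup>2 * (qh' k j w + qev k j w + MM1 / 2 * qp k j w)"
proof -
  let ?g = "mV (zstar (xx k j w), Vt k j w)"
  have cp: "closest_point (cball 0 R) (Vt k j w) = Vt k j w"
    using Vt_bound by (intro closest_point_self) auto
  have "norm (Vt k (Suc j) w - Vt k j w) \<le> norm (Vt k j w - sv *\<^sub>R DVt k j w - Vt k j w)"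
    unfolding Vt_Suc by (subst (2) cp[symmetric]) (rule closest_point_ball_lipschitz)
  also have "\<dots> = sv * norm (DVt k j w)" using sv by simp
  finally have "(norm (Vt k (Suc j) w - Vt k j w))\<^sup>2 \<le> (sv * norm (DVt k j w))\<^sup>2" by (intro power_mono) auto
  also have "\<dots> = sv\<^sup>2 * (norm (?g + (DVt k j w - mV (zz k j w, Vt k j w)) + (mV (zz k j w, Vt k j w) - ?g)))\<^sup>2"
    by (simp add: power_mult_distrib)
  also have "\<dots> \<le> sv\<^sup>2 * (3 * ((norm ?g)\<^sup>2 + (norm (DVt k j w - mV (zz k j w, Vt k j w)))\<^sup>2 + (norm (mV (zz k j w, Vt k j w) - ?g))\<^sup>2))"
    by (intro mult_left_mono norm_add3_square_le) auto
  also have "\<dots> \<le> sv\<^sup>2 * (3 * (qh' k j w + qev k j w + MM1 / 2 * qp k j w))"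
    using path_pert[of k j w] by (intro mult_left_mono add_mono) (auto simp: qh'_def qev_def)
  finally show ?thesis by (simp only: mult.assoc mult.left_commute)
qed

text \<open>A bound on the squared change of a sampled direction, common to x and v; its first
  summand is the joint jump of x and y, which the v-loop sees at j = 0 only.\<close>

definition "qrho k j w = (if j = 0 then MM1 * qZ k w else 0)
  + 2 * Lg\<^sup>2 * (3 * sv\<^sup>2 * (qh' k j w + qev k j w + MM1 / 2 * qp k j w))"

lemma path_rho:
  "MM1 * (norm (zz k (Suc j) w - zz k j w))\<^sup>2 + 2 * Lg\<^sup>2 * (norm (Vt k (Suc j) w - Vt k j w))\<^sup>2 \<le> qrho k j w"
proof -
  have "(norm (zz k (Suc j) w - zz k j w))\<^sup>2 = (if j = 0 then qZ k w else 0)"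
    by (cases "j = 0") (simp_all add: qZ_def zz_Suc zz_if[of k j] del: One_nat_def)
  moreover have "2 * Lg\<^sup>2 * (norm (Vt k (Suc j) w - Vt k j w))\<^sup>2 \<le> 2 * Lg\<^sup>2 * (3 * sv\<^sup>2 * (qh' k j w + qev k j w + MM1 / 2 * qp k j w))"
    by (intro mult_left_mono path_dv) auto
  moreover have "MM1 * (if j = 0 then qZ k w else 0) = (if j = 0 then MM1 * qZ k w else 0)" by simp
  ultimately show ?thesis unfolding qrho_def by (simp only: add_left_mono)
qed

abbreviation "Phi \<equiv> hyper_objective f g"

lemma path_Phi:
  "Phi (X (Suc k) w) \<le> Phi (X k w) - al / 2 * (norm (hypergrad (X k w)))\<^sup>2 - 5 * al / 12 * qD k w
    + al / 2 * (2 * qex k 0 w + 2 * MM1 * qa k 0 w + 4 * Lg\<^sup>2 * qb k 0 w)"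
proof -
  let ?G = "hypergrad (X k w)" and ?D = "DXt k 0 w"
  have "Phi (X (Suc k) w) \<le> Phi (X k w) + ?G \<bullet> (X (Suc k) w - X k w) + LPhi / 2 * (norm (X (Suc k) w - X k w))\<^sup>2"
    by (rule smooth_upper_bound[OF hyper_objective_GDERIV hypergrad_lip])
  also have "\<dots> = Phi (X k w) - al * (?G \<bullet> ?D) + LPhi / 2 * al\<^sup>2 * qD k w"
    by (simp add: X_Suc qD_def power_mult_distrib)
  \<comment> \<open>Polarization extracts the gains in |\<nabla>\<Phi>|^2 and in the squared
    direction, at the price of the squared error of the direction.\<close>
  also have "al * (?G \<bullet> ?D) = al / 2 * (norm ?G)\<^sup>2 + al / 2 * qD k w - al / 2 * (norm (?D - ?G))\<^sup>2"
    unfolding qD_def power2_norm_eq_inner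
    by (simp add: inner_diff_left inner_diff_right inner_commute algebra_simps)
  finally have 1: "Phi (X (Suc k) w) \<le> Phi (X k w) - (al / 2 * (norm ?G)\<^sup>2 + al / 2 * qD k w - al / 2 * (norm (?D - ?G))\<^sup>2)
    + LPhi / 2 * al\<^sup>2 * qD k w" .
  \<comment> \<open>By 6 L_Phi \<alpha> \<le> 1 the curvature takes 1/12 of the available 1/2, which
    leaves the coefficient 5/12.\<close>
  have 2: "LPhi / 2 * al\<^sup>2 * qD k w \<le> al / 12 * qD k w"
  proof (rule mult_right_mono)
    have "LPhi * al * al \<le> 1 / 6 * al" using al by (intro mult_right_mono) auto
    then show "LPhi / 2 * al\<^sup>2 \<le> al / 12" by (simp add: power2_eq_square mult_ac)
  qed (rule q_nonneg)
  have "(norm (?D - ?G))\<^sup>2 \<le> 2 * qex k 0 w + 2 * (norm (mX (zz k 0 w, Vt k 0 w) - ?G))\<^sup>2"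
    using norm_add_square_le[of "?D - mX (zz k 0 w, Vt k 0 w)" "mX (zz k 0 w, Vt k 0 w) - ?G"] by (simp add: qex_def)
  also have "(norm (mX (zz k 0 w, Vt k 0 w) - ?G))\<^sup>2 \<le> MM1 * qa k 0 w + 2 * Lg\<^sup>2 * qb k 0 w"
    using dir_x_sq_lip[OF vstar_in_ball, of "zz k 0 w" "Vt k 0 w" "zstar (X k w)" "X k w"] zz_dist[of k 0 w]
      q_nonneg(1)[of k 0 w]
    by (simp add: mX_def hypergrad_def MM1_def qb_def xx_def qp_def)
  finally have 3: "(norm (?D - ?G))\<^sup>2 \<le> 2 * qex k 0 w + 2 * MM1 * qa k 0 w + 4 * Lg\<^sup>2 * qb k 0 w" by simp
  have "al / 2 * (norm (?D - ?G))\<^sup>2 \<le> al / 2 * (2 * qex k 0 w + 2 * MM1 * qa k 0 w + 4 * Lg\<^sup>2 * qb k 0 w)"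
    using 3 al by (intro mult_left_mono) auto
  moreover have "al / 2 * qD k w = 5 * al / 12 * qD k w + al / 12 * qD k w" by (simp add: algebra_simps)
  ultimately show ?thesis using 1 2 by linarith
qed

end

section \<open>Expected descent\<close>

context als_setting
begin

abbreviation EE :: "((sample_set \<times> nat \<Rightarrow> 'a \<times> 'b) \<Rightarrow> real) \<Rightarrow> real" where "EE \<phi> \<equiv> (\<integral>w. \<phi> w \<partial>Om)"

text \<open>Transfers a pathwise linear bound to expectations and proves integrability at the same
  time. Bounds with fewer than six summands are padded with \<open>0 * 0\<close>.\<close>

lemma E_dom:
  fixes \<phi> f1 f2 f3 f4 f5 f6 :: "(sample_set \<times> nat \<Rightarrow> 'a \<times> 'b) \<Rightarrow> real"
  assumes m: "\<phi> \<in> borel_measurable Om"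
    and i: "integrable Om f1" "integrable Om f2" "integrable Om f3" "integrable Om f4" "integrable Om f5" "integrable Om f6"
    and lo: "\<And>w. L \<le> \<phi> w"
    and up: "\<And>w. \<phi> w \<le> c1 * f1 w + c2 * f2 w + c3 * f3 w + c4 * f4 w + c5 * f5 w + c6 * f6 w"
  shows "integrable Om \<phi>"
    and "EE \<phi> \<le> c1 * EE f1 + c2 * EE f2 + c3 * EE f3 + c4 * EE f4 + c5 * EE f5 + c6 * EE f6"
proof -
  let ?g = "\<lambda>w. c1 * f1 w + c2 * f2 w + c3 * f3 w + c4 * f4 w + c5 * f5 w + c6 * f6 w"
  have g: "integrable Om ?g" using i by simp
  show int: "integrable Om \<phi>"
  proof (rule Bochner_Integration.integrable_bound[of _ "\<lambda>w. \<bar>?g w\<bar> + \<bar>L\<bar>"])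
    show "integrable Om (\<lambda>w. \<bar>?g w\<bar> + \<bar>L\<bar>)" using g by simp
    show "AE w in Om. norm (\<phi> w) \<le> norm (\<bar>?g w\<bar> + \<bar>L\<bar>)"
    proof (rule AE_I2)
      fix w show "norm (\<phi> w) \<le> norm (\<bar>?g w\<bar> + \<bar>L\<bar>)"
        using lo[of w] up[of w] unfolding real_norm_def by arith
    qed
  qed (rule m)
  have "EE \<phi> \<le> EE ?g" by (rule integral_mono[OF int g up])
  then show "EE \<phi> \<le> c1 * EE f1 + c2 * EE f2 + c3 * EE f3 + c4 * EE f4 + c5 * EE f5 + c6 * EE f6"
    using i by simp
qed

lemma int0: "integrable Om (\<lambda>_. 0 :: real)" by simp

section \<open>Measurability of the tracked quantities\<close>

lemma base_measurable:
  "(\<lambda>w. X k w) \<in> borel_measurable Om" "(\<lambda>w. Yt k 0 w) \<in> borel_measurable Om" "(\<lambda>w. Vt k 0 w) \<in> borel_measurable Om"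
  "(\<lambda>w. DXt k 0 w) \<in> borel_measurable Om" "(\<lambda>w. DYt k 0 w) \<in> borel_measurable Om" "(\<lambda>w. DVt k 0 w) \<in> borel_measurable Om"
proof -
  have r: "0 \<le> radius par" using R_nonneg par_radius by simp
  have "(\<lambda>w. X k w) \<in> borel_measurable Om \<and> (\<lambda>w. Yt k 0 w) \<in> borel_measurable Om \<and> (\<lambda>w. Vt k 0 w) \<in> borel_measurable Om \<and>
    (\<lambda>w. DXt k 0 w) \<in> borel_measurable Om \<and> (\<lambda>w. DYt k 0 w) \<in> borel_measurable Om \<and> (\<lambda>w. DVt k 0 w) \<in> borel_measurable Om"
  proof (cases "k = 0")
    case True
    show ?thesis unfolding True X_def Yt_0 Vt_0 DXt_0 DYt_0 DVt_0 st_0 fst_conv snd_conv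
      by (intro conjI borel_measurable_const batch_x_measurable batch_y_measurable batch_v_measurable)
  next
    case False
    have "st k w = als F G par x0 y0 v0 (smp w) k" for w
      using False by (simp add: st_def case_prod_beta')
    then show ?thesis using als_measurable[OF r, of x0 y0 v0 k]
      unfolding X_def Yt_0 Vt_0 DXt_0 DYt_0 DVt_0 by (simp only:)
  qed
  then show "(\<lambda>w. X k w) \<in> borel_measurable Om" "(\<lambda>w. Yt k 0 w) \<in> borel_measurable Om" "(\<lambda>w. Vt k 0 w) \<in> borel_measurable Om"
    "(\<lambda>w. DXt k 0 w) \<in> borel_measurable Om" "(\<lambda>w. DYt k 0 w) \<in> borel_measurable Om" "(\<lambda>w. DVt k 0 w) \<in> borel_measurable Om"
    by blast+
qed

lemma Yt_DYt_measurable: "Yt k t \<in> borel_measurable Om" "DYt k t \<in> borel_measurable Om"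
proof -
  have "(\<lambda>w. fst (yl k t w)) \<in> borel_measurable Om \<and> (\<lambda>w. snd (yl k t w)) \<in> borel_measurable Om"
    unfolding yl_alt by (intro y_loop_measurable base_measurable)
  then show "Yt k t \<in> borel_measurable Om" "DYt k t \<in> borel_measurable Om"
    unfolding Yt_def[abs_def] DYt_def[abs_def] by blast+
qed

lemma xx_measurable: "xx k t \<in> borel_measurable Om"
  by (cases "t = 0") (simp_all add: xx_def[abs_def] base_measurable)

lemma zz_measurable: "zz k j \<in> borel_measurable Om"
  unfolding zz_def[abs_def]
  by (cases "j = 0") (simp_all only: if_True if_False simp_thms borel_measurable_Pair base_measurable Yt_DYt_measurable)

lemma Vt_measurable: "Vt k j \<in> borel_measurable Om" "DXt k j \<in> borel_measurable Om" "DVt k j \<in> borel_measurable Om"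
proof -
  have "(\<lambda>w. fst (vl k j w)) \<in> borel_measurable Om \<and> (\<lambda>w. fst (snd (vl k j w))) \<in> borel_measurable Om
      \<and> (\<lambda>w. snd (snd (vl k j w))) \<in> borel_measurable Om"
    unfolding vl_alt by (intro v_loop_measurable base_measurable zz_measurable) (use R_nonneg par_radius in simp)
  then show "Vt k j \<in> borel_measurable Om" "DXt k j \<in> borel_measurable Om" "DVt k j \<in> borel_measurable Om"
    unfolding Vt_def[abs_def] DXt_def[abs_def] DVt_def[abs_def] by blast+
qed

lemma lipschitz_measurable:
  fixes \<phi> :: "'x::euclidean_space \<Rightarrow> 'y::euclidean_space"
  assumes "\<And>x x'. norm (\<phi> x - \<phi> x') \<le> L * norm (x - x')" "0 \<le> L"
  shows "\<phi> \<in> borel_measurable borel"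
  by (rule borel_measurable_continuous_onI, rule lipschitz_on_continuous_on, rule lipschitz_onI)
     (use assms in \<open>auto simp: dist_norm\<close>)

lemma const_nonneg': "0 \<le> Lg / \<mu>" "0 \<le> Cv"
  using const_nonneg Lgg_nonneg mu unfolding Cv_def by (auto intro!: mult_nonneg_nonneg add_nonneg_nonneg)

lemma ystar_measurable: "ystar \<in> borel_measurable borel"
  by (rule lipschitz_measurable[OF ystar_lip const_nonneg'(1)])
lemma vstar_measurable: "vstar \<in> borel_measurable borel"
  by (rule lipschitz_measurable[OF vstar_lip const_nonneg'(2)])

lemmas process_measurable [measurable] =
  Yt_DYt_measurable xx_measurable zz_measurable Vt_measurable ystar_measurable vstar_measurable base_measurable(1)

lemma zstar_measurable[measurable]: "zstar \<in> borel_measurable borel"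
  unfolding zstar_def[abs_def] by (intro borel_measurable_Pair) simp_all

lemma hypergrad_measurable[measurable]: "hypergrad \<in> borel_measurable borel"
  by (rule borel_measurable_continuous_onI[OF hypergrad_continuous])

lemma Phi_measurable[measurable]: "Phi \<in> borel_measurable borel"
proof (rule borel_measurable_continuous_onI, rule continuous_at_imp_continuous_on, rule ballI)
  fix x show "isCont Phi x"
    using hyper_objective_GDERIV[of x] unfolding gderiv_def by (rule has_derivative_continuous)
qed

lemma q_measurable:
  "qa k t \<in> borel_measurable Om" "qh k t \<in> borel_measurable Om" "qey k t \<in> borel_measurable Om" "qD k \<in> borel_measurable Om"
  "qb k j \<in> borel_measurable Om" "qh' k j \<in> borel_measurable Om" "qex k j \<in> borel_measurable Om" "qev k j \<in> borel_measurable Om"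
  "qZ k \<in> borel_measurable Om"
proof -
  show "qa k t \<in> borel_measurable Om" unfolding qa_def[abs_def] by measurable
  show "qh k t \<in> borel_measurable Om" unfolding qh_def[abs_def] by measurable
  show "qey k t \<in> borel_measurable Om" unfolding qey_def[abs_def] by measurable
  show "qD k \<in> borel_measurable Om" unfolding qD_def[abs_def] by measurable
  show "qb k j \<in> borel_measurable Om" unfolding qb_def[abs_def] by measurable
  show "qh' k j \<in> borel_measurable Om" unfolding qh'_def[abs_def] by measurable
  show "qex k j \<in> borel_measurable Om" unfolding qex_def[abs_def] by measurable
  show "qev k j \<in> borel_measurable Om" unfolding qev_def[abs_def] by measurable
  show "qZ k \<in> borel_measurable Om" unfolding qZ_def[abs_def] by measurable
qed

lemma path_h: "qh k t w \<le> Lg\<^sup>2 * qa k t w"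
proof -
  have "norm (mY (xx k t w, Yt k t w)) \<le> Lg * norm (Yt k t w - ystar (xx k t w))"
    using grad_y_g_lip_y[of "xx k t w" "Yt k t w" "ystar (xx k t w)"] by (simp add: mY_def dir_y_def grad_y_ystar)
  then have "(norm (mY (xx k t w, Yt k t w)))\<^sup>2 \<le> (Lg * norm (Yt k t w - ystar (xx k t w)))\<^sup>2"
    by (intro power_mono) auto
  then show ?thesis by (simp add: qh_def qa_def power_mult_distrib)
qed

lemma path_h': "qh' k j w \<le> Lg\<^sup>2 * qb k j w"
proof -
  have "(norm (mV (zstar (xx k j w), Vt k j w)))\<^sup>2 \<le> (Lg * norm (Vt k j w - vstar (xx k j w)))\<^sup>2"
    unfolding mV_zstar by (intro power_mono hess_bound) auto
  then show ?thesis by (simp add: qh'_def qb_def power_mult_distrib)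
qed

text \<open>Both vectors lie in the ball, so b, unlike a, is bounded and hence integrable without
  induction.\<close>

lemma path_b_bound: "qb k j w \<le> (2 * R)\<^sup>2"
proof -
  have "norm (Vt k j w - vstar (xx k j w)) \<le> R + R"
    using norm_triangle_ineq4[of "Vt k j w" "vstar (xx k j w)"] Vt_bound[of k j w] vstar_in_ball[of "xx k j w"] by linarith
  then show ?thesis unfolding qb_def by (intro power_mono) auto
qed

lemma path_D: "qD k w \<le> 2 * qex k 0 w + 2 * (Cf + Lg * R)\<^sup>2"
proof -
  have "(norm (mX (zz k 0 w, Vt k 0 w)))\<^sup>2 \<le> (Cf + Lg * R)\<^sup>2"
    unfolding mX_def by (intro power_mono dir_x_bound) (auto simp: Vt_bound)
  then show ?thesis
    using norm_add_square_le[of "DXt k 0 w - mX (zz k 0 w, Vt k 0 w)" "mX (zz k 0 w, Vt k 0 w)"]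
    by (simp add: qD_def qex_def)
qed

lemma int_b: "integrable Om (qb k j)" "integrable Om (qh' k j)"
proof -
  show b: "integrable Om (qb k j)"
    by (rule O.integrable_const_bound[where B="(2 * R)\<^sup>2"])
       (use q_measurable path_b_bound q_nonneg in \<open>auto intro!: AE_I2\<close>)
  have le: "qh' k j w \<le> Lg\<^sup>2 * qb k j w + 0 * 0 + 0 * 0 + 0 * 0 + 0 * 0 + 0 * 0" for w
    using path_h' by simp
  show "integrable Om (qh' k j)"
    by (rule E_dom(1)[OF q_measurable(6) b int0 int0 int0 int0 int0 q_nonneg(6) le])
qed

text \<open>The induction invariant: integrability, at the start of an outer iteration, of the
  quantities with no a priori bound. All others are bounded or dominated by these.\<close>

definition "good k \<longleftrightarrow> integrable Om (qa k 0) \<and> integrable Om (qey k 0) \<and> integrable Om (qex k 0)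
  \<and> integrable Om (qev k 0) \<and> integrable Om (\<lambda>w. Phi (X k w))"

lemma goodD:
  assumes "good k"
  shows "integrable Om (qa k 0)" "integrable Om (qey k 0)" "integrable Om (qex k 0)" "integrable Om (qev k 0)"
    "integrable Om (\<lambda>w. Phi (X k w))"
  using assms by (auto simp: good_def)

lemma int_D:
  assumes "good k"
  shows "integrable Om (qD k)"
proof -
  have le: "qD k w \<le> 2 * qex k 0 w + (2 * (Cf + Lg * R)\<^sup>2) * 1 + 0 * 0 + 0 * 0 + 0 * 0 + 0 * 0" for w
    using path_D[of k w] by simp
  have one: "integrable Om (\<lambda>_. 1 :: real)" by simp
  show ?thesis
    by (rule E_dom(1)[OF q_measurable(4) goodD(3)[OF assms] one int0 int0 int0 int0 q_nonneg(4) le])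
qed

section \<open>Expected recursions of the y-loop\<close>

lemma E_a:
  assumes "integrable Om (qa k t)" "integrable Om (qey k t)" "integrable Om (qD k)"
  shows "integrable Om (qh k t)" "integrable Om (qa k (Suc t))"
    "EE (qa k (Suc t)) \<le> (if t = 0 then 1 - sy * \<mu> / 4 else 1) * EE (qa k t) + 3 * sy / \<mu> * EE (qey k t)
      - sy * (1 / (Lg + \<mu>)) * EE (qh k t) + (if t = 0 then al / 20 * EE (qD k) else 0)"
proof -
  have le: "qh k t w \<le> Lg\<^sup>2 * qa k t w + 0 * 0 + 0 * 0 + 0 * 0 + 0 * 0 + 0 * 0" for w
    using path_h by simp
  show h: "integrable Om (qh k t)"
    by (rule E_dom(1)[OF q_measurable(2) assms(1) int0 int0 int0 int0 int0 q_nonneg(2) le])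
  have le: "qa k (Suc t) w \<le> (if t = 0 then 1 - sy * \<mu> / 4 else 1) * qa k t w + (3 * sy / \<mu>) * qey k t w
    + (- (sy * (1 / (Lg + \<mu>)))) * qh k t w + (if t = 0 then al / 20 else 0) * qD k w + 0 * 0 + 0 * 0" for w
    using path_a[of k t w] by (cases "t = 0") simp_all
  note d = E_dom[OF q_measurable(1) assms(1,2) h assms(3) int0 int0 q_nonneg(1) le]
  show "integrable Om (qa k (Suc t))" by (rule d(1))
  show "EE (qa k (Suc t)) \<le> (if t = 0 then 1 - sy * \<mu> / 4 else 1) * EE (qa k t) + 3 * sy / \<mu> * EE (qey k t)
      - sy * (1 / (Lg + \<mu>)) * EE (qh k t) + (if t = 0 then al / 20 * EE (qD k) else 0)"
    using d(2) by (cases "t = 0") simp_all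
qed

lemma E_ey:
  assumes "integrable Om (qa k t)" "integrable Om (qey k t)" "integrable Om (qD k)"
  shows "integrable Om (qey k (Suc t))"
    "EE (qey k (Suc t)) \<le> (1 - mom_y par) * EE (qey k t) + 2 / real nb * ((mom_y par)\<^sup>2 * \<sigma>g\<^sup>2
        + Lg\<^sup>2 * (2 * sy\<^sup>2 * (EE (qh k t) + EE (qey k t)) + (if t = 0 then al\<^sup>2 * EE (qD k) else 0)))"
proof -
  note h = E_a(1)[OF assms]
  define \<rho> where "\<rho> w = Lg\<^sup>2 * (2 * sy\<^sup>2 * (qh k t w + qey k t w) + (if t = 0 then al\<^sup>2 else 0) * qD k w)" for w
  have \<rho>: "integrable Om \<rho>" unfolding \<rho>_def[abs_def] using h assms by simp
  have E\<rho>: "EE \<rho> = Lg\<^sup>2 * (2 * sy\<^sup>2 * (EE (qh k t) + EE (qey k t)) + (if t = 0 then al\<^sup>2 * EE (qD k) else 0))"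
    unfolding \<rho>_def[abs_def] using h assms by simp
  let ?b = "Inner_y k t"
  have b: "k < stage ?b" by simp
  have ylu: "yl k t (w((?b, i) := c)) = yl k t w" for w i c by (rule yl_upd) auto
  have U: "(\<lambda>w. (xx k t w, Yt k t w)) \<in> borel_measurable Om" "(\<lambda>w. (xx k (Suc t) w, Yt k (Suc t) w)) \<in> borel_measurable Om"
    by (intro borel_measurable_Pair process_measurable)+
  have lip: "(norm (SY c (xx k (Suc t) w, Yt k (Suc t) w) - SY c (xx k t w, Yt k t w)))\<^sup>2 \<le> \<rho> w"
    if "c \<in> space MM" for w c
  proof -
    have "(norm (SY c (xx k (Suc t) w, Yt k (Suc t) w) - SY c (xx k t w, Yt k t w)))\<^sup>2
        \<le> Lg\<^sup>2 * (norm ((xx k (Suc t) w, Yt k (Suc t) w) - (xx k t w, Yt k t w)))\<^sup>2"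
      by (rule SY_sq_lip[OF that])
    also have "\<dots> \<le> \<rho> w" unfolding \<rho>_def
    proof (rule mult_left_mono)
      show "(norm ((xx k (Suc t) w, Yt k (Suc t) w) - (xx k t w, Yt k t w)))\<^sup>2
          \<le> 2 * sy\<^sup>2 * (qh k t w + qey k t w) + (if t = 0 then al\<^sup>2 else 0) * qD k w"
        using path_zy[of k t w] by (cases "t = 0") simp_all
    qed simp
    finally show ?thesis .
  qed
  have e2: "integrable Om (\<lambda>w. (norm (DYt k t w - mY (xx k t w, Yt k t w)))\<^sup>2)"
    using assms(2) unfolding qey_def[abs_def] .
  \<comment> \<open>Both evaluation points are fixed before the batch \<open>Inner_y k t\<close> is
    drawn: the y-iterate t + 1 is computed from the estimator of step t, which uses earlier
    batches.\<close>
  have inv: "(xx k t (w((?b, i) := c)), Yt k t (w((?b, i) := c))) = (xx k t w, Yt k t w)"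
    "(xx k (Suc t) (w((?b, i) := c)), Yt k (Suc t) (w((?b, i) := c))) = (xx k (Suc t) w, Yt k (Suc t) w)"
    "DYt k t (w((?b, i) := c)) = DYt k t w" for w i c
    unfolding Yt_Suc xx_upd[OF b] unfolding Yt_def DYt_def ylu by (rule refl)+
  note s = momentum_step[OF sizes(2) oracle_SY U Yt_DYt_measurable(2) UNIV_I UNIV_I inv e2 lip \<rho> mom(3,4), folded DYt_Suc]
  show "integrable Om (qey k (Suc t))" unfolding qey_def[abs_def] by (rule s(1))
  show "EE (qey k (Suc t)) \<le> (1 - mom_y par) * EE (qey k t) + 2 / real nb * ((mom_y par)\<^sup>2 * \<sigma>g\<^sup>2
        + Lg\<^sup>2 * (2 * sy\<^sup>2 * (EE (qh k t) + EE (qey k t)) + (if t = 0 then al\<^sup>2 * EE (qD k) else 0)))"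
    using s(2) unfolding E\<rho> unfolding qey_def[abs_def] .
qed

lemma int_y:
  assumes "good k"
  shows "integrable Om (qa k t)" "integrable Om (qey k t)" "integrable Om (qh k t)"
proof -
  have "integrable Om (qa k t) \<and> integrable Om (qey k t)"
    by (induction t) (use goodD[OF assms] E_a(2) E_ey(1) int_D[OF assms] in auto)
  then show "integrable Om (qa k t)" "integrable Om (qey k t)" by auto
  then show "integrable Om (qh k t)" using E_a(1) int_D[OF assms] by blast
qed

lemma E_Z:
  assumes "good k"
  shows "integrable Om (qZ k)"
    "EE (qZ k) \<le> al\<^sup>2 * EE (qD k) + real Ty * (\<Sum>t<Ty. 2 * sy\<^sup>2 * (EE (qh k t) + EE (qey k t)))"
proof -
  define S where "S w = (\<Sum>t<Ty. 2 * sy\<^sup>2 * (qh k t w + qey k t w))" for w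
  have S: "integrable Om S" unfolding S_def[abs_def] using int_y[OF assms] by simp
  have ES: "EE S = (\<Sum>t<Ty. 2 * sy\<^sup>2 * (EE (qh k t) + EE (qey k t)))"
    unfolding S_def[abs_def] using int_y[OF assms] by (subst Bochner_Integration.integral_sum) auto
  have le: "qZ k w \<le> al\<^sup>2 * qD k w + real Ty * S w + 0 * 0 + 0 * 0 + 0 * 0 + 0 * 0" for w
    using path_Z[of k w] by (simp add: S_def)
  note d = E_dom[OF q_measurable(9) int_D[OF assms] S int0 int0 int0 int0 q_nonneg(9) le]
  show "integrable Om (qZ k)" by (rule d(1))
  show "EE (qZ k) \<le> al\<^sup>2 * EE (qD k) + real Ty * (\<Sum>t<Ty. 2 * sy\<^sup>2 * (EE (qh k t) + EE (qey k t)))"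
    using d(2) unfolding ES by simp
qed

section \<open>Expected recursions of the v-loop\<close>

lemma int_p: "good k \<Longrightarrow> integrable Om (qp k j)"
  unfolding qp_def[abs_def] using int_y(1) by (cases "j = 0") simp_all

lemma E_p: "EE (qp k j) = (if j = 0 then EE (qa k 0) else EE (qa k Ty))"
  by (simp add: qp_def[abs_def])

lemma E_b:
  assumes "good k" "integrable Om (qev k j)"
  shows "EE (qb k (Suc j)) \<le> (if j = 0 then 1 - sv * \<mu> / 4 else 1) * EE (qb k j)
      + 3 * sv / \<mu> * (2 * EE (qev k j) + MM1 * (if j = 0 then EE (qa k 0) else EE (qa k Ty)))
      - sv * (1 / (Lg + \<mu>)) * EE (qh' k j) + (if j = 0 then al / 11 * EE (qD k) else 0)"
proof -
  have le: "qb k (Suc j) w \<le> (if j = 0 then 1 - sv * \<mu> / 4 else 1) * qb k j w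
    + (3 * sv / \<mu> * 2) * qev k j w + (3 * sv / \<mu> * MM1) * qp k j w
    + (- (sv * (1 / (Lg + \<mu>)))) * qh' k j w + (if j = 0 then al / 11 else 0) * qD k w + 0 * 0" for w
  proof -
    have "3 * sv / \<mu> * (2 * qev k j w + MM1 * qp k j w) = (3 * sv / \<mu> * 2) * qev k j w + (3 * sv / \<mu> * MM1) * qp k j w"
      by (simp only: distrib_left mult.assoc)
    then show ?thesis using path_b[of k j w] by (cases "j = 0") simp_all
  qed
  note d = E_dom(2)[OF q_measurable(5) int_b(1) assms(2) int_p[OF assms(1)] int_b(2) int_D[OF assms(1)] int0 q_nonneg(5) le]
  have "3 * sv / \<mu> * (2 * EE (qev k j) + MM1 * EE (qp k j)) = (3 * sv / \<mu> * 2) * EE (qev k j) + (3 * sv / \<mu> * MM1) * EE (qp k j)"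
    by (simp only: distrib_left mult.assoc)
  then show ?thesis unfolding E_p[symmetric] using d by (cases "j = 0") simp_all
qed

lemma int_rho:
  assumes "good k" "integrable Om (qev k j)"
  shows "integrable Om (qrho k j)"
    "EE (qrho k j) = (if j = 0 then MM1 * EE (qZ k) else 0)
      + 2 * Lg\<^sup>2 * (3 * sv\<^sup>2 * (EE (qh' k j) + EE (qev k j) + MM1 / 2 * (if j = 0 then EE (qa k 0) else EE (qa k Ty))))"
proof -
  have i: "integrable Om (\<lambda>w. 2 * Lg\<^sup>2 * (3 * sv\<^sup>2 * (qh' k j w + qev k j w + MM1 / 2 * qp k j w)))"
    by (intro integrable_mult_right Bochner_Integration.integrable_add int_b(2) assms(2) int_p[OF assms(1)])
  have e: "EE (\<lambda>w. 2 * Lg\<^sup>2 * (3 * sv\<^sup>2 * (qh' k j w + qev k j w + MM1 / 2 * qp k j w)))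
      = 2 * Lg\<^sup>2 * (3 * sv\<^sup>2 * (EE (qh' k j) + EE (qev k j) + MM1 / 2 * EE (qp k j)))"
    using int_b(2)[of k j] assms(2) int_p[OF assms(1), of j] by simp
  have z: "integrable Om (\<lambda>w. if j = 0 then MM1 * qZ k w else 0)"
    using E_Z(1)[OF assms(1)] by (cases "j = 0") simp_all
  have ez: "EE (\<lambda>w. if j = 0 then MM1 * qZ k w else 0) = (if j = 0 then MM1 * EE (qZ k) else 0)"
    by (cases "j = 0") simp_all
  show "integrable Om (qrho k j)" unfolding qrho_def[abs_def] by (rule Bochner_Integration.integrable_add[OF z i])
  show "EE (qrho k j) = (if j = 0 then MM1 * EE (qZ k) else 0)
      + 2 * Lg\<^sup>2 * (3 * sv\<^sup>2 * (EE (qh' k j) + EE (qev k j) + MM1 / 2 * (if j = 0 then EE (qa k 0) else EE (qa k Ty))))"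
    unfolding qrho_def[abs_def] Bochner_Integration.integral_add[OF z i] e ez E_p ..
qed

lemma E_exv:
  assumes "good k" "integrable Om (qex k j)" "integrable Om (qev k j)"
  shows "integrable Om (qex k (Suc j))" "integrable Om (qev k (Suc j))"
    "EE (qex k (Suc j)) \<le> (1 - mom_x par) * EE (qex k j) + 2 / real nb * ((mom_x par)\<^sup>2 * var_x + EE (qrho k j))"
    "EE (qev k (Suc j)) \<le> (1 - mom_v par) * EE (qev k j) + 2 / real nb * ((mom_v par)\<^sup>2 * var_v + EE (qrho k j))"
proof -
  note \<rho> = int_rho(1)[OF assms(1,3)]
  have U: "(\<lambda>w. (zz k j w, Vt k j w)) \<in> borel_measurable Om" "(\<lambda>w. (zz k (Suc j) w, Vt k (Suc j) w)) \<in> borel_measurable Om"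
    by (intro borel_measurable_Pair process_measurable)+
  have VS: "(zz k j w, Vt k j w) \<in> VS" for j w by (simp add: VS_def Vt_bound)
  have lipx: "(norm (SX c (zz k (Suc j) w, Vt k (Suc j) w) - SX c (zz k j w, Vt k j w)))\<^sup>2 \<le> qrho k j w"
    and lipv: "(norm (SV c (zz k (Suc j) w, Vt k (Suc j) w) - SV c (zz k j w, Vt k j w)))\<^sup>2 \<le> qrho k j w"
    if "c \<in> space MM" for c w
    using SX_sq_lip[OF that, of "(zz k j w, Vt k j w)" "(zz k (Suc j) w, Vt k (Suc j) w)"]
      SV_sq_lip[OF that, of "(zz k j w, Vt k j w)" "(zz k (Suc j) w, Vt k (Suc j) w)"] path_rho[of k j w] Vt_bound[of k j w]
    by simp_all
  \<comment> \<open>The y-loop is finished before the v-loop starts, and the v-iterate j + 1 uses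
    the estimator of step j; so both evaluation points ignore the current batch.\<close>
  have vlu: "vl k j (w((Inner_x k j, i) := c)) = vl k j w" "vl k j (w((Inner_v k j, i) := c)) = vl k j w" for w i c
    by (rule vl_upd; auto)+
  have zzu: "zz k j' (w((Inner_x k j, i) := c)) = zz k j' w" "zz k j' (w((Inner_v k j, i) := c)) = zz k j' w" for w i c j'
    by (rule zz_upd; simp)+
  have e2: "integrable Om (\<lambda>w. (norm (DXt k j w - mX (zz k j w, Vt k j w)))\<^sup>2)"
    "integrable Om (\<lambda>w. (norm (DVt k j w - mV (zz k j w, Vt k j w)))\<^sup>2)"
    using assms(2,3) unfolding qex_def[abs_def] qev_def[abs_def] .
  let ?b = "Inner_x k j"
  have inv: "(zz k j (w((?b, i) := c)), Vt k j (w((?b, i) := c))) = (zz k j w, Vt k j w)"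
    "(zz k (Suc j) (w((?b, i) := c)), Vt k (Suc j) (w((?b, i) := c))) = (zz k (Suc j) w, Vt k (Suc j) w)"
    "DXt k j (w((?b, i) := c)) = DXt k j w" for w i c
    unfolding Vt_Suc zzu unfolding Vt_def DVt_def DXt_def vlu by (rule refl)+
  note s = momentum_step[OF sizes(2) oracle_SX U Vt_measurable(2) VS VS inv e2(1) lipx \<rho> mom(1,2), folded DXt_Suc]
  show "integrable Om (qex k (Suc j))" unfolding qex_def[abs_def] by (rule s(1))
  show "EE (qex k (Suc j)) \<le> (1 - mom_x par) * EE (qex k j) + 2 / real nb * ((mom_x par)\<^sup>2 * var_x + EE (qrho k j))"
    using s(2) unfolding qex_def[abs_def] .
  let ?b = "Inner_v k j"
  have inv: "(zz k j (w((?b, i) := c)), Vt k j (w((?b, i) := c))) = (zz k j w, Vt k j w)"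
    "(zz k (Suc j) (w((?b, i) := c)), Vt k (Suc j) (w((?b, i) := c))) = (zz k (Suc j) w, Vt k (Suc j) w)"
    "DVt k j (w((?b, i) := c)) = DVt k j w" for w i c
    unfolding Vt_Suc zzu unfolding Vt_def DVt_def vlu by (rule refl)+
  note s = momentum_step[OF sizes(2) oracle_SV U Vt_measurable(3) VS VS inv e2(2) lipv \<rho> mom(5,6), folded DVt_Suc]
  show "integrable Om (qev k (Suc j))" unfolding qev_def[abs_def] by (rule s(1))
  show "EE (qev k (Suc j)) \<le> (1 - mom_v par) * EE (qev k j) + 2 / real nb * ((mom_v par)\<^sup>2 * var_v + EE (qrho k j))"
    using s(2) unfolding qev_def[abs_def] .
qed

lemma int_v:
  assumes "good k"
  shows "integrable Om (qex k j)" "integrable Om (qev k j)"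
proof -
  have "integrable Om (qex k j) \<and> integrable Om (qev k j)"
    by (induction j) (use goodD[OF assms] E_exv(1,2)[OF assms] in auto)
  then show "integrable Om (qex k j)" "integrable Om (qev k j)" by auto
qed

definition "qG k w = (norm (hypergrad (X k w)))\<^sup>2"

lemma int_G: "integrable Om (qG k)"
proof (rule O.integrable_const_bound)
  show "qG k \<in> borel_measurable Om" unfolding qG_def[abs_def] by measurable
  show "AE w in Om. norm (qG k w) \<le> (Cf + Lg * (Cf / \<mu>))\<^sup>2"
  proof (rule AE_I2)
    fix w show "norm (qG k w) \<le> (Cf + Lg * (Cf / \<mu>))\<^sup>2"
      using power_mono[OF hypergrad_bound[of "X k w"] norm_ge_zero, of 2] by (simp add: qG_def)
  qed
qed

text \<open>\<Phi> is bounded below by hypothesis; integrability from above is supplied by the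
  descent inequality itself.\<close>

lemma E_Phi:
  assumes "good k"
  shows "integrable Om (\<lambda>w. Phi (X (Suc k) w))"
    "EE (\<lambda>w. Phi (X (Suc k) w)) \<le> EE (\<lambda>w. Phi (X k w)) - al / 2 * EE (qG k) - 5 * al / 12 * EE (qD k)
      + al / 2 * (2 * EE (qex k 0) + 2 * MM1 * EE (qa k 0) + 4 * Lg\<^sup>2 * EE (qb k 0))"
proof -
  obtain L where L: "\<And>x. L \<le> Phi x" using bdd unfolding bdd_below_def by auto
  have split: "al / 2 * (2 * x + 2 * MM1 * y + 4 * Lg\<^sup>2 * z) = al * x + (al * MM1) * y + (2 * al * Lg\<^sup>2) * z" for x y z
    by (simp add: algebra_simps)
  have le: "Phi (X (Suc k) w) \<le> 1 * Phi (X k w) + (- (al / 2)) * qG k w + (- (5 * al / 12)) * qD k w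
      + al * qex k 0 w + (al * MM1) * qa k 0 w + (2 * al * Lg\<^sup>2) * qb k 0 w" for w
    using path_Phi[of k w] unfolding split qG_def by simp
  have m: "(\<lambda>w. Phi (X (Suc k) w)) \<in> borel_measurable Om" by measurable
  note d = E_dom[OF m goodD(5)[OF assms] int_G int_D[OF assms] goodD(3,1)[OF assms] int_b(1) L le]
  show "integrable Om (\<lambda>w. Phi (X (Suc k) w))" by (rule d(1))
  show "EE (\<lambda>w. Phi (X (Suc k) w)) \<le> EE (\<lambda>w. Phi (X k w)) - al / 2 * EE (qG k) - 5 * al / 12 * EE (qD k)
      + al / 2 * (2 * EE (qex k 0) + 2 * MM1 * EE (qa k 0) + 4 * Lg\<^sup>2 * EE (qb k 0))"
    using d(2) unfolding split by simp
qed

text \<open>As T and J are positive, the last inner values already refer to the new x and are the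
  first values of the next outer iteration; this makes the Lyapunov function telescope.\<close>

lemma q_Suc_0:
  "qa (Suc k) 0 = qa k Ty" "qey (Suc k) 0 = qey k Ty" "qb (Suc k) 0 = qb k Jv" "qex (Suc k) 0 = qex k Jv" "qev (Suc k) 0 = qev k Jv"
  using sizes(3,4)
  by (auto simp: fun_eq_iff qa_def qey_def qb_def qex_def qev_def xx_def zz_def Yt_Suc_0 DYt_Suc_0 Vt_Suc_0 DXt_Suc_0 DVt_Suc_0)

lemma good_Suc: "good k \<Longrightarrow> good (Suc k)"
  unfolding good_def[of "Suc k"] q_Suc_0 using int_y int_v E_Phi(1) by blast

lemma init_errors:
  "integrable Om (qey 0 0)" "integrable Om (qex 0 0)" "integrable Om (qev 0 0)"
  "EE (qey 0 0) \<le> \<sigma>g\<^sup>2 / real (batch_init par)" "EE (qex 0 0) \<le> var_x / real (batch_init par)"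
  "EE (qev 0 0) \<le> var_v / real (batch_init par)"
proof -
  have u: "((x0, y0), v0) \<in> VS" using v0_ball by (simp add: VS_def)
  have y: "qey 0 0 = (\<lambda>w. (norm (batch_mean (batch_init par) (\<lambda>i. SY (w (Init_y 0, i)) (x0, y0)) - mY (x0, y0)))\<^sup>2)"
    by (simp add: fun_eq_iff qey_def xx_def X_def Yt_0 DYt_0 st_0 batch_y_eq)
  have x: "qex 0 0 = (\<lambda>w. (norm (batch_mean (batch_init par) (\<lambda>i. SX (w (Init_x 0, i)) ((x0, y0), v0)) - mX ((x0, y0), v0)))\<^sup>2)"
    by (simp add: fun_eq_iff qex_def zz_def X_def Yt_0 Vt_0 DXt_0 st_0 batch_x_eq)
  have v: "qev 0 0 = (\<lambda>w. (norm (batch_mean (batch_init par) (\<lambda>i. SV (w (Init_v 0, i)) ((x0, y0), v0)) - mV ((x0, y0), v0)))\<^sup>2)"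
    by (simp add: fun_eq_iff qev_def zz_def X_def Yt_0 Vt_0 DVt_0 st_0 batch_v_eq)
  show "integrable Om (qey 0 0)" "EE (qey 0 0) \<le> \<sigma>g\<^sup>2 / real (batch_init par)"
    unfolding y by (rule batch_mean_error[OF sizes(1) oracle_SY UNIV_I])+
  show "integrable Om (qex 0 0)" "EE (qex 0 0) \<le> var_x / real (batch_init par)"
    unfolding x by (rule batch_mean_error[OF sizes(1) oracle_SX u])+
  show "integrable Om (qev 0 0)" "EE (qev 0 0) \<le> var_v / real (batch_init par)"
    unfolding v by (rule batch_mean_error[OF sizes(1) oracle_SV u])+
qed

lemma X_0: "X 0 w = x0" by (simp add: X_def st_0)

lemma init_consts: "qa 0 0 w = (norm (y0 - ystar x0))\<^sup>2" "qb 0 0 w = (norm (v0 - vstar x0))\<^sup>2"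
  by (simp_all add: qa_def qb_def xx_def X_0 Yt_0 Vt_0 st_0)

lemma good: "good k"
proof (induction k)
  case 0
  show ?case unfolding good_def using init_errors by (simp add: X_0 init_consts[abs_def])
qed (rule good_Suc)

end

section \<open>Stationarity of the output\<close>

context als_setting
begin

text \<open>Telescopes \<open>one_iteration\<close> over K outer iterations; \<Phi> \<ge> L bounds
  the final value from below, and the first batch damps the initial estimator errors.\<close>

lemma average_gradient_bound:
  assumes lw: "lyapunov_weights \<mu> Lg MM1 Cy Cv al sy sv lam1 lam2 Cb Ce w q (mom_x par) (mom_y par) (mom_v par) C7 Ty Jv nb"
    and L: "\<And>x. L \<le> Phi x"
  shows "al / 2 * (\<Sum>k<K. EE (qG k))
    \<le> Phi x0 - L + (norm (y0 - ystar x0))\<^sup>2 + (2 * R)\<^sup>2 + w * ((var_x + \<sigma>g\<^sup>2 + var_v) / real (batch_init par))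
      + real K * (q * (real Jv * ((mom_x par)\<^sup>2 * var_x) + real Ty * ((mom_y par)\<^sup>2 * \<sigma>g\<^sup>2) + real Jv * ((mom_v par)\<^sup>2 * var_v)))"
proof -
  interpret W: lyapunov_weights \<mu> Lg MM1 Cy Cv al sy sv lam1 lam2 Cb Ce w q "mom_x par" "mom_y par" "mom_v par" C7 Ty Jv nb
    by (rule lw)
  define N where "N = q * (real Jv * ((mom_x par)\<^sup>2 * var_x) + real Ty * ((mom_y par)\<^sup>2 * \<sigma>g\<^sup>2) + real Jv * ((mom_v par)\<^sup>2 * var_v))"
  define V where "V k = EE (\<lambda>u. Phi (X k u)) + EE (qa k 0) + EE (qb k 0) + w * (EE (qex k 0) + EE (qey k 0) + EE (qev k 0))" for k
  have nn: "0 \<le> EE (qa k t)" "0 \<le> EE (qh k t)" "0 \<le> EE (qey k t)" "0 \<le> EE (qb k t)" "0 \<le> EE (qh' k t)"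
      "0 \<le> EE (qev k t)" "0 \<le> EE (qex k t)" "0 \<le> EE (qD k)" for k t
    by (intro Bochner_Integration.integral_nonneg q_nonneg)+
  have step: "V (Suc k) + al / 2 * EE (qG k) \<le> V k + N" for k
  proof -
    note g = good[of k]
    note rho = int_rho(2)[OF g int_v(2)[OF g]]
    show ?thesis unfolding V_def q_Suc_0 N_def
      by (rule W.one_iteration[where a = "\<lambda>t. EE (qa k t)" and h = "\<lambda>t. EE (qh k t)" and h' = "\<lambda>j. EE (qh' k j)"
          and ex = "\<lambda>j. EE (qex k j)" and b = "\<lambda>j. EE (qb k j)" and ev = "\<lambda>j. EE (qev k j)" and ey = "\<lambda>t. EE (qey k t)"
          and \<Delta> = "EE (qD k)" and Z = "EE (qZ k)",
          OF nn E_Phi(2)[OF g] E_a(3)[OF int_y(1)[OF g] int_y(2)[OF g] int_D[OF g], folded W.r_def]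
            E_ey(2)[OF int_y(1)[OF g] int_y(2)[OF g] int_D[OF g]] E_Z(2)[OF g]
            E_b[OF g int_v(2)[OF g], folded W.r_def]
            E_exv(3)[OF g int_v(1)[OF g] int_v(2)[OF g], unfolded rho add.assoc[symmetric]]
            E_exv(4)[OF g int_v(1)[OF g] int_v(2)[OF g], unfolded rho add.assoc[symmetric]]])
  qed
  have sum: "V K + al / 2 * (\<Sum>k<K. EE (qG k)) \<le> V 0 + real K * N"
  proof (induction K)
    case (Suc K)
    then show ?case using step[of K] by (simp add: algebra_simps)
  qed simp
  have "L \<le> EE (\<lambda>u. Phi (X K u))"
    using integral_mono[OF _ goodD(5)[OF good], of "\<lambda>_. L" K] L by (simp add: O.prob_space)
  moreover have "0 \<le> w * (EE (qex K 0) + EE (qey K 0) + EE (qev K 0))" using nn W.q_pos by simp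
  ultimately have lo: "L \<le> V K" unfolding V_def using nn(1)[of K 0] nn(4)[of K 0] by linarith
  have "EE (qa 0 0) = (norm (y0 - ystar x0))\<^sup>2" by (simp add: init_consts[abs_def] O.prob_space)
  moreover have "EE (qb 0 0) \<le> (2 * R)\<^sup>2"
    using integral_mono[OF int_b(1), of "\<lambda>_. (2 * R)\<^sup>2" 0 0] path_b_bound by (simp add: O.prob_space)
  moreover have "EE (\<lambda>u. Phi (X 0 u)) = Phi x0" by (simp add: X_0 O.prob_space)
  moreover have "w * (EE (qex 0 0) + EE (qey 0 0) + EE (qev 0 0)) \<le> w * ((var_x + \<sigma>g\<^sup>2 + var_v) / real (batch_init par))"
    using init_errors(4-6) W.q_pos by (intro mult_left_mono) (auto simp: add_divide_distrib)
  ultimately have "V 0 \<le> Phi x0 + (norm (y0 - ystar x0))\<^sup>2 + (2 * R)\<^sup>2 + w * ((var_x + \<sigma>g\<^sup>2 + var_v) / real (batch_init par))"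
    unfolding V_def by linarith
  then show ?thesis using sum lo unfolding N_def by linarith
qed

end

section \<open>From period 0 to period K\<close>

lemma y_loop_period: "y_loop G (par\<lparr>period := p\<rparr>) s k xk xk1 y d t = y_loop G par s k xk xk1 y d t"
  by (induction t) (simp_all add: Let_def)

lemma v_loop_period: "v_loop F G (par\<lparr>period := p\<rparr>) s k zk zk1 v dx dv j = v_loop F G par s k zk zk1 v dx dv j"
  by (induction j) (simp_all add: Let_def)

text \<open>Period \<open>K\<close> and period \<open>0\<close> both mean that only iteration \<open>0\<close> among the first \<open>K\<close> initialises.\<close>

lemma als_period:
  assumes "k \<le> K" "0 < K" "period par = K"
  shows "als F G (par\<lparr>period := 0\<rparr>) x0 y0 v0 s k = als F G par x0 y0 v0 s k"
  using assms(1)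
proof (induction k)
  case (Suc k)
  then have IH: "als F G (par\<lparr>period := 0\<rparr>) x0 y0 v0 s k = als F G par x0 y0 v0 s k" and k: "k < K" by auto
  then have "k mod period par = 0 \<longleftrightarrow> k = 0" using assms by simp
  then show ?case by (simp add: Let_def IH y_loop_period v_loop_period cong: if_cong)
qed simp

context als_base
begin

lemma als_x_measurable:
  assumes "0 \<le> radius par"
  shows "(\<lambda>p. als_x F G par x0 y0 v0 (smp (snd p)) (fst p)) \<in> borel_measurable (measure_pmf \<pi> \<Otimes>\<^sub>M Om)"
proof (rule measurable_compose_countable[where f="\<lambda>k p. als_x F G par x0 y0 v0 (smp (snd p)) k" and g=fst])
  show "fst \<in> measurable (measure_pmf \<pi> \<Otimes>\<^sub>M Om) (count_space UNIV)"
    using measurable_fst[of "measure_pmf \<pi>" Om] by (simp cong: measurable_cong_sets)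
  show "(\<lambda>p. als_x F G par x0 y0 v0 (smp (snd p)) k) \<in> borel_measurable (measure_pmf \<pi> \<Otimes>\<^sub>M Om)" for k
    unfolding als_x_def
    by (rule measurable_compose[OF measurable_snd conjunct1[OF als_measurable[OF assms]]])
qed

text \<open>Under the product law of index and samples, Fubini turns the expectation at the random
  index into the average over k < K.\<close>

lemma output_stationary:
  assumes K: "0 < K" and r: "0 \<le> radius par" and rand: "als_randomness P Mxi Mzeta Z K \<kappa>"
    and bound: "(\<Sum>k<K. \<integral>w. (norm (hypergrad (als_x F G par x0 y0 v0 (smp w) k)))\<^sup>2 \<partial>Om) / real K \<le> \<epsilon>"
  shows "eps_stationary P (hyper_objective f g) \<epsilon> (als_output F G par x0 y0 v0 Z \<kappa>)"
proof -
  define \<pi> where "\<pi> = pmf_of_set {0..<K}"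
  define Q where "Q = (\<lambda>\<omega>. (\<kappa> \<omega>, \<lambda>i. Z i \<omega>))"
  have P: "prob_space P" and Q: "Q \<in> measurable P (measure_pmf \<pi> \<Otimes>\<^sub>M Om)"
    and dQ: "distr P (measure_pmf \<pi> \<Otimes>\<^sub>M Om) Q = measure_pmf \<pi> \<Otimes>\<^sub>M Om"
    using rand unfolding als_randomness_def Let_def Q_def \<pi>_def \<Omega>_def by auto
  define A where "A p = als_x F G par x0 y0 v0 (smp (snd p)) (fst p)" for p
  have A: "A \<in> borel_measurable (measure_pmf \<pi> \<Otimes>\<^sub>M Om)"
    unfolding A_def[abs_def] by (rule als_x_measurable[OF r])
  have out: "als_output F G par x0 y0 v0 Z \<kappa> = (\<lambda>\<omega>. A (Q \<omega>))"
    unfolding als_output_def[abs_def] A_def Q_def smp_def[abs_def] by simp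
  define \<phi> where "\<phi> p = (norm (hypergrad (A p)))\<^sup>2" for p
  have hm: "hypergrad \<in> borel_measurable borel"
    by (rule borel_measurable_continuous_onI[OF hypergrad_continuous])
  have \<phi>: "\<phi> \<in> borel_measurable (measure_pmf \<pi> \<Otimes>\<^sub>M Om)"
    unfolding \<phi>_def[abs_def] using measurable_compose[OF A hm] by simp
  have le: "norm (\<phi> p) \<le> (Cf + Lg * (Cf / \<mu>))\<^sup>2" for p
    using power_mono[OF hypergrad_bound[of "A p"] norm_ge_zero, of 2] by (simp add: \<phi>_def)
  interpret PN: prob_space "measure_pmf \<pi> \<Otimes>\<^sub>M Om"
    by (intro prob_space_pair prob_\<Omega>) (rule prob_space_measure_pmf)
  interpret PP: pair_sigma_finite "measure_pmf \<pi>" Om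
    by (intro pair_sigma_finite.intro prob_space_imp_sigma_finite prob_\<Omega>) (rule prob_space_measure_pmf)
  have int: "integrable (measure_pmf \<pi> \<Otimes>\<^sub>M Om) \<phi>"
  proof (rule PN.integrable_const_bound[OF _ \<phi>])
    show "AE p in measure_pmf \<pi> \<Otimes>\<^sub>M Om. norm (\<phi> p) \<le> (Cf + Lg * (Cf / \<mu>))\<^sup>2"
      by (rule AE_I2) (rule le)
  qed
  have grad: "gradient (hyper_objective f g) = hypergrad" by (rule ext) (rule gradient_hyper_objective)
  have eq: "(\<lambda>\<omega>. (norm (gradient (hyper_objective f g) (als_output F G par x0 y0 v0 Z \<kappa> \<omega>)))\<^sup>2) = (\<lambda>\<omega>. \<phi> (Q \<omega>))"
    unfolding grad out \<phi>_def ..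
  have "integrable P (\<lambda>\<omega>. \<phi> (Q \<omega>))"
    by (rule integrable_distr[OF Q]) (simp add: dQ int)
  moreover have "(\<integral>\<omega>. \<phi> (Q \<omega>) \<partial>P) \<le> \<epsilon>"
  proof -
    have "(\<integral>\<omega>. \<phi> (Q \<omega>) \<partial>P) = (\<integral>p. \<phi> p \<partial>(measure_pmf \<pi> \<Otimes>\<^sub>M Om))"
      using integral_distr[OF Q \<phi>] by (simp add: dQ)
    also have "\<dots> = (\<integral>k. (\<integral>w. \<phi> (k, w) \<partial>Om) \<partial>measure_pmf \<pi>)"
      using PP.integral_fst'[OF int] by simp
    also have "\<dots> = (\<Sum>k\<in>{0..<K}. \<integral>w. \<phi> (k, w) \<partial>Om) / real (card {0..<K})"
      unfolding \<pi>_def using K by (intro integral_pmf_of_set) auto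
    also have "\<dots> = (\<Sum>k<K. \<integral>w. (norm (hypergrad (als_x F G par x0 y0 v0 (smp w) k)))\<^sup>2 \<partial>Om) / real K"
      by (simp add: \<phi>_def A_def atLeast0LessThan)
    finally show ?thesis using bound by simp
  qed
  moreover have "als_output F G par x0 y0 v0 Z \<kappa> \<in> borel_measurable P"
    unfolding out by (rule measurable_compose[OF Q A])
  ultimately show ?thesis unfolding eps_stationary_def eq by blast
qed

end

section \<open>The constants\<close>

locale als_constants = als_base f g Cf Lf Lg Lgxy Lgyy \<mu> Mxi Mzeta F G \<sigma>f \<sigma>g \<sigma>gxy \<sigma>gyy R
  for f g :: "(real^'p) \<times> (real^'q) \<Rightarrow> real" and Cf Lf Lg Lgxy Lgyy \<mu>
    and Mxi :: "'a measure" and Mzeta :: "'b measure"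
    and F :: "'a \<Rightarrow> (real^'p) \<times> (real^'q) \<Rightarrow> real" and G :: "'b \<Rightarrow> (real^'p) \<times> (real^'q) \<Rightarrow> real"
    and \<sigma>f \<sigma>g \<sigma>gxy \<sigma>gyy R +
  fixes S2 T J :: nat and lam1 lam2 Ce Cb Cex Cey Cev C3 C7 C8 P6 Pt6 :: real
    and x0 :: "real^'p" and y0 v0 :: "real^'q"
  assumes sizes_pos: "0 < S2" "0 < T" "0 < J"
    and lam: "0 < lam1" "lam1 \<le> 1 / (2 * Lg + 2 * \<mu>)" "0 < lam2" "lam2 \<le> 1 / (2 * Lg + 2 * \<mu>)"
    and Ce: "Ce = 48 * (Lg\<^sup>2 + Cv\<^sup>2) / (\<mu> * lam2)"
    and Cb: "Cb = max ((96 * Cy\<^sup>2 + 8 * MM1) / (\<mu> * lam1)) (128 * MM1 * real J * Ce * lam2 / (\<mu>\<^sup>2 * lam1))"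
    and C3: "C3 = (real J)\<^sup>2 + (real J)\<^sup>2 * R\<^sup>2 + 2 * (real T)\<^sup>2"
    and C7: "C7 = 2 ^ (2 * (T + J) + 11) * (Lg\<^sup>2 * Ce + (MM1 + Lg\<^sup>2) * (1 + real T * Cb))"
    and Cex: "Cex = C7 / real S2"
    and Cey: "Cey = C7 * lam1 * Cb * real T / (\<mu> * real S2)"
    and Cev: "Cev = C7 * lam2 * Ce * real J / (\<mu> * real S2)"
    and C8: "C8 = 1 + 6 * LPhi + Cb + Ce + sqrt Cex + sqrt Cey + sqrt Cev"
    and P6: "P6 = Min {real S2 / (32 * (MM1 + Lg\<^sup>2)),
        (1/2) ^ (2 * T + 2) * real S2 / (real T * Cb * (MM1 + Lg\<^sup>2)),
        (1/2) ^ (2 * J - 1) * real S2 / (24 * Lg\<^sup>2 * Ce)}"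
    and Pt6: "Pt6 = (Cex\<^sup>2 + Cey\<^sup>2 + Cev\<^sup>2)
        * (1 + P6 + 8 / \<mu> * lam1 * Cb * C3 + 8 / \<mu> * lam2 * Ce * real J)
        * C3 * (\<sigma>f\<^sup>2 + \<sigma>g\<^sup>2 + \<sigma>gxy\<^sup>2 + \<sigma>gyy\<^sup>2)"
    and v0_ball: "norm v0 \<le> R"
    and bdd: "bdd_below (range (hyper_objective f g))"
begin

section \<open>Inequalities between the constants\<close>

lemma Lg_pos: "0 < Lg" using mu mu_le_Lg by linarith

lemma MM1_nonneg: "0 \<le> MM1" by (simp add: MM1_def)

lemma MM1_Lg_pos: "0 < MM1 + Lg\<^sup>2" using MM1_nonneg Lg_pos by (simp add: add_nonneg_pos)

lemma Ce_pos: "0 < Ce" unfolding Ce using Lg_pos mu lam by (simp add: add_pos_nonneg)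

lemma Ce_eq: "48 * (Lg\<^sup>2 + Cv\<^sup>2) = \<mu> * lam2 * Ce" unfolding Ce using mu lam by simp

lemma Cb1: "96 * Cy\<^sup>2 + 8 * MM1 \<le> \<mu> * lam1 * Cb"
proof -
  have "(96 * Cy\<^sup>2 + 8 * MM1) / (\<mu> * lam1) \<le> Cb" unfolding Cb by (rule max.cobounded1)
  then show ?thesis using mu lam by (simp add: pos_divide_le_eq mult.commute)
qed

lemma Cb2: "128 * MM1 * real J * Ce * lam2 \<le> \<mu>\<^sup>2 * lam1 * Cb"
proof -
  have "128 * MM1 * real J * Ce * lam2 / (\<mu>\<^sup>2 * lam1) \<le> Cb" unfolding Cb by (rule max.cobounded2)
  then show ?thesis using mu lam by (simp add: pos_divide_le_eq mult.commute)
qed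

lemma Cb_pos: "0 < Cb"
proof -
  have "0 < Cy" using Lg_pos mu by (simp add: Cy_def)
  then have "0 < (96 * Cy\<^sup>2 + 8 * MM1) / (\<mu> * lam1)"
    using mu lam MM1_nonneg by (intro divide_pos_pos add_pos_nonneg) auto
  also have "\<dots> \<le> Cb" unfolding Cb by (rule max.cobounded1)
  finally show ?thesis .
qed

text \<open>The bracket of C7, kept apart from its power of two.\<close>

definition "Br = Lg\<^sup>2 * Ce + (MM1 + Lg\<^sup>2) * (1 + real T * Cb)"

lemma Br_ge: "Lg\<^sup>2 * Ce \<le> Br" "(MM1 + Lg\<^sup>2) * (real T * Cb) \<le> Br" "MM1 + Lg\<^sup>2 \<le> Br" "0 < Br"
proof -
  have "0 \<le> Lg\<^sup>2 * Ce" "0 \<le> (MM1 + Lg\<^sup>2) * (real T * Cb)"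
    using Ce_pos Cb_pos MM1_nonneg by simp_all
  moreover have "Br = Lg\<^sup>2 * Ce + (MM1 + Lg\<^sup>2) + (MM1 + Lg\<^sup>2) * (real T * Cb)"
    by (simp add: Br_def algebra_simps)
  ultimately show "Lg\<^sup>2 * Ce \<le> Br" "(MM1 + Lg\<^sup>2) * (real T * Cb) \<le> Br" "MM1 + Lg\<^sup>2 \<le> Br" "0 < Br"
    using MM1_Lg_pos by linarith+
qed

lemma C7_ge: "n \<le> 2 * (T + J) + 11 \<Longrightarrow> 2 ^ n * Br \<le> C7"
  unfolding C7 Br_def[symmetric] using Br_ge(4) by (intro mult_right_mono power_increasing) auto

lemma C7_pos: "0 < C7" unfolding C7 Br_def[symmetric] using Br_ge(4) by simp

lemma C_pos: "0 < Cex" "0 < Cey" "0 < Cev"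
  using C7_pos sizes_pos lam Cb_pos Ce_pos mu by (simp_all add: Cex Cey Cev)

lemma C8_ge: "1 \<le> C8" "6 * LPhi \<le> C8" "Cb \<le> C8" "Ce \<le> C8" "sqrt Cex \<le> C8" "sqrt Cey \<le> C8" "sqrt Cev \<le> C8"
proof -
  have "0 \<le> LPhi" "0 < Cb" "0 < Ce" "0 \<le> sqrt Cex" "0 \<le> sqrt Cey" "0 \<le> sqrt Cev"
    using LPhi_nonneg Cb_pos Ce_pos C_pos by simp_all
  then show "1 \<le> C8" "6 * LPhi \<le> C8" "Cb \<le> C8" "Ce \<le> C8" "sqrt Cex \<le> C8" "sqrt Cey \<le> C8" "sqrt Cev \<le> C8"
    unfolding C8 by linarith+
qed

lemma C3_pos: "0 < C3" unfolding C3 using sizes_pos by (simp add: add_pos_nonneg)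

text \<open>8 S2 / C7 is \<alpha> times the weight of the estimator errors. Against each term of P6,
  one summand of the bracket in C7 and a part of its power of two suffice.\<close>

lemma P6_ge: "8 * real S2 / C7 \<le> P6"
proof -
  have a: "8 * real S2 / C7 \<le> real S2 / (32 * (MM1 + Lg\<^sup>2))"
  proof -
    have "256 * (MM1 + Lg\<^sup>2) \<le> 2 ^ 8 * Br" using Br_ge(3) by simp
    also have "\<dots> \<le> C7" by (rule C7_ge) simp
    finally have "8 / C7 \<le> 1 / (32 * (MM1 + Lg\<^sup>2))" using C7_pos MM1_Lg_pos by (simp add: field_simps)
    from mult_right_mono[OF this, of "real S2"] show ?thesis by simp
  qed
  have b: "8 * real S2 / C7 \<le> (1/2) ^ (2 * T + 2) * real S2 / (real T * Cb * (MM1 + Lg\<^sup>2))"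
  proof -
    define D where "D = real T * Cb * (MM1 + Lg\<^sup>2)"
    have D: "0 < D" unfolding D_def using sizes_pos Cb_pos MM1_Lg_pos by simp
    have "8 * 2 ^ (2 * T + 2) * D \<le> 2 ^ (2 * T + 5) * Br"
      using Br_ge(2) by (simp add: D_def power_add mult_ac)
    also have "\<dots> \<le> C7" by (rule C7_ge) simp
    finally have "8 * 2 ^ (2 * T + 2) * D \<le> C7" .
    then have "8 / C7 \<le> 1 / (2 ^ (2 * T + 2) * D)" using C7_pos D by (simp add: field_simps)
    from mult_right_mono[OF this, of "real S2"]
    show ?thesis unfolding D_def[symmetric] by (simp add: power_one_over field_simps)
  qed
  have c: "8 * real S2 / C7 \<le> (1/2) ^ (2 * J - 1) * real S2 / (24 * Lg\<^sup>2 * Ce)"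
  proof -
    define D where "D = 24 * Lg\<^sup>2 * Ce"
    have D: "0 < D" unfolding D_def using Lg_pos Ce_pos by simp
    have "8 * 2 ^ (2 * J - 1) * D \<le> 2 ^ (2 * J - 1 + 8) * Br"
    proof -
      have "8 * D = 192 * (Lg\<^sup>2 * Ce)" by (simp add: D_def)
      also have "\<dots> \<le> 192 * Br" using Br_ge(1) by (intro mult_left_mono) auto
      also have "\<dots> \<le> 2 ^ 8 * Br" using Br_ge(4) by simp
      finally have "8 * D \<le> 2 ^ 8 * Br" .
      from mult_left_mono[OF this, of "2 ^ (2 * J - 1)"] show ?thesis by (simp add: power_add mult_ac)
    qed
    also have "\<dots> \<le> C7" by (rule C7_ge) simp
    finally have "8 * 2 ^ (2 * J - 1) * D \<le> C7" .
    then have "8 / C7 \<le> 1 / (2 ^ (2 * J - 1) * D)" using C7_pos D by (simp add: field_simps)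
    from mult_right_mono[OF this, of "real S2"]
    show ?thesis unfolding D_def[symmetric] by (simp add: power_one_over field_simps)
  qed
  show ?thesis unfolding P6 using a b c by simp
qed

definition "\<Sigma> = \<sigma>f\<^sup>2 + \<sigma>g\<^sup>2 + \<sigma>gxy\<^sup>2 + \<sigma>gyy\<^sup>2"
definition "CC = Cex\<^sup>2 + Cey\<^sup>2 + Cev\<^sup>2"

lemma \<Sigma>_nonneg: "0 \<le> \<Sigma>" by (simp add: \<Sigma>_def)
lemma CC_nonneg: "0 \<le> CC" by (simp add: CC_def)

text \<open>The noise of one iteration meets Pt6 in this form; the factor 8 S2 / C7 is absorbed by
  the summand P6.\<close>

lemma Pt6_ge: "CC * (8 * real S2 / C7) * C3 * \<Sigma> \<le> Pt6" "0 \<le> Pt6"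
proof -
  have "0 \<le> 8 / \<mu> * lam1 * Cb * C3" "0 \<le> 8 / \<mu> * lam2 * Ce * real J"
    using mu lam Cb_pos Ce_pos C3_pos by simp_all
  then have "8 * real S2 / C7 \<le> 1 + P6 + 8 / \<mu> * lam1 * Cb * C3 + 8 / \<mu> * lam2 * Ce * real J"
    using P6_ge by linarith
  then show 1: "CC * (8 * real S2 / C7) * C3 * \<Sigma> \<le> Pt6"
    unfolding Pt6 CC_def[symmetric] \<Sigma>_def[symmetric]
    using CC_nonneg C3_pos \<Sigma>_nonneg by (intro mult_right_mono mult_left_mono) auto
  have "0 \<le> CC * (8 * real S2 / C7) * C3 * \<Sigma>"
    using CC_nonneg C3_pos \<Sigma>_nonneg C7_pos by simp
  then show "0 \<le> Pt6" using 1 by linarith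
qed

text \<open>C3 dominates J (1 + R^2), which comes from the variances of the x- and v-directions, and
  also T, because J \<le> J^2 and T \<le> T^2.\<close>

lemma noise_sum:
  "real J * (Cex\<^sup>2 * var_x) + real T * (Cey\<^sup>2 * \<sigma>g\<^sup>2) + real J * (Cev\<^sup>2 * var_v) \<le> 2 * (CC * (C3 * \<Sigma>))"
proof -
  have JJ: "real J \<le> (real J)\<^sup>2" "real T \<le> (real T)\<^sup>2"
    using sizes_pos by (simp_all add: power2_eq_square)
  have jr: "real J * R\<^sup>2 \<le> (real J)\<^sup>2 * R\<^sup>2" using JJ by (intro mult_right_mono) auto
  have sq: "0 \<le> (real J)\<^sup>2 * R\<^sup>2" "0 \<le> (real J)\<^sup>2" "0 \<le> (real T)\<^sup>2" by simp_all
  have c3: "real J + real J * R\<^sup>2 \<le> C3" "real T \<le> C3"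
    unfolding C3 using JJ jr sq by linarith+
  have s: "\<sigma>f\<^sup>2 \<le> \<Sigma>" "\<sigma>g\<^sup>2 \<le> \<Sigma>" "\<sigma>gxy\<^sup>2 \<le> \<Sigma>" "\<sigma>gyy\<^sup>2 \<le> \<Sigma>" by (simp_all add: \<Sigma>_def)
  have v: "real J * var_x \<le> 2 * (C3 * \<Sigma>)" "real J * var_v \<le> 2 * (C3 * \<Sigma>)"
  proof -
    have *: "real J * (2 * a + 2 * (R\<^sup>2 * b)) \<le> 2 * (C3 * \<Sigma>)" if "a \<le> \<Sigma>" "b \<le> \<Sigma>" for a b
    proof -
      have "real J * (2 * a + 2 * (R\<^sup>2 * b)) \<le> real J * (2 * \<Sigma> + 2 * (R\<^sup>2 * \<Sigma>))"
        using that by (intro mult_left_mono add_mono) auto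
      also have "\<dots> = 2 * ((real J + real J * R\<^sup>2) * \<Sigma>)" by (simp add: algebra_simps)
      also have "\<dots> \<le> 2 * (C3 * \<Sigma>)" using c3 \<Sigma>_nonneg by (intro mult_left_mono mult_right_mono) auto
      finally show ?thesis .
    qed
    show "real J * var_x \<le> 2 * (C3 * \<Sigma>)" "real J * var_v \<le> 2 * (C3 * \<Sigma>)"
      unfolding var_x_def var_v_def using s by (intro *; simp)+
  qed
  have t: "real T * \<sigma>g\<^sup>2 \<le> 2 * (C3 * \<Sigma>)"
  proof -
    have "real T * \<sigma>g\<^sup>2 \<le> C3 * \<Sigma>" using c3 s C3_pos by (intro mult_mono) auto
    moreover have "0 \<le> C3 * \<Sigma>" using C3_pos \<Sigma>_nonneg by simp
    ultimately show ?thesis by linarith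
  qed
  have "Cex\<^sup>2 * (real J * var_x) + Cey\<^sup>2 * (real T * \<sigma>g\<^sup>2) + Cev\<^sup>2 * (real J * var_v)
      \<le> Cex\<^sup>2 * (2 * (C3 * \<Sigma>)) + Cey\<^sup>2 * (2 * (C3 * \<Sigma>)) + Cev\<^sup>2 * (2 * (C3 * \<Sigma>))"
    using v t by (intro add_mono mult_left_mono) auto
  then show ?thesis unfolding CC_def by (simp add: algebra_simps)
qed

section \<open>Instantiation of the parameters\<close>

definition "parK K S1 \<alpha> = \<lparr> period = K, y_iters = T, v_iters = J, batch_init = S1, batch_inner = S2,
  rate_y = lam1, rate_v = lam2, step_x = \<alpha>, step_y = Cb * \<alpha>, step_v = Ce * \<alpha>,
  mom_x = Cex * \<alpha>\<^sup>2, mom_y = Cey * \<alpha>\<^sup>2, mom_v = Cev * \<alpha>\<^sup>2, radius = R \<rparr>"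

lemma parK_sel [simp]:
  "period (parK K S1 \<alpha>) = K" "y_iters (parK K S1 \<alpha>) = T" "v_iters (parK K S1 \<alpha>) = J" "batch_init (parK K S1 \<alpha>) = S1"
  "batch_inner (parK K S1 \<alpha>) = S2" "rate_y (parK K S1 \<alpha>) = lam1" "rate_v (parK K S1 \<alpha>) = lam2" "step_x (parK K S1 \<alpha>) = \<alpha>"
  "step_y (parK K S1 \<alpha>) = Cb * \<alpha>" "step_v (parK K S1 \<alpha>) = Ce * \<alpha>" "mom_x (parK K S1 \<alpha>) = Cex * \<alpha>\<^sup>2"
  "mom_y (parK K S1 \<alpha>) = Cey * \<alpha>\<^sup>2" "mom_v (parK K S1 \<alpha>) = Cev * \<alpha>\<^sup>2" "radius (parK K S1 \<alpha>) = R"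
  by (simp_all add: parK_def)

lemma parK_period: "(parK K S1 \<alpha>)\<lparr>period := p\<rparr> = parK p S1 \<alpha>" by (simp add: parK_def)

context
  fixes \<alpha> :: real
  assumes \<alpha>: "0 < \<alpha>" "\<alpha> \<le> 1 / C8"
begin

text \<open>Each summand c of C8 yields one step-size condition.\<close>

lemma \<alpha>_C8: "c \<le> C8 \<Longrightarrow> c * \<alpha> \<le> 1"
proof -
  assume c: "c \<le> C8"
  have "c * \<alpha> \<le> C8 * \<alpha>" using c \<alpha> by (intro mult_right_mono) auto
  also have "\<dots> \<le> 1" using \<alpha> C8_ge(1) by (simp add: field_simps)
  finally show ?thesis .
qed

text \<open>The momentum parameters are quadratic in \<alpha>, which is why C8 contains square
  roots.\<close>

lemma mom_le: "0 \<le> c \<Longrightarrow> sqrt c \<le> C8 \<Longrightarrow> c * \<alpha>\<^sup>2 \<le> 1"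
proof -
  assume c: "0 \<le> c" "sqrt c \<le> C8"
  have "(sqrt c * \<alpha>)\<^sup>2 \<le> 1" using \<alpha>_C8[OF c(2)] c \<alpha> by (intro power_le_one) auto
  then show ?thesis using c by (simp add: power_mult_distrib)
qed

lemma rates_le: "lam1 * (Cb * \<alpha>) \<le> lam1" "lam2 * (Ce * \<alpha>) \<le> lam2"
  using \<alpha>_C8[OF C8_ge(3)] \<alpha>_C8[OF C8_ge(4)] lam by (simp_all add: mult_left_le)

lemma als_setting_parK:
  assumes "0 < S1"
  shows "als_setting f g Cf Lf Lg Lgxy Lgyy \<mu> Mxi Mzeta F G \<sigma>f \<sigma>g \<sigma>gxy \<sigma>gyy R (parK 0 S1 \<alpha>) v0"
proof (unfold_locales, unfold parK_sel)
  have d1: "96 * Cy\<^sup>2 \<le> \<mu> * lam1 * Cb"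
    by (rule order_trans[OF _ Cb1]) (use MM1_nonneg in simp)
  have d2: "48 * Cv\<^sup>2 \<le> \<mu> * lam2 * Ce" unfolding Ce_eq[symmetric] by simp
  show "96 * Cy\<^sup>2 * \<alpha> \<le> lam1 * (Cb * \<alpha>) * \<mu>" using mult_right_mono[OF d1, of \<alpha>] \<alpha> by (simp add: mult_ac)
  show "48 * Cv\<^sup>2 * \<alpha> \<le> lam2 * (Ce * \<alpha>) * \<mu>" using mult_right_mono[OF d2, of \<alpha>] \<alpha> by (simp add: mult_ac)
  show "6 * LPhi * \<alpha> \<le> 1" by (rule \<alpha>_C8[OF C8_ge(2)])
  show "lam1 * (Cb * \<alpha>) \<le> 1 / (2 * Lg + 2 * \<mu>)" "lam2 * (Ce * \<alpha>) \<le> 1 / (2 * Lg + 2 * \<mu>)"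
    using rates_le lam by linarith+
  show "Cex * \<alpha>\<^sup>2 \<le> 1" "Cey * \<alpha>\<^sup>2 \<le> 1" "Cev * \<alpha>\<^sup>2 \<le> 1"
    using C_pos C8_ge by (auto intro!: mom_le)
qed (use assms sizes_pos lam Cb_pos Ce_pos C_pos \<alpha> v0_ball bdd in auto)

lemma lyapunov_weights_parK:
  "lyapunov_weights \<mu> Lg MM1 Cy Cv \<alpha> (lam1 * (Cb * \<alpha>)) (lam2 * (Ce * \<alpha>)) lam1 lam2 Cb Ce
    (8 * real S2 / (C7 * \<alpha>)) (16 / (C7 * \<alpha>)) (Cex * \<alpha>\<^sup>2) (Cey * \<alpha>\<^sup>2) (Cev * \<alpha>\<^sup>2) C7 T J S2"
proof
  \<comment> \<open>T and J are at least 1, so the exponent 2 (T + J) + 11 is at least 15.\<close>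
  show "2 ^ 15 * (Lg\<^sup>2 * Ce + (MM1 + Lg\<^sup>2) * (1 + real T * Cb)) \<le> C7"
    using C7_ge[of 15] sizes_pos unfolding Br_def by simp
  \<comment> \<open>S2 and C7 cancel: the momentum constants are made so that the gain of a momentum
    step contains neither.\<close>
  show "8 * real S2 / (C7 * \<alpha>) * (Cex * \<alpha>\<^sup>2) = 8 * \<alpha>"
    unfolding Cex using C7_pos sizes_pos \<alpha> by (simp add: power2_eq_square)
  show "8 * real S2 / (C7 * \<alpha>) * (Cey * \<alpha>\<^sup>2) = 8 * real T * (lam1 * (Cb * \<alpha>)) / \<mu>"
    unfolding Cey using C7_pos sizes_pos \<alpha> mu by (simp add: power2_eq_square)
  show "8 * real S2 / (C7 * \<alpha>) * (Cev * \<alpha>\<^sup>2) = 8 * real J * (lam2 * (Ce * \<alpha>)) / \<mu>"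
    unfolding Cev using C7_pos sizes_pos \<alpha> mu by (simp add: power2_eq_square)
qed (use mu mu_le_Lg MM1_nonneg \<alpha> sizes_pos lam Cb_pos Ce_pos Ce_eq Cb1 Cb2 rates_le in auto)

text \<open>The noise is of order \<alpha>^3; if Pt6 is nonzero, the bound on \<alpha> that involves
  \<epsilon> converts two of these factors into \<epsilon>.\<close>

lemma noise_le:
  assumes e: "Pt6 = 0 \<or> \<alpha>\<^sup>2 \<le> real S2 * \<epsilon> / (16 * Pt6)" "0 < \<epsilon>"
  shows "16 / (C7 * \<alpha>) * (real J * ((Cex * \<alpha>\<^sup>2)\<^sup>2 * var_x) + real T * ((Cey * \<alpha>\<^sup>2)\<^sup>2 * \<sigma>g\<^sup>2) + real J * ((Cev * \<alpha>\<^sup>2)\<^sup>2 * var_v))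
    \<le> \<alpha> * \<epsilon> / 4"
proof -
  have "16 / (C7 * \<alpha>) * (real J * ((Cex * \<alpha>\<^sup>2)\<^sup>2 * var_x) + real T * ((Cey * \<alpha>\<^sup>2)\<^sup>2 * \<sigma>g\<^sup>2) + real J * ((Cev * \<alpha>\<^sup>2)\<^sup>2 * var_v))
      = 16 * \<alpha>^3 / C7 * (real J * (Cex\<^sup>2 * var_x) + real T * (Cey\<^sup>2 * \<sigma>g\<^sup>2) + real J * (Cev\<^sup>2 * var_v))"
    using \<alpha> C7_pos by (simp add: field_simps power2_eq_square power3_eq_cube)
  also have "\<dots> \<le> 16 * \<alpha>^3 / C7 * (2 * (CC * (C3 * \<Sigma>)))"
    using \<alpha> C7_pos by (intro mult_left_mono noise_sum) auto
  also have "\<dots> = 4 * \<alpha>^3 / real S2 * (CC * (8 * real S2 / C7) * C3 * \<Sigma>)"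
    using sizes_pos by simp
  also have "\<dots> \<le> 4 * \<alpha>^3 / real S2 * Pt6" using \<alpha> by (intro mult_left_mono Pt6_ge) auto
  also have "\<dots> \<le> \<alpha> * \<epsilon> / 4"
  proof (cases "Pt6 = 0")
    case True
    then show ?thesis using \<alpha> e by simp
  next
    case False
    then have P: "0 < Pt6" using Pt6_ge(2) by simp
    have "\<alpha>\<^sup>2 * Pt6 \<le> real S2 * \<epsilon> / 16" using e(1) False P by (simp add: field_simps)
    then have "4 * \<alpha> / real S2 * (\<alpha>\<^sup>2 * Pt6) \<le> 4 * \<alpha> / real S2 * (real S2 * \<epsilon> / 16)"
      using \<alpha> by (intro mult_left_mono) auto
    then show ?thesis using sizes_pos by (simp add: power2_eq_square power3_eq_cube mult_ac)
  qed
  finally show ?thesis .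
qed

text \<open>Of the target K \<alpha> \<epsilon> / 2 one half is used up by the noise of K iterations
  and the other by V, which the choice of K makes at most K \<alpha> \<epsilon> / 4.\<close>

lemma parK_stationary:
  assumes e: "Pt6 = 0 \<or> \<alpha>\<^sup>2 \<le> real S2 * \<epsilon> / (16 * Pt6)" "0 < \<epsilon>"
    and L: "\<And>x. L \<le> hyper_objective f g x"
    and V: "hyper_objective f g x0 - L + (norm (y0 - ystar x0))\<^sup>2 + (2 * R)\<^sup>2 + 8 * real S2 / C7 * (var_x + \<sigma>g\<^sup>2 + var_v) \<le> V"
    and S1: "1 / \<alpha> \<le> real S1" and K: "4 * V / (\<alpha> * \<epsilon>) \<le> real K" "0 < K"
    and rand: "als_randomness P Mxi Mzeta Z K \<kappa>"
  shows "eps_stationary P (hyper_objective f g) \<epsilon> (als_output F G (parK K S1 \<alpha>) x0 y0 v0 Z \<kappa>)"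
proof (rule output_stationary[OF K(2) _ rand])
  have S1p: "0 < S1" using S1 \<alpha> by (metis divide_pos_pos less_le_trans of_nat_0_less_iff zero_less_one)
  interpret A: als_setting f g Cf Lf Lg Lgxy Lgyy \<mu> Mxi Mzeta F G \<sigma>f \<sigma>g \<sigma>gxy \<sigma>gyy R "parK 0 S1 \<alpha>" x0 y0 v0
    by (rule als_setting_parK[OF S1p])
  have X: "als_x F G (parK K S1 \<alpha>) x0 y0 v0 (smp w) k = A.X k w" if "k < K" for k w
  proof -
    have "als F G (parK 0 S1 \<alpha>) x0 y0 v0 (smp w) k = als F G (parK K S1 \<alpha>) x0 y0 v0 (smp w) k"
      using als_period[of k K "parK K S1 \<alpha>"] that K(2) by (simp add: parK_period)
    then show ?thesis unfolding als_x_def A.X_def A.st_def by (simp add: case_prod_beta')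
  qed
  have G: "(\<Sum>k<K. \<integral>w. (norm (hypergrad (als_x F G (parK K S1 \<alpha>) x0 y0 v0 (smp w) k)))\<^sup>2 \<partial>Om) = (\<Sum>k<K. A.EE (A.qG k))"
    by (rule sum.cong) (simp_all add: X A.qG_def[abs_def])
  define N where "N = 16 / (C7 * \<alpha>) * (real J * ((Cex * \<alpha>\<^sup>2)\<^sup>2 * var_x) + real T * ((Cey * \<alpha>\<^sup>2)\<^sup>2 * \<sigma>g\<^sup>2) + real J * ((Cev * \<alpha>\<^sup>2)\<^sup>2 * var_v))"
  have N: "N \<le> \<alpha> * \<epsilon> / 4" unfolding N_def by (rule noise_le[OF e])
  have vn: "0 \<le> var_x + \<sigma>g\<^sup>2 + var_v" by (simp add: var_x_def var_v_def)
  \<comment> \<open>S1 \<ge> 1 / \<alpha> cancels the 1 / \<alpha> in the weight of the estimator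
    errors.\<close>
  have init: "8 * real S2 / (C7 * \<alpha>) * ((var_x + \<sigma>g\<^sup>2 + var_v) / real S1) \<le> 8 * real S2 / C7 * (var_x + \<sigma>g\<^sup>2 + var_v)"
  proof -
    have "1 \<le> \<alpha> * real S1" using S1 \<alpha> by (simp add: field_simps)
    have "8 * real S2 / (C7 * \<alpha>) * ((var_x + \<sigma>g\<^sup>2 + var_v) / real S1) = 8 * real S2 / C7 * (var_x + \<sigma>g\<^sup>2 + var_v) / (\<alpha> * real S1)"
      by simp
    also have "\<dots> \<le> 8 * real S2 / C7 * (var_x + \<sigma>g\<^sup>2 + var_v) / 1"
      using \<open>1 \<le> \<alpha> * real S1\<close> vn C7_pos by (intro divide_left_mono) auto
    finally show ?thesis by simp
  qed
  have "\<alpha> / 2 * (\<Sum>k<K. A.EE (A.qG k)) \<le> hyper_objective f g x0 - L + (norm (y0 - ystar x0))\<^sup>2 + (2 * R)\<^sup>2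
      + 8 * real S2 / (C7 * \<alpha>) * ((var_x + \<sigma>g\<^sup>2 + var_v) / real S1) + real K * N"
    using A.average_gradient_bound[unfolded parK_sel, OF lyapunov_weights_parK L, of K] unfolding N_def .
  also have "\<dots> \<le> V + real K * (\<alpha> * \<epsilon> / 4)"
    using V init mult_left_mono[OF N, of "real K"] by simp
  also have "\<dots> \<le> real K * (\<alpha> * \<epsilon> / 4) + real K * (\<alpha> * \<epsilon> / 4)"
    using K \<alpha> e(2) by (simp add: field_simps)
  finally have "\<alpha> * (\<Sum>k<K. A.EE (A.qG k)) \<le> \<alpha> * (real K * \<epsilon>)" by (simp add: mult_ac)
  then have "(\<Sum>k<K. A.EE (A.qG k)) \<le> real K * \<epsilon>" using \<alpha> by simp
  then show "(\<Sum>k<K. \<integral>w. (norm (hypergrad (als_x F G (parK K S1 \<alpha>) x0 y0 v0 (smp w) k)))\<^sup>2 \<partial>Om) / real K \<le> \<epsilon>"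
    unfolding G using K(2) by (simp add: field_simps)
qed (use R_nonneg in simp)

end

end

theorem theorem2:
  fixes Mxi :: "'a measure" and Mzeta :: "'b measure"
    and F :: "'a \<Rightarrow> (real^'p) \<times> (real^'q) \<Rightarrow> real"
    and G :: "'b \<Rightarrow> (real^'p) \<times> (real^'q) \<Rightarrow> real"
    and f g :: "(real^'p) \<times> (real^'q) \<Rightarrow> real"
    and \<mu> C_f L_f L_g L_gxy L_gyy \<sigma>_f \<sigma>_g \<sigma>_gxy \<sigma>_gyy :: real
    and M L_gg M1 C_y C_v L_Phi :: real
    and S2 T J :: nat
    and lam1 lam2 :: real
    and x0 :: "real^'p" and y0 v0 :: "real^'q"
    and C_eta C_beta C_etax C_etay C_etav C3 C6 C7 C8 P6 Pt6 :: real
    and \<alpha> :: "real \<Rightarrow> real"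
  assumes prob: "prob_space Mxi" "prob_space Mzeta"
    and f_expectation: "is_expectation_of f Mxi F"
    and g_expectation: "is_expectation_of g Mzeta G"
    and A1: "problem_regularity Mxi Mzeta F G f g \<mu>"
    and A2: "upper_lipschitz C_f L_f f" "lower_lipschitz L_g L_gxy L_gyy g"
    and A3: "stochastic_oracles Mxi Mzeta F G f g \<sigma>_f \<sigma>_g \<sigma>_gxy \<sigma>_gyy"
    and A4: "\<And>\<xi>. \<xi> \<in> space Mxi \<Longrightarrow> upper_lipschitz C_f L_f (F \<xi>)"
            "\<And>\<zeta>. \<zeta> \<in> space Mzeta \<Longrightarrow> lower_lipschitz L_g L_gxy L_gyy (G \<zeta>)"
    and M: "M \<ge> C_f / \<mu>"
    and v0: "v0 \<in> cball 0 M"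
    and L_gg: "L_gg = max L_gxy L_gyy"
    and M1: "M1 = 4 * L_f\<^sup>2 + 4 * M\<^sup>2 * L_gg\<^sup>2"
    and C_y: "C_y = L_g / \<mu>"
    and C_v: "C_v = (L_f / \<mu> + C_f * L_gg / \<mu>\<^sup>2) * (1 + L_g / \<mu>)"
    and L_Phi: "L_Phi = L_f + (2 * L_f * L_g + C_f * L_gg) / \<mu>
                  + (L_f * L_g\<^sup>2 + 2 * C_f * L_g * L_gg) / \<mu>\<^sup>2
                  + C_f * L_g\<^sup>2 * L_gg / \<mu>^3"
    and positive: "0 < S2" "0 < T" "0 < J"
    and lam1: "0 < lam1" "lam1 \<le> 1 / (2 * L_g + 2 * \<mu>)"
    and lam2: "0 < lam2" "lam2 \<le> 1 / (2 * L_g + 2 * \<mu>)"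
    and C_eta: "C_eta = 48 * (L_g\<^sup>2 + C_v\<^sup>2) / (\<mu> * lam2)"
    and C_beta: "C_beta = max ((96 * C_y\<^sup>2 + 8 * M1) / (\<mu> * lam1))
                              (128 * M1 * real J * C_eta * lam2 / (\<mu>\<^sup>2 * lam1))"
    and C3: "C3 = (real J)\<^sup>2 + (real J)\<^sup>2 * M\<^sup>2 + 2 * (real T)\<^sup>2"
    and C6: "C6 = L_g\<^sup>2 * lam1 * C_beta + M1 * lam2 * C_eta"
    and C7: "C7 = 2 ^ (2 * (T + J) + 11)
                    * (L_g\<^sup>2 * C_eta + (M1 + L_g\<^sup>2) * (1 + real T * C_beta))"
    and C_etax: "C_etax = C7 / real S2"
    and C_etay: "C_etay = C7 * lam1 * C_beta * real T / (\<mu> * real S2)"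
    and C_etav: "C_etav = C7 * lam2 * C_eta * real J / (\<mu> * real S2)"
    and C8: "C8 = 1 + 6 * L_Phi + C_beta + C_eta + sqrt C_etax + sqrt C_etay + sqrt C_etav"
    and P6: "P6 = Min {real S2 / (32 * (M1 + L_g\<^sup>2)),
                       (1/2) ^ (2 * T + 2) * real S2 / (real T * C_beta * (M1 + L_g\<^sup>2)),
                       (1/2) ^ (2 * J - 1) * real S2 / (24 * L_g\<^sup>2 * C_eta)}"
    and Pt6: "Pt6 = (C_etax\<^sup>2 + C_etay\<^sup>2 + C_etav\<^sup>2)
                      * (1 + P6 + 8 / \<mu> * lam1 * C_beta * C3 + 8 / \<mu> * lam2 * C_eta * real J)
                      * C3 * (\<sigma>_f\<^sup>2 + \<sigma>_g\<^sup>2 + \<sigma>_gxy\<^sup>2 + \<sigma>_gyy\<^sup>2)"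
    \<comment> \<open>If there is no noise, i.e. \<open>Pt6 = 0\<close>, the first bound on the step size is infinite.\<close>
    and \<alpha>: "\<And>\<epsilon>. \<alpha> \<epsilon> = Min ((if Pt6 = 0 then {} else {sqrt (real S2 * \<epsilon> / (16 * Pt6))}) \<union>
              {sqrt ((1/2) ^ (2 * (T + J + 4)) * \<mu> * real S2
                       / (lam2 * L_g\<^sup>2 * C_eta\<^sup>2 * real J + real T * C_beta * C3 * C6)),
               1 / 32 * sqrt (\<mu> / (C6 * (C3 / real S2 + 1 + C_y\<^sup>2))),
               sqrt (real S2 / C7),
               1 / C8})"
  shows "\<exists>(K :: real \<Rightarrow> nat) (S1 :: real \<Rightarrow> nat) (par :: real \<Rightarrow> als_params).
    (\<forall>\<epsilon>>0. 0 < K \<epsilon> \<and> 0 < S1 \<epsilon> \<and>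
       par \<epsilon> = \<lparr> period = K \<epsilon>, y_iters = T, v_iters = J, batch_init = S1 \<epsilon>, batch_inner = S2,
                 rate_y = lam1, rate_v = lam2,
                 step_x = \<alpha> \<epsilon>, step_y = C_beta * \<alpha> \<epsilon>, step_v = C_eta * \<alpha> \<epsilon>,
                 mom_x = C_etax * (\<alpha> \<epsilon>)\<^sup>2, mom_y = C_etay * (\<alpha> \<epsilon>)\<^sup>2, mom_v = C_etav * (\<alpha> \<epsilon>)\<^sup>2,
                 radius = M \<rparr> \<and>
       (\<forall>(P :: 'w measure) Z \<kappa>. als_randomness P Mxi Mzeta Z (K \<epsilon>) \<kappa> \<longrightarrow>
          eps_stationary P (hyper_objective f g) \<epsilon> (als_output F G (par \<epsilon>) x0 y0 v0 Z \<kappa>))) \<and>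
    (\<lambda>\<epsilon>. real (S1 \<epsilon>)) \<in> O[at_right 0](\<lambda>\<epsilon>. \<epsilon> powr (- (1/2))) \<and>
    (\<lambda>\<epsilon>. real (sample_complexity (par \<epsilon>) (K \<epsilon>))) \<in> O[at_right 0](\<lambda>\<epsilon>. \<epsilon> powr (- (3/2)))"
proof -
  have reg: "C1 f" "\<And>\<xi>. \<xi> \<in> space Mxi \<Longrightarrow> C1 (F \<xi>)" "C2 g" "\<And>\<zeta>. \<zeta> \<in> space Mzeta \<Longrightarrow> C2 (G \<zeta>)" "0 < \<mu>"
    "\<And>x. strongly_convex \<mu> (\<lambda>y. g (x, y))" "\<And>\<zeta> x. \<zeta> \<in> space Mzeta \<Longrightarrow> strongly_convex \<mu> (\<lambda>y. G \<zeta> (x, y))"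
    "bdd_below (range (hyper_objective f g))"
    using A1 unfolding problem_regularity_def by auto
  have samples: "smooth_pair (F \<xi>) (G \<zeta>) C_f L_f L_g L_gxy L_gyy \<mu>" if "\<xi> \<in> space Mxi" "\<zeta> \<in> space Mzeta" for \<xi> \<zeta>
    by (intro smooth_pair.intro reg A4 that)
  interpret B: als_base f g C_f L_f L_g L_gxy L_gyy \<mu> Mxi Mzeta F G \<sigma>_f \<sigma>_g \<sigma>_gxy \<sigma>_gyy M
    by (intro als_base.intro als_base_axioms.intro samples prob A3 M smooth_pair.intro[OF reg(1,3,5,6) A2])
  have eqs: "L_gg = B.Lgg" "C_y = B.Cy" using L_gg C_y by (simp_all add: B.Lgg_def B.Cy_def)
  have eqs': "M1 = B.MM1" "C_v = B.Cv" "L_Phi = B.LPhi"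
    using M1 C_v L_Phi eqs by (simp_all add: B.MM1_def B.Cv_def B.LPhi_def)
  interpret C: als_constants f g C_f L_f L_g L_gxy L_gyy \<mu> Mxi Mzeta F G \<sigma>_f \<sigma>_g \<sigma>_gxy \<sigma>_gyy M
      S2 T J lam1 lam2 C_eta C_beta C_etax C_etay C_etav C3 C7 C8 P6 Pt6 x0 y0 v0
    by (unfold_locales; fact positive lam1 lam2 C_eta[unfolded eqs'] C_beta[unfolded eqs eqs'] C3
        C7[unfolded eqs'] C_etax C_etay C_etav C8[unfolded eqs'] P6[unfolded eqs'] Pt6 v0[unfolded mem_cball_0] reg(8))
  have C6_pos: "0 < C6"
    unfolding C6 using C.Lg_pos C.Cb_pos C.Ce_pos C.MM1_nonneg lam1 lam2 eqs' by (simp add: add_pos_nonneg)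
  obtain L where L: "\<And>x. L \<le> hyper_objective f g x"
    using reg(8) unfolding bdd_below_def by auto
  \<comment> \<open>The part of the bound that does not depend on \<epsilon>; the maximum makes it
    visibly nonnegative.\<close>
  define V where "V = max 0 (hyper_objective f g x0 - L + (norm (y0 - lower_solution g x0))\<^sup>2 + (2 * M)\<^sup>2
    + 8 * real S2 / C7 * (B.var_x + \<sigma>_g\<^sup>2 + B.var_v))"
  \<comment> \<open>The factor of sqrt \<epsilon> in the one bound on \<alpha> that depends on
    \<epsilon>.\<close>
  define \<kappa> where "\<kappa> = sqrt (real S2 / (16 * Pt6))"
  define E where "E = {sqrt ((1/2) ^ (2 * (T + J + 4)) * \<mu> * real S2
                       / (lam2 * L_g\<^sup>2 * C_eta\<^sup>2 * real J + real T * C_beta * C3 * C6)),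
               1 / 32 * sqrt (\<mu> / (C6 * (C3 / real S2 + 1 + C_y\<^sup>2))),
               sqrt (real S2 / C7),
               1 / C8}"
  define m where "m = Min E"
  have E: "finite E" "E \<noteq> {}" "1 / C8 \<in> E" by (simp_all add: E_def)
  have E_pos: "0 < e" if "e \<in> E" for e
  proof -
    have "0 < lam2 * L_g\<^sup>2 * C_eta\<^sup>2 * real J + real T * C_beta * C3 * C6"
      using C.Lg_pos C.Cb_pos C.Ce_pos C.C3_pos C6_pos lam2 positive by (simp add: add_pos_pos)
    moreover have "0 < C6 * (C3 / real S2 + 1 + C_y\<^sup>2)"
      using C6_pos C.C3_pos positive by (intro mult_pos_pos add_pos_nonneg) auto
    ultimately show ?thesis
      using that C.C7_pos C.C8_ge(1) reg(5) positive unfolding E_def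
      by (elim insertE emptyE; hypsubst) simp_all
  qed
  have m: "0 < m" "\<And>e. e \<in> E \<Longrightarrow> m \<le> e"
    using E E_pos by (simp_all add: m_def)
  have \<alpha>': "\<alpha> \<epsilon> = Min ((if Pt6 = 0 then {} else {sqrt (real S2 * \<epsilon> / (16 * Pt6))}) \<union> E)" for \<epsilon>
    unfolding \<alpha> E_def ..
  have \<alpha>_mem: "\<alpha> \<epsilon> \<le> e" if "e \<in> (if Pt6 = 0 then {} else {sqrt (real S2 * \<epsilon> / (16 * Pt6))}) \<union> E" for \<epsilon> e
    unfolding \<alpha>' using that E by (intro Min_le) auto
  have \<alpha>_ge: "x \<le> \<alpha> \<epsilon>" if "\<And>e. e \<in> (if Pt6 = 0 then {} else {sqrt (real S2 * \<epsilon> / (16 * Pt6))}) \<union> E \<Longrightarrow> x \<le> e" for \<epsilon> x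
    unfolding \<alpha>' using that E by (intro Min.boundedI) auto
  have \<alpha>_C8: "\<alpha> \<epsilon> \<le> 1 / C8" for \<epsilon> using \<alpha>_mem E by auto
  have \<kappa>: "0 < \<kappa>" if "Pt6 \<noteq> 0"
  proof -
    have "0 < Pt6" using that C.Pt6_ge(2) by linarith
    then show ?thesis using positive by (simp add: \<kappa>_def)
  qed
  have \<kappa>_eq: "sqrt (real S2 * \<epsilon> / (16 * Pt6)) = \<kappa> * sqrt \<epsilon>" for \<epsilon>
    unfolding \<kappa>_def by (simp add: real_sqrt_mult[symmetric])
  \<comment> \<open>The constant in \<alpha> \<ge> c min(1, sqrt \<epsilon>). Without noise \<alpha>
    does not depend on \<epsilon>, and m alone is used.\<close>
  define c where "c = (if Pt6 = 0 then m else min \<kappa> m)"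
  have c: "0 < c" "c \<le> m" "Pt6 \<noteq> 0 \<Longrightarrow> c \<le> \<kappa>" using m \<kappa> by (auto simp: c_def)
  have \<alpha>_lower: "min 1 (sqrt \<epsilon>) * c \<le> \<alpha> \<epsilon>" if "0 < \<epsilon>" for \<epsilon>
  proof (rule \<alpha>_ge)
    fix e assume e: "e \<in> (if Pt6 = 0 then {} else {sqrt (real S2 * \<epsilon> / (16 * Pt6))}) \<union> E"
    show "min 1 (sqrt \<epsilon>) * c \<le> e"
    proof (cases "e \<in> E")
      case True
      have "min 1 (sqrt \<epsilon>) * c \<le> 1 * c" using c by (intro mult_right_mono) auto
      then show ?thesis using m(2)[OF True] c by linarith
    next
      case False
      then have P: "Pt6 \<noteq> 0" and e: "e = \<kappa> * sqrt \<epsilon>" using e by (auto simp: \<kappa>_eq split: if_splits)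
      have "min 1 (sqrt \<epsilon>) * c \<le> sqrt \<epsilon> * \<kappa>" using c P that by (intro mult_mono) auto
      then show ?thesis by (simp add: e mult.commute)
    qed
  qed
  have \<alpha>_pos: "0 < \<alpha> \<epsilon>" if "0 < \<epsilon>" for \<epsilon>
    using \<alpha>_lower[OF that] c that by (smt (verit) mult_pos_pos real_sqrt_gt_zero)
  have \<alpha>_noise: "Pt6 = 0 \<or> (\<alpha> \<epsilon>)\<^sup>2 \<le> real S2 * \<epsilon> / (16 * Pt6)" if "0 < \<epsilon>" for \<epsilon>
  proof (cases "Pt6 = 0")
    case False
    have "\<alpha> \<epsilon> \<le> sqrt (real S2 * \<epsilon> / (16 * Pt6))" using \<alpha>_mem[of _ \<epsilon>] False by simp
    then have "(\<alpha> \<epsilon>)\<^sup>2 \<le> (sqrt (real S2 * \<epsilon> / (16 * Pt6)))\<^sup>2" using \<alpha>_pos[OF that] by (intro power_mono) auto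
    also have "\<dots> = real S2 * \<epsilon> / (16 * Pt6)" using C.Pt6_ge(2) that by simp
    finally show ?thesis by simp
  qed simp
  define S1 where "S1 \<epsilon> = nat \<lceil>1 / \<alpha> \<epsilon>\<rceil>" for \<epsilon>
  \<comment> \<open>The summand 1 keeps K positive when V = 0.\<close>
  define K where "K \<epsilon> = nat \<lceil>4 * V / (\<alpha> \<epsilon> * \<epsilon>)\<rceil> + 1" for \<epsilon>
  define par where "par \<epsilon> = C.parK (K \<epsilon>) (S1 \<epsilon>) (\<alpha> \<epsilon>)" for \<epsilon>
  have S1_ge: "1 / \<alpha> \<epsilon> \<le> real (S1 \<epsilon>)" for \<epsilon> unfolding S1_def by (rule real_nat_ceiling_ge)
  have K_ge: "4 * V / (\<alpha> \<epsilon> * \<epsilon>) \<le> real (K \<epsilon>)" for \<epsilon>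
    using real_nat_ceiling_ge[of "4 * V / (\<alpha> \<epsilon> * \<epsilon>)"] unfolding K_def by simp
  have K_pos: "0 < K \<epsilon>" for \<epsilon> by (simp add: K_def)
  have main: "0 < K \<epsilon> \<and> 0 < S1 \<epsilon> \<and>
       par \<epsilon> = \<lparr> period = K \<epsilon>, y_iters = T, v_iters = J, batch_init = S1 \<epsilon>, batch_inner = S2,
                 rate_y = lam1, rate_v = lam2,
                 step_x = \<alpha> \<epsilon>, step_y = C_beta * \<alpha> \<epsilon>, step_v = C_eta * \<alpha> \<epsilon>,
                 mom_x = C_etax * (\<alpha> \<epsilon>)\<^sup>2, mom_y = C_etay * (\<alpha> \<epsilon>)\<^sup>2, mom_v = C_etav * (\<alpha> \<epsilon>)\<^sup>2,
                 radius = M \<rparr> \<and>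
       (\<forall>(P :: 'w measure) Z \<kappa>. als_randomness P Mxi Mzeta Z (K \<epsilon>) \<kappa> \<longrightarrow>
          eps_stationary P (hyper_objective f g) \<epsilon> (als_output F G (par \<epsilon>) x0 y0 v0 Z \<kappa>))"
    if e: "0 < \<epsilon>" for \<epsilon>
  proof (intro conjI allI impI)
    show "0 < K \<epsilon>" by (rule K_pos)
    then show "eps_stationary P (hyper_objective f g) \<epsilon> (als_output F G (par \<epsilon>) x0 y0 v0 Z \<kappa>)"
      if "als_randomness P Mxi Mzeta Z (K \<epsilon>) \<kappa>" for P :: "'w measure" and Z \<kappa>
      unfolding par_def
      by (intro C.parK_stationary[OF \<alpha>_pos[OF e] \<alpha>_C8 \<alpha>_noise[OF e] e L _ S1_ge K_ge _ that])
         (simp_all add: V_def)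
    show "0 < S1 \<epsilon>" using S1_ge[of \<epsilon>] \<alpha>_pos[OF e]
      by (metis divide_pos_pos less_le_trans of_nat_0_less_iff zero_less_one)
  qed (simp add: par_def C.parK_def)
  \<comment> \<open>Near 0 one has sqrt \<epsilon> \<le> 1, so 1 / \<alpha> is at most 1 / (c sqrt
    \<epsilon>), and dividing by \<epsilon> gives the order \<epsilon>^(-3/2) of K.\<close>
  have near: "real (S1 \<epsilon>) \<le> (1 / c + 1) * \<epsilon> powr (- (1/2)) \<and> real (K \<epsilon>) \<le> (4 * V / c + 2) * \<epsilon> powr (- (3/2))
      \<and> \<epsilon> powr (- (1/2)) \<le> \<epsilon> powr (- (3/2))"
    if e: "0 < \<epsilon>" "\<epsilon> < 1" for \<epsilon>
  proof -
    have sq: "0 < sqrt \<epsilon>" "sqrt \<epsilon> \<le> 1" using e by simp_all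
    have p: "\<epsilon> powr (- (1/2)) = 1 / sqrt \<epsilon>"
      unfolding powr_minus_divide powr_half_sqrt[OF less_imp_le[OF e(1)]] ..
    have "\<epsilon> powr (- (3/2)) = \<epsilon> powr (- 1 + - (1/2))" by simp
    also have "\<dots> = \<epsilon> powr (- 1) * \<epsilon> powr (- (1/2))" by (rule powr_add)
    also have "\<dots> = 1 / (sqrt \<epsilon> * \<epsilon>)" unfolding p unfolding powr_minus_divide using e by simp
    finally have p3: "\<epsilon> powr (- (3/2)) = 1 / (sqrt \<epsilon> * \<epsilon>)" .
    have se: "0 < sqrt \<epsilon> * \<epsilon>" "sqrt \<epsilon> * \<epsilon> \<le> sqrt \<epsilon>" "sqrt \<epsilon> * \<epsilon> \<le> 1"
      using sq e by (auto simp: mult_le_one)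
    have a: "sqrt \<epsilon> * c \<le> \<alpha> \<epsilon>" using \<alpha>_lower[OF e(1)] unfolding min.absorb2[OF sq(2)] .
    have ap: "0 < \<alpha> \<epsilon>" by (rule \<alpha>_pos[OF e(1)])
    have nat_ceiling: "real (nat \<lceil>x\<rceil>) \<le> x + 1" if "0 \<le> x" for x :: real
    proof -
      have "real (nat \<lceil>x\<rceil>) = real_of_int \<lceil>x\<rceil>" using that by (intro of_nat_nat) simp
      then show ?thesis using ceiling_correct[of x] by linarith
    qed
    have "real (S1 \<epsilon>) \<le> 1 / \<alpha> \<epsilon> + 1"
      unfolding S1_def using ap by (intro nat_ceiling) simp
    also have "\<dots> \<le> 1 / (sqrt \<epsilon> * c) + 1 / sqrt \<epsilon>"
      using a ap sq c by (intro add_mono divide_left_mono) auto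
    also have "\<dots> = (1 / c + 1) * \<epsilon> powr (- (1/2))" unfolding p using sq c by (simp add: field_simps)
    finally have 1: "real (S1 \<epsilon>) \<le> (1 / c + 1) * \<epsilon> powr (- (1/2))" .
    have V0: "0 \<le> V" by (simp add: V_def)
    have "0 \<le> 4 * V / (\<alpha> \<epsilon> * \<epsilon>)" using V0 ap e by simp
    from nat_ceiling[OF this] have "real (K \<epsilon>) \<le> 4 * V / (\<alpha> \<epsilon> * \<epsilon>) + 2"
      unfolding K_def of_nat_add by linarith
    also have "\<dots> \<le> 4 * V / (sqrt \<epsilon> * c * \<epsilon>) + 2 / (sqrt \<epsilon> * \<epsilon>)"
      using a ap sq c e V0 se by (intro add_mono divide_left_mono mult_right_mono) (auto simp: field_simps)
    also have "\<dots> = (4 * V / c + 2) * \<epsilon> powr (- (3/2))" unfolding p3 using sq c e by (simp add: field_simps)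
    finally have 2: "real (K \<epsilon>) \<le> (4 * V / c + 2) * \<epsilon> powr (- (3/2))" .
    have "1 / sqrt \<epsilon> \<le> 1 / (sqrt \<epsilon> * \<epsilon>)" using se sq by (intro divide_left_mono) auto
    then show ?thesis using 1 2 unfolding p p3 by blast
  qed
  have ev: "eventually (\<lambda>\<epsilon>. 0 < \<epsilon> \<and> \<epsilon> < 1) (at_right (0::real))"
    unfolding eventually_at_right_field by (intro exI[of _ 1]) auto
  have O1: "(\<lambda>\<epsilon>. real (S1 \<epsilon>)) \<in> O[at_right 0](\<lambda>\<epsilon>. \<epsilon> powr (- (1/2)))"
    by (rule bigoI[where c="1 / c + 1"], rule eventually_mono[OF ev]) (use near in auto)
  \<comment> \<open>Below K only k = 0 is divisible by the period K, so the first batches are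
    charged once, at 2 + 1 + 2 evaluations per sample index.\<close>
  have cost: "sample_complexity (par \<epsilon>) (K \<epsilon>) = S1 \<epsilon> * 5 + K \<epsilon> * (T * (S2 * 2) + J * (S2 * 4 + S2 * 4))" for \<epsilon>
  proof -
    have "(\<Sum>k<n. (if k mod n = 0 then a else 0) + b) = a + n * b" if "0 < n" for n a b :: nat
    proof -
      have "(\<Sum>k<n. if k mod n = 0 then a else 0) = (\<Sum>k<n. if k = 0 then a else 0)"
        by (intro sum.cong) auto
      also have "\<dots> = a" using that by simp
      finally show ?thesis unfolding sum.distrib by simp
    qed
    from this[of "K \<epsilon>" "S1 \<epsilon> * (2 + 1 + 2)" "T * (S2 * 2) + J * (S2 * 4 + S2 * 4)"] show ?thesis
      unfolding sample_complexity_def par_def C.parK_def using K_pos by (simp add: add.assoc cong: if_cong)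
  qed
  define d where "d = real (T * (S2 * 2) + J * (S2 * 4 + S2 * 4))"
  have O2: "(\<lambda>\<epsilon>. real (sample_complexity (par \<epsilon>) (K \<epsilon>))) \<in> O[at_right 0](\<lambda>\<epsilon>. \<epsilon> powr (- (3/2)))"
  proof (rule bigoI[where c="(1 / c + 1) * 5 + (4 * V / c + 2) * d"], rule eventually_mono[OF ev])
    fix \<epsilon> :: real assume e: "0 < \<epsilon> \<and> \<epsilon> < 1"
    have "real (sample_complexity (par \<epsilon>) (K \<epsilon>)) = real (S1 \<epsilon>) * 5 + real (K \<epsilon>) * d"
      unfolding cost d_def by simp
    also have "\<dots> \<le> (1 / c + 1) * \<epsilon> powr (- (3/2)) * 5 + (4 * V / c + 2) * \<epsilon> powr (- (3/2)) * d"
    proof (intro add_mono mult_right_mono)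
      \<comment> \<open>The first batches are of the lower order \<epsilon>^(-1/2) and are absorbed
        because \<epsilon> < 1.\<close>
      have "(1 / c + 1) * \<epsilon> powr (- (1/2)) \<le> (1 / c + 1) * \<epsilon> powr (- (3/2))"
        using near e c by (intro mult_left_mono) auto
      then show "real (S1 \<epsilon>) \<le> (1 / c + 1) * \<epsilon> powr (- (3/2))" using near e by fastforce
      show "real (K \<epsilon>) \<le> (4 * V / c + 2) * \<epsilon> powr (- (3/2))" using near e by blast
    qed (simp_all add: d_def)
    finally show "norm (real (sample_complexity (par \<epsilon>) (K \<epsilon>)))
        \<le> ((1 / c + 1) * 5 + (4 * V / c + 2) * d) * norm (\<epsilon> powr (- (3/2)))"
      by (simp add: algebra_simps)
  qed
  show ?thesis using main O1 O2 by blast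
qed

end
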